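(* Let $L$ be a Lagrangian satisfying the following Lipschitz condition: for every $R>0$ there is $C\ge0$ such that $|L(x,y_1,p)-L(x,y_2,p)|\le C|y_1-y_2|$ whenever $|x|,|y_1|,|y_2|,|p|\le R$. Then the universal singular set of $L$ is a countable union of closed subsets of $\mathbb{R}^2$. In particular, it is a set of the first Baire category in $\mathbb{R}^2$.
   Context: A function $\omega\colon\mathbb{R}\to\mathbb{R}$ is superlinear if $\lim_{|p|\to\infty}\omega(p)/|p|=\infty$. A Lagrangian is a function $L\colon\mathbb{R}^3\to\mathbb{R}$ that is Borel measurable, bounded from below, locally bounded from above, and for which there is a superlinear function $\omega\colon\mathbb{R}\to\mathbb{R}$ with $L(x,y,p)\ge\omega(p)$ for all $(x,y,p)\in\mathbb{R}^3$. $AC[a,b]$ denotes the absolutely continuous real-valued functions on $[a,b]$. For $a<b$ and $u\in AC[a,b]$ put $\mathcal{L}(u;a,b)=\int_a^b L(x,u(x),u'(x))\,dx\in(-\infty,\infty]$, $\mathcal{L}(a,A;b,B)=\inf\{\mathcal{L}(v;a,b):v\in AC[a,b],\ v(a)=A,\ v(b)=B\}$, and define the excess $\mathcal{E}(u;a,b)=\mathcal{L}(u;a,b)-\mathcal{L}(a,u(a);b,u(b))$. A function $u\in C[a,b]$ is a generalized minimizer for $L$ on $[a,b]$ if its restriction to $(a,b)$ is a locally uniform limit of a sequence $u_n\in AC[a_n,b_n]$ with $\mathcal{E}(u_n;a_n,b_n)\to0$ (in particular $\limsup a_n\le a$ and $\liminf b_n\ge b$). The universal singular set of $L$ is the set of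 all $(x_0,y_0)\in\mathbb{R}^2$ for which there are $a\le x_0\le b$ with $a<b$ and a generalized minimizer $u$ for $L$ on $[a,b]$ such that $u(x_0)=y_0$ and $u$ has infinite derivative ($+\infty$ or $-\infty$; one-sided if $x_0$ is an endpoint) at $x_0$. *)

theory Defs
  imports "HOL-Analysis.Analysis"
begin

definition superlinear :: "(real \<Rightarrow> real) \<Rightarrow> bool" where
  "superlinear \<omega> \<longleftrightarrow> filterlim (\<lambda>p. \<omega> p / \<bar>p\<bar>) at_top at_infinity"

definition lagrangian :: "(real \<times> real \<times> real \<Rightarrow> real) \<Rightarrow> bool" where
  "lagrangian L \<longleftrightarrow>
     L \<in> borel_measurable borel \<and>
     bdd_below (range L) \<and>
     (\<forall>z. \<exists>U. open U \<and> z \<in> U \<and> bdd_above (L ` U)) \<and>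
     (\<exists>\<omega>. superlinear \<omega> \<and> (\<forall>x y p. \<omega> p \<le> L (x, y, p)))"

text \<open>
  Functions on \<open>[a, b]\<close> are represented by total functions of which only the values on
  \<open>{a..b}\<close> matter. In the definition of absolute continuity, a finite family of
  non-overlapping intervals is given by the set of pairs of its end points.
\<close>

definition abs_cont :: "real \<Rightarrow> real \<Rightarrow> (real \<Rightarrow> real) \<Rightarrow> bool" where
  "abs_cont a b u \<longleftrightarrow>
     (\<forall>\<epsilon>>0. \<exists>\<delta>>0. \<forall>I.
        finite I \<and>
        (\<forall>(s, t)\<in>I. a \<le> s \<and> s \<le> t \<and> t \<le> b) \<and>
        pairwise (\<lambda>(s, t) (s', t'). {s<..<t} \<inter> {s'<..<t'} = {}) I \<and>
        (\<Sum>(s, t)\<in>I. t - s) < \<delta>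
        \<longrightarrow> (\<Sum>(s, t)\<in>I. \<bar>u t - u s\<bar>) < \<epsilon>)"

text \<open>
  The integral with values in \<open>(-\<infinity>, \<infinity>]\<close> is the integral of the positive part minus that of
  the negative part (the coercion \<open>ennreal\<close> maps negative reals to 0); the latter is finite when
  \<open>L\<close> is bounded below. An absolutely continuous \<open>u\<close> is differentiable almost everywhere, and
  the value of \<open>deriv u\<close> on the exceptional null set (including the end points, where it may
  depend on \<open>u\<close> outside \<open>{a..b}\<close>) is irrelevant.
\<close>

definition action ::
    "(real \<times> real \<times> real \<Rightarrow> real) \<Rightarrow> (real \<Rightarrow> real) \<Rightarrow> real \<Rightarrow> real \<Rightarrow> ereal" where
  "action L u a b =
     enn2ereal (\<integral>\<^sup>+x. ennreal (L (x, u x, deriv u x)) \<partial>lebesgue_on {a..b}) -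
     enn2ereal (\<integral>\<^sup>+x. ennreal (- L (x, u x, deriv u x)) \<partial>lebesgue_on {a..b})"

definition least_action ::
    "(real \<times> real \<times> real \<Rightarrow> real) \<Rightarrow> real \<Rightarrow> real \<Rightarrow> real \<Rightarrow> real \<Rightarrow> ereal" where
  "least_action L a A b B = (INF v \<in> {v. abs_cont a b v \<and> v a = A \<and> v b = B}. action L v a b)"

definition excess ::
    "(real \<times> real \<times> real \<Rightarrow> real) \<Rightarrow> (real \<Rightarrow> real) \<Rightarrow> real \<Rightarrow> real \<Rightarrow> ereal" where
  "excess L u a b = action L u a b - least_action L a (u a) b (u b)"

text \<open>
  Locally uniform convergence on \<open>(a, b)\<close> is uniform convergence on its compact subsets. The
  function \<open>us n\<close> is only meaningful on \<open>[as n, bs n]\<close>, so each compact subset has to lie in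
  these intervals for all large \<open>n\<close>.
\<close>

definition generalized_minimizer ::
    "(real \<times> real \<times> real \<Rightarrow> real) \<Rightarrow> (real \<Rightarrow> real) \<Rightarrow> real \<Rightarrow> real \<Rightarrow> bool" where
  "generalized_minimizer L u a b \<longleftrightarrow>
     continuous_on {a..b} u \<and>
     (\<exists>us as bs.
        (\<forall>n. as n < bs n \<and> abs_cont (as n) (bs n) (us n)) \<and>
        (\<lambda>n. excess L (us n) (as n) (bs n)) \<longlonglongrightarrow> 0 \<and>
        (\<forall>K. compact K \<and> K \<subseteq> {a<..<b} \<longrightarrow>
           (\<forall>\<^sub>F n in sequentially. K \<subseteq> {as n..bs n}) \<and>
           uniform_limit K us u sequentially))"

definition infinite_derivative_within :: "(real \<Rightarrow> real) \<Rightarrow> real \<Rightarrow> real set \<Rightarrow> bool" where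
  "infinite_derivative_within u x0 S \<longleftrightarrow>
     filterlim (\<lambda>x. (u x - u x0) / (x - x0)) at_top (at x0 within S) \<or>
     filterlim (\<lambda>x. (u x - u x0) / (x - x0)) at_bot (at x0 within S)"

definition universal_singular_set :: "(real \<times> real \<times> real \<Rightarrow> real) \<Rightarrow> (real \<times> real) set" where
  "universal_singular_set L =
     {(x0, y0). \<exists>a b u. a \<le> x0 \<and> x0 \<le> b \<and> a < b \<and> generalized_minimizer L u a b \<and>
        u x0 = y0 \<and> infinite_derivative_within u x0 {a..b}}"

definition nowhere_dense :: "'a::topological_space set \<Rightarrow> bool" where
  "nowhere_dense S \<longleftrightarrow> interior (closure S) = {}"

definition first_category :: "'a::topological_space set \<Rightarrow> bool" where
  "first_category S \<longleftrightarrow> (\<exists>F :: nat \<Rightarrow> 'a set. (\<forall>n. nowhere_dense (F n)) \<and> S = (\<Union>n. F n))"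

end

theory Submission
  imports Defs "HOL-Complex_Analysis.Great_Picard"
begin

text \<open>
  Let \<open>- B\<close> be a lower bound of the Lagrangian \<open>L\<close> and put \<open>\<Lambda> = L + B\<close>. Up to the constant \<open>B (b - a)\<close> the
  action of \<open>u\<close> is the energy \<open>\<integral> \<Lambda>(x, u, u') dx \<ge> 0\<close>, and a small excess says that \<open>u\<close> is a near minimizer:
  no curve with the same end points has an energy that is smaller by more than a given tolerance.

  The proof rests on one exchange argument (\<open>near_min_steep_part\<close>). On a short interval over which the
  chord of a near minimizer \<open>u\<close> has slope at most \<open>M\<close>, comparison with the chord bounds the energy by a
  multiple of the length, so \<open>\<bar>u'\<bar> \<le> P\<close> on half of the interval. Replace the slope by \<open>0\<close> where \<open>\<bar>u'\<bar> > K\<close>, and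
  restore the displacement \<open>D\<close> that is lost in this way by changing the slope by one on a set of measure at
  most \<open>D\<close> on which \<open>\<bar>u'\<bar> \<le> P\<close>. By superlinearity the first change saves at least \<open>N D\<close> with \<open>N\<close> as large as
  desired. The second one costs a multiple of \<open>D\<close>. Elsewhere the slope is unchanged and at most \<open>K\<close>, and
  the graph moves by at most \<open>2 D\<close>, so there the Lipschitz condition, which is only available for bounded
  slopes, suffices to bound the cost by \<open>D\<close> on a short interval. Hence \<open>D\<close> is at most the tolerance.
  In the limit of vanishing tolerance a generalized minimizer with a shallow chord over a short
  interval is Lipschitz there, so all chords at a point of infinite derivative are steeper than \<open>M\<close> up to
  a scale that depends only on \<open>M\<close> and on a bound for the curve (\<open>uniformly_steep\<close>).

  \<^bold>\<open>Closedness.\<close> Fix a length \<open>d\<close> and a bound \<open>R\<close>, and consider the points at which a generalized minimizer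
  over \<open>[x0, x0 + d]\<close> that is bounded by \<open>R\<close> starts with derivative \<open>+\<infinity>\<close>. Such minimizers are
  equicontinuous, a uniform limit of them is again a generalized minimizer, and the uniform steepness
  survives in the limit, so that the set of these points is closed (\<open>closed_right_singular_set\<close>).

  \<^bold>\<open>Empty interior.\<close> Suppose that all points of a horizontal segment at height \<open>y0\<close> belong to this set. Let
  \<open>V(t)\<close> be the least energy of a curve from \<open>(t, y0)\<close> to a fixed point that lies to the right of the
  segment and above all the minimizers. From \<open>(t, y0)\<close> follow a line of slope about one up to the height
  \<open>y0 + r\<close> and then the minimizer that starts at \<open>(t + r, y0)\<close>. This curve crosses every competitor for
  \<open>V(t + r)\<close>, and exchanging the ends of the two curves at the crossing gives a competitor for \<open>V(t)\<close> and
  another one for the minimizer. Therefore \<open>V(t) \<le> V(t + r) - G\<close>, where \<open>G\<close> is the energy of the steep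
  part of the minimizer that has been avoided minus the energy of the line. By superlinearity
  \<open>G \<ge> \<kappa> r\<close> with \<open>\<kappa> \<rightarrow> \<infinity>\<close> as \<open>r \<rightarrow> 0\<close>. Summation along the segment contradicts the bounds
  on \<open>V\<close> (\<open>no_singular_segment\<close>).

  Reflections in both variables carry right end points and the derivative \<open>-\<infinity>\<close> to this case, and the
  universal singular set is the union of countably many reflected sets of this kind.

  An absolutely continuous function enters the energy through an integrable density of which it is an
  integral. Its existence follows from the Radon-Nikodym theorem, applied to the monotone parts of
  the function, and the density agrees almost everywhere with the derivative by Lebesgue differentiation.
\<close>

section \<open>Total variation of absolutely continuous functions\<close>

text \<open>
  Families indexed by an arbitrary finite set are easier to build than sets of pairs: degenerate intervals
  may then occur several times.
\<close>

lemma abs_cont_indexed: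
  assumes "abs_cont a b u" "\<epsilon> > 0"
  obtains \<delta> where "\<delta> > 0"
    "\<And>(A::'i set) s t. \<lbrakk>finite A; \<And>i. i \<in> A \<Longrightarrow> a \<le> s i \<and> s i \<le> t i \<and> t i \<le> b;
       \<And>i j. \<lbrakk>i \<in> A; j \<in> A; i \<noteq> j\<rbrakk> \<Longrightarrow> {s i<..<t i} \<inter> {s j<..<t j} = {};
       (\<Sum>i\<in>A. t i - s i) < \<delta>\<rbrakk> \<Longrightarrow> (\<Sum>i\<in>A. \<bar>u (t i) - u (s i)\<bar>) < \<epsilon>"
proof -
  obtain \<delta> where \<delta>: "\<delta> > 0" and *: "\<And>I. finite I \<Longrightarrow> (\<forall>(s, t)\<in>I. a \<le> s \<and> s \<le> t \<and> t \<le> b) \<Longrightarrow>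
        pairwise (\<lambda>(s, t) (s', t'). {s<..<t} \<inter> {s'<..<t'} = {}) I \<Longrightarrow>
        (\<Sum>(s, t)\<in>I. t - s) < \<delta> \<Longrightarrow> (\<Sum>(s, t)\<in>I. \<bar>u t - u s\<bar>) < \<epsilon>"
    using assms unfolding abs_cont_def by meson
  show thesis
  proof (rule that[OF \<delta>])
    fix A :: "'i set" and s t :: "'i \<Rightarrow> real"
    assume fin: "finite A" and le: "\<And>i. i \<in> A \<Longrightarrow> a \<le> s i \<and> s i \<le> t i \<and> t i \<le> b"
      and disj: "\<And>i j. \<lbrakk>i \<in> A; j \<in> A; i \<noteq> j\<rbrakk> \<Longrightarrow> {s i<..<t i} \<inter> {s j<..<t j} = {}"
      and small: "(\<Sum>i\<in>A. t i - s i) < \<delta>"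
    let ?B = "{i\<in>A. s i < t i}" and ?f = "\<lambda>i. (s i, t i)"
    have inj: "inj_on ?f ?B"
    proof (rule inj_onI, rule ccontr)
      fix i j assume ij: "i \<in> ?B" "j \<in> ?B" "?f i = ?f j" "i \<noteq> j"
      then have "{s i<..<t i} \<inter> {s i<..<t i} = {}" using disj[of i j] by auto
      with ij dense[of "s i" "t i"] show False by auto
    qed
    have eq: "(\<Sum>i\<in>A. f i) = (\<Sum>i\<in>?B. f i)" if "\<And>i. s i = t i \<Longrightarrow> f i = 0" for f :: "'i \<Rightarrow> real"
      using le that by (intro sum.mono_neutral_right) (auto simp: fin, metis linorder_not_less order_antisym)
    have "(\<Sum>(s, t)\<in>?f ` ?B. \<bar>u t - u s\<bar>) < \<epsilon>"
    proof (rule *)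
      show "pairwise (\<lambda>(s, t) (s', t'). {s<..<t} \<inter> {s'<..<t'} = {}) (?f ` ?B)"
        unfolding pairwise_def using disj by fastforce
      show "(\<Sum>(s, t)\<in>?f ` ?B. t - s) < \<delta>"
        using small eq[of "\<lambda>i. t i - s i"] by (simp add: sum.reindex[OF inj])
    qed (use le fin in auto)
    then show "(\<Sum>i\<in>A. \<bar>u (t i) - u (s i)\<bar>) < \<epsilon>"
      using eq[of "\<lambda>i. \<bar>u (t i) - u (s i)\<bar>"] by (simp add: sum.reindex[OF inj])
  qed
qed

lemma abs_cont_subinterval:
  assumes "abs_cont a b u" "a \<le> s" "t \<le> b" shows "abs_cont s t u"
  unfolding abs_cont_def
proof (intro allI impI)
  fix \<epsilon> :: real assume "\<epsilon> > 0"
  then obtain \<delta> where "\<delta> > 0" and *: "\<forall>I. finite I \<and> (\<forall>(s, t)\<in>I. a \<le> s \<and> s \<le> t \<and> t \<le> b) \<and>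
        pairwise (\<lambda>(s, t) (s', t'). {s<..<t} \<inter> {s'<..<t'} = {}) I \<and>
        (\<Sum>(s, t)\<in>I. t - s) < \<delta> \<longrightarrow> (\<Sum>(s, t)\<in>I. \<bar>u t - u s\<bar>) < \<epsilon>"
    using assms(1) unfolding abs_cont_def by meson
  have "(\<forall>(s, t)\<in>I. a \<le> s \<and> s \<le> t \<and> t \<le> b)" if "(\<forall>(s', t')\<in>I. s \<le> s' \<and> s' \<le> t' \<and> t' \<le> t)" for I
    using that assms by fastforce
  with * \<open>\<delta> > 0\<close> show "\<exists>\<delta>>0. \<forall>I. finite I \<and> (\<forall>(s', t')\<in>I. s \<le> s' \<and> s' \<le> t' \<and> t' \<le> t) \<and>
        pairwise (\<lambda>(s, t) (s', t'). {s<..<t} \<inter> {s'<..<t'} = {}) I \<and>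
        (\<Sum>(s, t)\<in>I. t - s) < \<delta> \<longrightarrow> (\<Sum>(s, t)\<in>I. \<bar>u t - u s\<bar>) < \<epsilon>"
    by meson
qed

lemma abs_cont_continuous_on:
  assumes "abs_cont a b u" shows "continuous_on {a..b} u"
  unfolding continuous_on_iff
proof (intro ballI allI impI)
  fix x e :: real assume x: "x \<in> {a..b}" and "e > 0"
  obtain \<delta> where \<delta>: "\<delta> > 0"
    "\<And>(A::unit set) s t. \<lbrakk>finite A; \<And>i. i \<in> A \<Longrightarrow> a \<le> s i \<and> s i \<le> t i \<and> t i \<le> b;
       \<And>i j. \<lbrakk>i \<in> A; j \<in> A; i \<noteq> j\<rbrakk> \<Longrightarrow> {s i<..<t i} \<inter> {s j<..<t j} = {};
       (\<Sum>i\<in>A. t i - s i) < \<delta>\<rbrakk> \<Longrightarrow> (\<Sum>i\<in>A. \<bar>u (t i) - u (s i)\<bar>) < e"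
    by (fact abs_cont_indexed[OF assms \<open>e > 0\<close>])
  have "dist (u y) (u x) < e" if "y \<in> {a..b}" "dist y x < \<delta>" for y
    using \<delta>(2)[of "{()}" "\<lambda>_. min x y" "\<lambda>_. max x y"] that x
    by (cases "x \<le> y") (auto simp: dist_real_def min_def max_def abs_minus_commute)
  then show "\<exists>d>0. \<forall>x'\<in>{a..b}. dist x' x < d \<longrightarrow> dist (u x') (u x) < e" using \<delta>(1) by blast
qed

lemma abs_cont_diff:
  assumes "abs_cont a b u" "abs_cont a b v" shows "abs_cont a b (\<lambda>x. u x - v x)"
  unfolding abs_cont_def
proof (intro allI impI)
  fix \<epsilon> :: real assume "\<epsilon> > 0"
  then have "\<epsilon>/2 > 0" by simp
  let ?P = "\<lambda>u \<delta> \<epsilon> I. finite I \<and> (\<forall>(s, t)\<in>I. a \<le> s \<and> s \<le> t \<and> t \<le> b) \<and>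
        pairwise (\<lambda>(s, t) (s', t'). {s<..<t} \<inter> {s'<..<t'} = {}) I \<and>
        (\<Sum>(s, t)\<in>I. t - s) < \<delta> \<longrightarrow> (\<Sum>(s, t)\<in>I. \<bar>u t - u s\<bar>) < \<epsilon>"
  obtain d1 where d1: "d1 > 0" "\<And>I. ?P u d1 (\<epsilon>/2) I"
    using assms(1) \<open>\<epsilon>/2 > 0\<close> unfolding abs_cont_def by blast
  obtain d2 where d2: "d2 > 0" "\<And>I. ?P v d2 (\<epsilon>/2) I"
    using assms(2) \<open>\<epsilon>/2 > 0\<close> unfolding abs_cont_def by blast
  have "?P (\<lambda>x. u x - v x) (min d1 d2) \<epsilon> I" for I
  proof
    assume I: "finite I \<and> (\<forall>(s, t)\<in>I. a \<le> s \<and> s \<le> t \<and> t \<le> b) \<and>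
        pairwise (\<lambda>(s, t) (s', t'). {s<..<t} \<inter> {s'<..<t'} = {}) I \<and>
        (\<Sum>(s, t)\<in>I. t - s) < min d1 d2"
    have "(\<Sum>(s, t)\<in>I. \<bar>(u t - v t) - (u s - v s)\<bar>) \<le> (\<Sum>(s, t)\<in>I. \<bar>u t - u s\<bar> + \<bar>v t - v s\<bar>)"
      by (intro sum_mono) auto
    also have "\<dots> = (\<Sum>(s, t)\<in>I. \<bar>u t - u s\<bar>) + (\<Sum>(s, t)\<in>I. \<bar>v t - v s\<bar>)"
      by (simp add: sum.distrib split_beta)
    also have "\<dots> < \<epsilon>" using d1(2)[of I] d2(2)[of I] I by simp
    finally show "(\<Sum>(s, t)\<in>I. \<bar>(u t - v t) - (u s - v s)\<bar>) < \<epsilon>" .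
  qed
  then show "\<exists>\<delta>>0. \<forall>I. ?P (\<lambda>x. u x - v x) \<delta> \<epsilon> I"
    using d1 d2 by (intro exI[of _ "min d1 d2"]) auto
qed

text \<open>
  A chain of points is a monotone function on the natural numbers of which only finitely many values are
  used. Clipping a chain at a point then needs no reindexing.
\<close>

definition variation_sums :: "(real \<Rightarrow> real) \<Rightarrow> real \<Rightarrow> real \<Rightarrow> real set" where
  "variation_sums u s t =
     {(\<Sum>i<n. \<bar>u (p (Suc i)) - u (p i)\<bar>) | n p. mono p \<and> p 0 = s \<and> p n = t}"

definition total_variation :: "(real \<Rightarrow> real) \<Rightarrow> real \<Rightarrow> real \<Rightarrow> real" where
  "total_variation u s t = Sup (variation_sums u s t)"

lemma variation_sumsI:
  "\<lbrakk>mono p; p 0 = s; p n = t\<rbrakk> \<Longrightarrow> (\<Sum>i<n. \<bar>u (p (Suc i)) - u (p i)\<bar>) \<in> variation_sums u s t"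
  unfolding variation_sums_def by blast

lemma variation_sums_increment:
  assumes "s \<le> t" shows "\<bar>u t - u s\<bar> \<in> variation_sums u s t"
proof -
  have "mono (\<lambda>i::nat. if i = 0 then s else t)" using assms by (auto simp: mono_def)
  from variation_sumsI[OF this, of s "Suc 0" t u] show ?thesis by simp
qed

lemma variation_sums_split:
  assumes "x \<in> variation_sums u s t" "s \<le> c" "c \<le> t"
  obtains y z where "y \<in> variation_sums u s c" "z \<in> variation_sums u c t" "x \<le> y + z"
proof -
  obtain n p where p: "mono p" "p 0 = s" "p n = t" and x: "x = (\<Sum>i<n. \<bar>u (p (Suc i)) - u (p i)\<bar>)"
    using assms(1) unfolding variation_sums_def by blast
  let ?q = "\<lambda>i. min (p i) c" and ?r = "\<lambda>i. max (p i) c"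
  have 1: "(\<Sum>i<n. \<bar>u (?q (Suc i)) - u (?q i)\<bar>) \<in> variation_sums u s c"
    using p assms by (intro variation_sumsI) (auto simp: mono_def min_def intro: order_trans)
  have 2: "(\<Sum>i<n. \<bar>u (?r (Suc i)) - u (?r i)\<bar>) \<in> variation_sums u c t"
    using p assms by (intro variation_sumsI) (auto simp: mono_def max_def intro: order_trans)
  have "\<bar>u (p (Suc i)) - u (p i)\<bar> \<le> \<bar>u (?q (Suc i)) - u (?q i)\<bar> + \<bar>u (?r (Suc i)) - u (?r i)\<bar>" for i
    by (auto simp: min_def max_def)
  then have "x \<le> (\<Sum>i<n. \<bar>u (?q (Suc i)) - u (?q i)\<bar>) + (\<Sum>i<n. \<bar>u (?r (Suc i)) - u (?r i)\<bar>)"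
    unfolding x sum.distrib[symmetric] by (intro sum_mono)
  with 1 2 that show thesis by blast
qed

lemma variation_sums_extend:
  assumes "x \<in> variation_sums u s c" "c \<le> t"
  shows "x + \<bar>u t - u c\<bar> \<in> variation_sums u s t"
proof -
  obtain n p where p: "mono p" "p 0 = s" "p n = c" and x: "x = (\<Sum>i<n. \<bar>u (p (Suc i)) - u (p i)\<bar>)"
    using assms(1) unfolding variation_sums_def by blast
  let ?q = "\<lambda>i. if i \<le> n then p i else t"
  have "p i \<le> t" if "i \<le> n" for i using monoD[OF p(1) that] p assms(2) by simp
  then have "mono ?q" using p(1) by (auto simp: mono_def)
  moreover have "(\<Sum>i<Suc n. \<bar>u (?q (Suc i)) - u (?q i)\<bar>) = x + \<bar>u t - u c\<bar>"
    unfolding x using p by (auto intro!: sum.cong)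
  ultimately show ?thesis
    using variation_sumsI[of ?q s "Suc n" t u] p by simp
qed

text \<open>
  Splitting each interval of a short family by a chain of points leaves the total length
  unchanged, so absolute continuity controls the variation sums over the family as well.
\<close>

lemma abs_cont_variation:
  assumes "abs_cont a b u" "\<epsilon> > 0"
  obtains \<delta> where "\<delta> > 0"
    "\<And>(J::'j set) s t w. \<lbrakk>finite J; \<And>j. j \<in> J \<Longrightarrow> a \<le> s j \<and> t j \<le> b;
       \<And>i j. \<lbrakk>i \<in> J; j \<in> J; i \<noteq> j\<rbrakk> \<Longrightarrow> {s i<..<t i} \<inter> {s j<..<t j} = {};
       (\<Sum>j\<in>J. t j - s j) < \<delta>; \<And>j. j \<in> J \<Longrightarrow> w j \<in> variation_sums u (s j) (t j)\<rbrakk>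
      \<Longrightarrow> (\<Sum>j\<in>J. w j) < \<epsilon>"
proof -
  obtain \<delta> where \<delta>: "\<delta> > 0"
    and *: "\<And>(A::('j \<times> nat) set) s t. \<lbrakk>finite A; \<And>i. i \<in> A \<Longrightarrow> a \<le> s i \<and> s i \<le> t i \<and> t i \<le> b;
       \<And>i j. \<lbrakk>i \<in> A; j \<in> A; i \<noteq> j\<rbrakk> \<Longrightarrow> {s i<..<t i} \<inter> {s j<..<t j} = {};
       (\<Sum>i\<in>A. t i - s i) < \<delta>\<rbrakk> \<Longrightarrow> (\<Sum>i\<in>A. \<bar>u (t i) - u (s i)\<bar>) < \<epsilon>"
    by (fact abs_cont_indexed[OF assms])
  show thesis
  proof (rule that[OF \<delta>])
    fix J :: "'j set" and s t w
    assume fin: "finite J" and ab: "\<And>j. j \<in> J \<Longrightarrow> a \<le> s j \<and> t j \<le> b"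
      and disj: "\<And>i j. \<lbrakk>i \<in> J; j \<in> J; i \<noteq> j\<rbrakk> \<Longrightarrow> {s i<..<t i} \<inter> {s j<..<t j} = {}"
      and small: "(\<Sum>j\<in>J. t j - s j) < \<delta>" and w: "\<And>j. j \<in> J \<Longrightarrow> w j \<in> variation_sums u (s j) (t j)"
    have "\<forall>j\<in>J. \<exists>n p. mono p \<and> p 0 = s j \<and> p n = t j \<and> w j = (\<Sum>i<n. \<bar>u (p (Suc i)) - u (p i)\<bar>)"
      using w unfolding variation_sums_def by blast
    then obtain n p where p: "\<And>j. j \<in> J \<Longrightarrow> mono (p j) \<and> p j 0 = s j \<and> p j (n j) = t j \<and>
        w j = (\<Sum>i<n j. \<bar>u (p j (Suc i)) - u (p j i)\<bar>)" by metis
    let ?A = "SIGMA j:J. {..<n j}"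
    have between: "s j \<le> p j i \<and> p j i \<le> p j (Suc i) \<and> p j (Suc i) \<le> t j" if "j \<in> J" "i < n j" for i j
    proof -
      have m: "mono (p j)" using p[OF that(1)] by blast
      show ?thesis
        using monoD[OF m, of 0 i] monoD[OF m, of i "Suc i"] monoD[OF m, of "Suc i" "n j"]
          p[OF that(1)] that(2) by simp
    qed
    have "(\<Sum>(j,i)\<in>?A. \<bar>u (p j (Suc i)) - u (p j i)\<bar>) < \<epsilon>"
      unfolding split_beta
    proof (rule *)
      show "finite ?A" using fin by auto
      show "a \<le> p (fst z) (snd z) \<and> p (fst z) (snd z) \<le> p (fst z) (Suc (snd z)) \<and> p (fst z) (Suc (snd z)) \<le> b"
        if "z \<in> ?A" for z using between[of "fst z" "snd z"] ab[of "fst z"] that by auto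
      show "{p (fst z) (snd z)<..<p (fst z) (Suc (snd z))} \<inter> {p (fst y) (snd y)<..<p (fst y) (Suc (snd y))} = {}"
        if zy: "z \<in> ?A" "y \<in> ?A" "z \<noteq> y" for z y
      proof (cases "fst z = fst y")
        case True
        have m: "mono (p (fst z))" using p zy by auto
        from True zy have "snd z \<noteq> snd y" by (auto simp: prod_eq_iff)
        then have "p (fst z) (Suc (snd z)) \<le> p (fst z) (snd y) \<or> p (fst z) (Suc (snd y)) \<le> p (fst z) (snd z)"
          using monoD[OF m, of "Suc (snd z)" "snd y"] monoD[OF m, of "Suc (snd y)" "snd z"] by linarith
        with True show ?thesis by auto
      next
        case False
        then have "{s (fst z)<..<t (fst z)} \<inter> {s (fst y)<..<t (fst y)} = {}" using disj zy by auto
        moreover have "{p (fst z) (snd z)<..<p (fst z) (Suc (snd z))} \<subseteq> {s (fst z)<..<t (fst z)}"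
          "{p (fst y) (snd y)<..<p (fst y) (Suc (snd y))} \<subseteq> {s (fst y)<..<t (fst y)}"
          using between[of "fst z" "snd z"] between[of "fst y" "snd y"] zy by auto
        ultimately show ?thesis by blast
      qed
      have "(\<Sum>z\<in>?A. p (fst z) (Suc (snd z)) - p (fst z) (snd z))
          = (\<Sum>j\<in>J. \<Sum>i<n j. p j (Suc i) - p j i)"
        using fin by (subst sum.Sigma) (auto simp: split_beta)
      also have "\<dots> = (\<Sum>j\<in>J. t j - s j)"
        using p by (intro sum.cong refl) (simp add: sum_lessThan_telescope)
      finally show "(\<Sum>z\<in>?A. p (fst z) (Suc (snd z)) - p (fst z) (snd z)) < \<delta>" using small by simp
    qed
    moreover have "(\<Sum>j\<in>J. w j) = (\<Sum>j\<in>J. \<Sum>i<n j. \<bar>u (p j (Suc i)) - u (p j i)\<bar>)"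
      using p by (intro sum.cong) auto
    ultimately show "(\<Sum>j\<in>J. w j) < \<epsilon>"
      using fin by (simp add: sum.Sigma)
  qed
qed

text \<open>
  Over an interval shorter than the \<open>\<delta>\<close> that belongs to \<open>\<epsilon> = 1\<close> all variation sums are below \<open>1\<close>, and finitely
  many such intervals cover \<open>[a, b]\<close>.
\<close>

lemma abs_cont_bdd_variation:
  assumes "abs_cont a b u" "a \<le> b" shows "bdd_above (variation_sums u a b)"
proof -
  obtain \<delta> where \<delta>: "\<delta> > 0"
    and *: "\<And>(J::unit set) s t w. \<lbrakk>finite J; \<And>j. j \<in> J \<Longrightarrow> a \<le> s j \<and> t j \<le> b;
       \<And>i j. \<lbrakk>i \<in> J; j \<in> J; i \<noteq> j\<rbrakk> \<Longrightarrow> {s i<..<t i} \<inter> {s j<..<t j} = {};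
       (\<Sum>j\<in>J. t j - s j) < \<delta>; \<And>j. j \<in> J \<Longrightarrow> w j \<in> variation_sums u (s j) (t j)\<rbrakk>
      \<Longrightarrow> (\<Sum>j\<in>J. w j) < 1"
    by (fact abs_cont_variation[OF assms(1) zero_less_one])
  have short: "w < 1" if "w \<in> variation_sums u s t" "a \<le> s" "t \<le> b" "t - s < \<delta>" for w s t
    using *[of "{()}" "\<lambda>_. s" "\<lambda>_. t" "\<lambda>_. w"] that by simp
  have *: "\<exists>B. \<forall>w\<in>variation_sums u a t. w \<le> B" if "a \<le> t" "t \<le> b" "t - a \<le> k * (\<delta>/2)" for t and k :: nat
    using that
  proof (induction k arbitrary: t)
    case 0
    then show ?case using short[of _ a t] \<delta> by (intro exI[of _ 1]) (auto intro: less_imp_le)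
  next
    case (Suc k)
    define c where "c = max a (t - \<delta>/2)"
    have c: "a \<le> c" "c \<le> t" "c \<le> b" "c - a \<le> k * (\<delta>/2)" "t - c < \<delta>"
      using Suc.prems \<delta> by (auto simp: c_def algebra_simps max_def)
    from Suc.IH[OF c(1) c(3) c(4)] obtain B where B: "\<And>w. w\<in>variation_sums u a c \<Longrightarrow> w \<le> B" by blast
    have "w \<le> B + 1" if w: "w \<in> variation_sums u a t" for w
    proof -
      obtain y z where "y \<in> variation_sums u a c" "z \<in> variation_sums u c t" "w \<le> y + z"
        using variation_sums_split[OF w c(1,2)] by blast
      with B[of y] short[of z c t] c Suc.prems show ?thesis by force
    qed
    then show ?case by blast
  qed
  obtain k :: nat where "(b - a) / (\<delta>/2) \<le> k" using real_arch_simple by blast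
  then have "b - a \<le> k * (\<delta>/2)" using \<delta> by (simp add: field_simps)
  from *[OF assms(2) order_refl this] show ?thesis unfolding bdd_above_def by blast
qed

text \<open>
  In particular the total variation and its difference with the function are both increasing.
\<close>

lemma total_variation_increment:
  assumes "abs_cont a b u" "a \<le> s" "s \<le> t" "t \<le> b"
  shows "total_variation u a s + \<bar>u t - u s\<bar> \<le> total_variation u a t"
proof -
  have ne: "variation_sums u a s \<noteq> {}" using variation_sums_increment[OF assms(2)] by blast
  have bdd: "bdd_above (variation_sums u a t)"
    using abs_cont_bdd_variation[OF abs_cont_subinterval[OF assms(1) order_refl assms(4)]] assms by auto
  have "w \<le> total_variation u a t - \<bar>u t - u s\<bar>" if "w \<in> variation_sums u a s" for w
    using cSup_upper[OF variation_sums_extend[OF that assms(3)] bdd] unfolding total_variation_def by simp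
  then show ?thesis using cSup_least[OF ne] unfolding total_variation_def by fastforce
qed

lemma total_variation_subadditive:
  assumes "abs_cont a b u" "a \<le> s" "s \<le> t" "t \<le> b"
  shows "total_variation u a t - total_variation u a s \<le> total_variation u s t"
proof -
  have ne: "variation_sums u a t \<noteq> {}" using variation_sums_increment[of a t u] assms by fastforce
  have b1: "bdd_above (variation_sums u a s)" and b2: "bdd_above (variation_sums u s t)"
    using abs_cont_bdd_variation[OF abs_cont_subinterval[OF assms(1)]] assms by auto
  have "w \<le> total_variation u a s + total_variation u s t" if w: "w \<in> variation_sums u a t" for w
  proof -
    obtain y z where "y \<in> variation_sums u a s" "z \<in> variation_sums u s t" "w \<le> y + z"
      using variation_sums_split[OF w assms(2,3)] by blast
    with cSup_upper[OF _ b1] cSup_upper[OF _ b2] show ?thesis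
      unfolding total_variation_def by force
  qed
  then show ?thesis using cSup_least[OF ne] unfolding total_variation_def by fastforce
qed

lemma abs_cont_total_variation:
  assumes "abs_cont a b u" shows "abs_cont a b (total_variation u a)"
  unfolding abs_cont_def
proof (intro allI impI)
  fix \<epsilon> :: real assume "\<epsilon> > 0"
  then have "\<epsilon>/3 > 0" by simp
  obtain \<delta> where \<delta>: "\<delta> > 0"
    and *: "\<And>(J::(real\<times>real) set) s t w. \<lbrakk>finite J; \<And>j. j \<in> J \<Longrightarrow> a \<le> s j \<and> t j \<le> b;
       \<And>i j. \<lbrakk>i \<in> J; j \<in> J; i \<noteq> j\<rbrakk> \<Longrightarrow> {s i<..<t i} \<inter> {s j<..<t j} = {};
       (\<Sum>j\<in>J. t j - s j) < \<delta>; \<And>j. j \<in> J \<Longrightarrow> w j \<in> variation_sums u (s j) (t j)\<rbrakk>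
      \<Longrightarrow> (\<Sum>j\<in>J. w j) < \<epsilon>/3"
    by (fact abs_cont_variation[OF assms \<open>\<epsilon>/3 > 0\<close>])
  show "\<exists>\<delta>>0. \<forall>I. finite I \<and> (\<forall>(s, t)\<in>I. a \<le> s \<and> s \<le> t \<and> t \<le> b) \<and>
        pairwise (\<lambda>(s, t) (s', t'). {s<..<t} \<inter> {s'<..<t'} = {}) I \<and>
        (\<Sum>(s, t)\<in>I. t - s) < \<delta> \<longrightarrow> (\<Sum>(s, t)\<in>I. \<bar>total_variation u a t - total_variation u a s\<bar>) < \<epsilon>"
  proof (rule exI[of _ \<delta>], intro conjI allI impI \<delta>)
    fix I assume I: "finite I \<and> (\<forall>(s, t)\<in>I. a \<le> s \<and> s \<le> t \<and> t \<le> b) \<and>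
        pairwise (\<lambda>(s, t) (s', t'). {s<..<t} \<inter> {s'<..<t'} = {}) I \<and> (\<Sum>(s, t)\<in>I. t - s) < \<delta>"
    define \<eta> where "\<eta> = \<epsilon> / (3 * (1 + real (card I)))"
    have \<eta>: "\<eta> > 0" "card I * \<eta> \<le> \<epsilon>/3" using \<open>\<epsilon> > 0\<close> by (auto simp: \<eta>_def field_simps)
    have "\<exists>w. w \<in> variation_sums u (fst z) (snd z) \<and> total_variation u (fst z) (snd z) < w + \<eta>" if "z \<in> I" for z
    proof -
      have z: "a \<le> fst z" "fst z \<le> snd z" "snd z \<le> b" using I that by auto
      have "total_variation u (fst z) (snd z) - \<eta> < Sup (variation_sums u (fst z) (snd z))"
        using \<eta> by (simp add: total_variation_def)
      then show ?thesis
        using less_cSupD[of "variation_sums u (fst z) (snd z)"] variation_sums_increment[OF z(2), of u]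
        by (metis diff_less_eq empty_iff)
    qed
    then obtain w where w: "\<And>z. z \<in> I \<Longrightarrow> w z \<in> variation_sums u (fst z) (snd z)"
      "\<And>z. z \<in> I \<Longrightarrow> total_variation u (fst z) (snd z) < w z + \<eta>" by metis
    have W: "(\<Sum>z\<in>I. w z) < \<epsilon>/3"
    proof (rule *[of I fst snd])
      show "{fst i<..<snd i} \<inter> {fst j<..<snd j} = {}" if "i \<in> I" "j \<in> I" "i \<noteq> j" for i j
        using I that unfolding pairwise_def by (auto simp: split_beta)
    qed (use I w in \<open>auto simp: split_beta\<close>)
    have "(\<Sum>(s, t)\<in>I. \<bar>total_variation u a t - total_variation u a s\<bar>) \<le> (\<Sum>z\<in>I. w z + \<eta>)"
    proof (rule sum_mono, clarify)
      fix s t assume "(s, t) \<in> I"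
      then have "a \<le> s" "s \<le> t" "t \<le> b" using I by auto
      from total_variation_increment[OF assms this] total_variation_subadditive[OF assms this]
        w(2)[OF \<open>(s, t) \<in> I\<close>]
      show "\<bar>total_variation u a t - total_variation u a s\<bar> \<le> w (s, t) + \<eta>" by auto
    qed
    also have "\<dots> < \<epsilon>" using W \<eta> \<open>\<epsilon> > 0\<close> by (simp add: sum.distrib)
    finally show "(\<Sum>(s, t)\<in>I. \<bar>total_variation u a t - total_variation u a s\<bar>) < \<epsilon>" .
  qed
qed

section \<open>Existence of densities\<close>

text \<open>
  A null set is covered by an open set of small measure, and the open set by nonoverlapping intervals;
  absolute continuity makes the total increment over these intervals small.
\<close>

lemma abs_cont_mono_null:
  fixes F :: "real \<Rightarrow> real"
  assumes "a < b" and F: "abs_cont a b F" and mono: "mono G" and cont: "continuous_on UNIV G"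
    and G: "\<And>x. x \<in> {a..b} \<Longrightarrow> G x = F x" and N: "N \<in> null_sets lborel"
  shows "emeasure (interval_measure G) (N \<inter> {a..b}) = 0"
proof -
  let ?\<mu> = "interval_measure G"
  have Icc: "emeasure ?\<mu> {c..d} = ennreal (G d - G c)" if "c \<le> d" for c d
    using that mono cont by (intro emeasure_interval_measure_Icc) (auto simp: mono_def)
  have "emeasure ?\<mu> (N \<inter> {a..b}) \<le> 0 + ennreal \<epsilon>" if "\<epsilon> > 0" for \<epsilon>
  proof -
    obtain \<delta> where \<delta>: "\<delta> > 0"
      and *: "\<And>(A::real set set) s t. \<lbrakk>finite A; \<And>i. i \<in> A \<Longrightarrow> a \<le> s i \<and> s i \<le> t i \<and> t i \<le> b;
       \<And>i j. \<lbrakk>i \<in> A; j \<in> A; i \<noteq> j\<rbrakk> \<Longrightarrow> {s i<..<t i} \<inter> {s j<..<t j} = {};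
       (\<Sum>i\<in>A. t i - s i) < \<delta>\<rbrakk> \<Longrightarrow> (\<Sum>i\<in>A. \<bar>F (t i) - F (s i)\<bar>) < \<epsilon>"
      by (fact abs_cont_indexed[OF F \<open>\<epsilon> > 0\<close>])
    have NL: "N \<in> null_sets lebesgue" using N by (simp add: null_sets_completionI)
    obtain U where U: "open U" "N \<subseteq> U" "emeasure lebesgue (U - N) < ennreal \<delta>"
      using sets_lebesgue_outer_open[of N \<delta>] NL \<delta> by blast
    have Usmall: "emeasure lebesgue U < ennreal \<delta>"
    proof -
      have "emeasure lebesgue U \<le> emeasure lebesgue (U - N) + emeasure lebesgue N"
        using U NL by (intro order_trans[OF emeasure_mono[of U "(U - N) \<union> N"] emeasure_subadditive]) auto
      with U NL show ?thesis by (auto simp: null_sets_def)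
    qed
    define g where "g x = (if x \<in> U then U else ball x 1)" for x
    have "gauge g" using U by (auto simp: gauge_def g_def)
    have sub: "N \<inter> {a..b} \<subseteq> cbox a b" and ne: "box a b \<noteq> {}" using \<open>a < b\<close> by auto
    obtain \<D> where \<D>: "countable \<D>" "\<Union>\<D> \<subseteq> cbox a b"
      and boxes: "\<And>K. K \<in> \<D> \<Longrightarrow> interior K \<noteq> {} \<and> (\<exists>c d. K = cbox c d)"
      and disj: "pairwise (\<lambda>A B. interior A \<inter> interior B = {}) \<D>"
      and tag: "\<And>K. K \<in> \<D> \<Longrightarrow> \<exists>x \<in> (N \<inter> {a..b}) \<inter> K. K \<subseteq> g x"
      and "\<And>u v. cbox u v \<in> \<D> \<Longrightarrow> \<exists>n. \<forall>i\<in>Basis. v \<bullet> i - u \<bullet> i = (b \<bullet> i - a \<bullet> i) / 2 ^ n"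
      and cover: "N \<inter> {a..b} \<subseteq> \<Union>\<D>"
      by (fact covering_lemma[OF sub ne \<open>gauge g\<close>])
    have K: "\<exists>c d. K = {c..d} \<and> c < d \<and> a \<le> c \<and> d \<le> b \<and> {c<..<d} \<subseteq> U" if k: "K \<in> \<D>" for K
    proof -
      obtain c d where "K = cbox c d" using boxes[OF k] by blast
      then have cd: "K = {c..d}" "interior K \<noteq> {}" using boxes[OF k] by auto
      then have "c < d" by auto
      moreover have "K \<subseteq> {a..b}" using \<D>(2) k by auto
      moreover have "K \<subseteq> U" using tag[OF k] U(2) by (auto simp: g_def split: if_splits)
      ultimately show ?thesis using cd by (intro exI[of _ c] exI[of _ d]) auto
    qed
    have lo: "a \<le> Inf K \<and> Inf K < Sup K \<and> Sup K \<le> b" and Kset: "K = {Inf K..Sup K}"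
      and KU: "{Inf K<..<Sup K} \<subseteq> U" if "K \<in> \<D>" for K
      using K[OF that] by auto
    have disjoint: "{Inf K<..<Sup K} \<inter> {Inf K'<..<Sup K'} = {}" if "K \<in> \<D>" "K' \<in> \<D>" "K \<noteq> K'" for K K'
    proof -
      have "interior K \<inter> interior K' = {}" using disj that by (auto simp: pairwise_def)
      then show ?thesis using K[OF that(1)] K[OF that(2)] by auto
    qed
    have borelK: "K \<in> sets borel" if "K \<in> \<D>" for K
      using boxes[OF that] by (metis borel_closed closed_cbox)
    have fin_small: "emeasure ?\<mu> (\<Union>\<F>) \<le> ennreal \<epsilon>" if \<F>: "finite \<F>" "\<F> \<subseteq> \<D>" for \<F>
    proof -
      have lo': "a \<le> Inf K" "Inf K \<le> Sup K" "Sup K \<le> b" if "K \<in> \<F>" for K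
        using lo[of K] that \<F> by auto
      have "(\<Sum>K\<in>\<F>. ennreal (Sup K - Inf K)) = (\<Sum>K\<in>\<F>. emeasure lebesgue {Inf K<..<Sup K})"
        using lo' by (intro sum.cong refl) auto
      also have "\<dots> = emeasure lebesgue (\<Union>K\<in>\<F>. {Inf K<..<Sup K})"
        using disjoint \<F> by (intro sum_emeasure) (auto simp: disjoint_family_on_def subset_iff)
      also have "\<dots> \<le> emeasure lebesgue U"
        using KU \<F> U by (intro emeasure_mono) (auto simp: subset_iff)
      finally have "(\<Sum>K\<in>\<F>. ennreal (Sup K - Inf K)) < ennreal \<delta>" using Usmall by (rule le_less_trans)
      moreover have "(\<Sum>K\<in>\<F>. ennreal (Sup K - Inf K)) = ennreal (\<Sum>K\<in>\<F>. Sup K - Inf K)"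
        using lo' by (intro sum_ennreal) auto
      moreover have "0 \<le> (\<Sum>K\<in>\<F>. Sup K - Inf K)" using lo' by (intro sum_nonneg) auto
      ultimately have len: "(\<Sum>K\<in>\<F>. Sup K - Inf K) < \<delta>" by (simp add: ennreal_less_iff)
      have sum: "(\<Sum>K\<in>\<F>. \<bar>F (Sup K) - F (Inf K)\<bar>) < \<epsilon>"
      proof (rule *)
        show "{Inf K<..<Sup K} \<inter> {Inf K'<..<Sup K'} = {}" if "K \<in> \<F>" "K' \<in> \<F>" "K \<noteq> K'" for K K'
          using disjoint that \<F> by blast
      qed (use lo' \<F> len in auto)
      have \<mu>K: "emeasure ?\<mu> K = ennreal \<bar>F (Sup K) - F (Inf K)\<bar>" if "K \<in> \<F>" for K
      proof -
        have k: "K \<in> \<D>" using that \<F> by blast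
        have "emeasure ?\<mu> K = emeasure ?\<mu> {Inf K..Sup K}" using Kset[OF k] by (rule arg_cong)
        also have "\<dots> = ennreal (G (Sup K) - G (Inf K))" using lo'[OF that] by (intro Icc)
        moreover have "G (Inf K) \<le> G (Sup K)" using mono lo'[OF that] by (auto simp: mono_def)
        ultimately show ?thesis using G[of "Inf K"] G[of "Sup K"] lo'[OF that] by simp
      qed
      have "emeasure ?\<mu> (\<Union>\<F>) \<le> (\<Sum>K\<in>\<F>. emeasure ?\<mu> K)"
        using emeasure_subadditive_finite[of \<F> "\<lambda>K. K" ?\<mu>] \<F> borelK by auto
      also have "\<dots> = (\<Sum>K\<in>\<F>. ennreal \<bar>F (Sup K) - F (Inf K)\<bar>)" using \<mu>K by (rule sum.cong[OF refl])
      also have "\<dots> = ennreal (\<Sum>K\<in>\<F>. \<bar>F (Sup K) - F (Inf K)\<bar>)" by (intro sum_ennreal) auto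
      also have "\<dots> \<le> ennreal \<epsilon>" using sum by (intro ennreal_leI) auto
      finally show ?thesis .
    qed
    have "emeasure ?\<mu> (\<Union>\<D>) \<le> ennreal \<epsilon>"
    proof (cases "\<D> = {}")
      case False
      let ?C = "\<lambda>n::nat. \<Union>(from_nat_into \<D> ` {..n})"
      have sub: "from_nat_into \<D> ` {..n} \<subseteq> \<D>" for n using from_nat_into[OF False] by auto
      have "\<Union>\<D> = \<Union>(range (from_nat_into \<D>))" using range_from_nat_into[OF False \<D>(1)] by simp
      also have "\<dots> = (\<Union>n. ?C n)" by auto
      finally have "\<Union>\<D> = (\<Union>n. ?C n)" .
      moreover have "(SUP n. emeasure ?\<mu> (?C n)) = emeasure ?\<mu> (\<Union>n. ?C n)"
      proof (rule SUP_emeasure_incseq)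
        have "?C n \<in> sets borel" for n using sub[of n] borelK by (intro sets.finite_Union) auto
        then show "range ?C \<subseteq> sets ?\<mu>" by auto
        show "incseq ?C" by (auto simp: incseq_def) force
      qed
      moreover have "(SUP n. emeasure ?\<mu> (?C n)) \<le> ennreal \<epsilon>"
        using fin_small sub by (intro SUP_least) auto
      ultimately show ?thesis by simp
    qed simp
    moreover have "\<Union>\<D> \<in> sets ?\<mu>"
      using \<D>(1) borelK by (intro sets.countable_Union) auto
    ultimately show ?thesis using cover emeasure_mono[of "N \<inter> {a..b}" "\<Union>\<D>" ?\<mu>] by auto
  qed
  then have "emeasure ?\<mu> (N \<inter> {a..b}) \<le> 0" by (rule ennreal_le_epsilon) auto
  then show ?thesis by simp
qed

text \<open>
  By the preceding lemma the Lebesgue-Stieltjes measure of a monotone absolutely continuous function is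
  absolutely continuous, and its Radon-Nikodym derivative is the density. Outside \<open>[a, b]\<close> the function is
  extended by constants, so that this measure lives on \<open>[a, b]\<close>.
\<close>

lemma abs_cont_mono_density:
  fixes F :: "real \<Rightarrow> real"
  assumes "a < b" and F: "abs_cont a b F" and mono: "\<And>x y. \<lbrakk>a \<le> x; x \<le> y; y \<le> b\<rbrakk> \<Longrightarrow> F x \<le> F y"
  obtains f where "f absolutely_integrable_on {a..b}" "\<And>x. x \<in> {a..b} \<Longrightarrow> integral {a..x} f = F x - F a"
proof -
  define G where "G x = F (max a (min b x))" for x
  have monoG: "mono G" unfolding mono_def G_def using \<open>a < b\<close> by (auto intro!: mono)
  have contG: "continuous_on UNIV G"
    unfolding G_def
    by (rule continuous_on_compose2[OF abs_cont_continuous_on[OF F]])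
      (use \<open>a < b\<close> in \<open>auto intro!: continuous_intros\<close>)
  have G: "G x = F x" if "x \<in> {a..b}" for x using that by (auto simp: G_def)
  let ?\<mu> = "interval_measure G"
  have Icc: "emeasure ?\<mu> {c..d} = ennreal (G d - G c)" if "c \<le> d" for c d
    using that monoG contG by (intro emeasure_interval_measure_Icc) (auto simp: mono_def)
  have out: "emeasure ?\<mu> (- {a..b}) = 0"
  proof -
    have "{a - real n..a} \<in> null_sets ?\<mu>" "{b..b + real n} \<in> null_sets ?\<mu>" for n
      using Icc[of "a - n" a] Icc[of b "b + n"] \<open>a < b\<close> by (auto simp: null_sets_def G_def)
    then have "(\<Union>n. {a - real n..a}) \<union> (\<Union>n. {b..b + real n}) \<in> null_sets ?\<mu>"
      by (intro null_sets.Un null_sets_UN)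
    moreover have "- {a..b} \<subseteq> (\<Union>n. {a - real n..a}) \<union> (\<Union>n. {b..b + real n})"
    proof
      fix x assume "x \<in> - {a..b}"
      moreover obtain n :: nat where "max (x - b) (a - x) \<le> n" using real_arch_simple by blast
      ultimately show "x \<in> (\<Union>n. {a - real n..a}) \<union> (\<Union>n. {b..b + real n})"
        by (auto intro!: exI[of _ n])
    qed
    moreover have "- {a..b} \<in> sets ?\<mu>" by simp
    ultimately have "- {a..b} \<in> null_sets ?\<mu>" by (blast intro: null_sets_subset)
    then show ?thesis by auto
  qed
  have "absolutely_continuous lborel ?\<mu>"
    unfolding absolutely_continuous_def
  proof
    fix N :: "real set" assume N: "N \<in> null_sets lborel"
    then have Ns: "N \<in> sets borel" by auto
    have "emeasure ?\<mu> N \<le> emeasure ?\<mu> (N \<inter> {a..b}) + emeasure ?\<mu> (- {a..b})"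
      using Ns by (intro order_trans[OF emeasure_mono[of N "(N \<inter> {a..b}) \<union> - {a..b}"] emeasure_subadditive]) auto
    then show "N \<in> null_sets ?\<mu>"
      using out abs_cont_mono_null[OF \<open>a < b\<close> F monoG contG G N] Ns by (auto simp: null_sets_def)
  qed
  then obtain f where f: "f \<in> borel_measurable lborel" and dens: "density lborel f = ?\<mu>"
    using sigma_finite_measure.Radon_Nikodym[OF sigma_finite_lborel, of ?\<mu>] by auto
  have int: "(\<integral>\<^sup>+x. f x * indicator {a..c} x \<partial>lborel) = ennreal (F c - F a)" if "c \<in> {a..b}" for c
    using Icc[of a c] G[of a] G[of c] that emeasure_density[OF f, of "{a..c}"] \<open>a < b\<close> by (simp add: dens)
  have "AE x in lborel. f x * indicator {a..b} x \<noteq> \<infinity>"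
    using f int[of b] \<open>a < b\<close> by (intro nn_integral_PInf_AE) auto
  then have ae: "AE x in lborel. x \<in> {a..b} \<longrightarrow> f x = ennreal (enn2real (f x))"
    by eventually_elim (auto simp: less_top)
  let ?\<phi> = "\<lambda>x. enn2real (f x)"
  have has: "(?\<phi> has_integral (F c - F a)) {a..c}" if c: "c \<in> {a..b}" for c
  proof -
    have "((\<lambda>x. indicator {a..c} x * ?\<phi> x) has_integral (F c - F a)) UNIV"
    proof (rule nn_integral_has_integral)
      show "(\<lambda>x. indicator {a..c} x * ?\<phi> x) \<in> borel_measurable borel"
        using f by simp
      have "(\<integral>\<^sup>+x. ennreal (indicator {a..c} x * ?\<phi> x) \<partial>lborel) = (\<integral>\<^sup>+x. f x * indicator {a..c} x \<partial>lborel)"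
        by (rule nn_integral_cong_AE, use ae in eventually_elim) (use c in \<open>auto simp: indicator_def\<close>)
      then show "(\<integral>\<^sup>+x. ennreal (indicator {a..c} x * ?\<phi> x) \<partial>lborel) = ennreal (F c - F a)"
        using int[OF c] by simp
      show "0 \<le> F c - F a" using mono[of a c] c by auto
    qed auto
    moreover have "(\<lambda>x. indicator {a..c} x * ?\<phi> x) = (\<lambda>x. if x \<in> {a..c} then ?\<phi> x else 0)"
      by (auto simp: indicator_def)
    ultimately show ?thesis by (simp only: has_integral_restrict_UNIV)
  qed
  show thesis
  proof
    show "?\<phi> absolutely_integrable_on {a..b}"
      using has[of b] \<open>a < b\<close> by (intro nonnegative_absolutely_integrable_1) auto
    show "integral {a..x} ?\<phi> = F x - F a" if "x \<in> {a..b}" for x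
      using has[OF that] by (rule integral_unique)
  qed
qed

text \<open>
  This is the working form of absolute continuity. The derivative of \<open>u\<close> is replaced by a density that
  can be modified freely on measurable sets.
\<close>

definition has_density :: "real \<Rightarrow> real \<Rightarrow> (real \<Rightarrow> real) \<Rightarrow> (real \<Rightarrow> real) \<Rightarrow> bool" where
  "has_density a b u g \<longleftrightarrow>
     g absolutely_integrable_on {a..b} \<and> (\<forall>x\<in>{a..b}. u x - u a = integral {a..x} g)"

text \<open>
  Write \<open>u\<close> as the difference of the total variation \<open>V\<close> and \<open>V - u\<close>, both increasing and absolutely
  continuous.
\<close>

lemma abs_cont_imp_has_density:
  assumes "a < b" "abs_cont a b u" obtains g where "has_density a b u g"
proof -
  let ?V = "total_variation u a"
  have V: "abs_cont a b ?V" by (rule abs_cont_total_variation[OF assms(2)])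
  have inc: "?V x + \<bar>u y - u x\<bar> \<le> ?V y" if "a \<le> x" "x \<le> y" "y \<le> b" for x y
    using total_variation_increment[OF assms(2) that] .
  obtain f where f: "f absolutely_integrable_on {a..b}" "\<And>x. x \<in> {a..b} \<Longrightarrow> integral {a..x} f = ?V x - ?V a"
    using abs_cont_mono_density[OF assms(1) V] inc by (smt (verit, ccfv_threshold))
  obtain h where h: "h absolutely_integrable_on {a..b}"
    "\<And>x. x \<in> {a..b} \<Longrightarrow> integral {a..x} h = (?V x - u x) - (?V a - u a)"
    using abs_cont_mono_density[OF assms(1) abs_cont_diff[OF V assms(2)]] inc by (smt (verit, ccfv_threshold))
  have "has_density a b u (\<lambda>x. f x - h x)"
    unfolding has_density_def
  proof (intro conjI ballI)
    show "(\<lambda>x. f x - h x) absolutely_integrable_on {a..b}"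
      using f(1) h(1) by (rule set_integral_diff(1))
    fix x assume x: "x \<in> {a..b}"
    have "f integrable_on {a..x}" "h integrable_on {a..x}"
      using f(1) h(1) x integrable_on_subinterval[of _ "{a..b}" a x]
      by (auto simp: absolutely_integrable_on_def)
    then show "u x - u a = integral {a..x} (\<lambda>x. f x - h x)"
      using f(2)[OF x] h(2)[OF x] by (simp add: integral_diff)
  qed
  then show thesis by (rule that)
qed

section \<open>Calculus with densities\<close>

lemma has_density_integrable:
  assumes "has_density a b u g" "a \<le> s" "t \<le> b"
  shows "g absolutely_integrable_on {s..t}" "g integrable_on {s..t}" "(\<lambda>x. \<bar>g x\<bar>) integrable_on {s..t}"
proof -
  show 1: "g absolutely_integrable_on {s..t}"
    using assms unfolding has_density_def by (auto intro: absolutely_integrable_on_subinterval)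
  then show "g integrable_on {s..t}" "(\<lambda>x. \<bar>g x\<bar>) integrable_on {s..t}"
    by (auto simp: absolutely_integrable_on_def)
qed

lemma has_density_increment:
  assumes "has_density a b u g" "a \<le> s" "s \<le> t" "t \<le> b"
  shows "u t - u s = integral {s..t} g"
proof -
  have "u t - u a = integral {a..t} g" "u s - u a = integral {a..s} g"
    using assms unfolding has_density_def by auto
  moreover have "integral {a..s} g + integral {s..t} g = integral {a..t} g"
    using assms has_density_integrable(2)[OF assms(1), of a t] by (intro Henstock_Kurzweil_Integration.integral_combine) auto
  ultimately show ?thesis by simp
qed

lemma has_density_increment_le:
  assumes "has_density a b u g" "a \<le> s" "s \<le> t" "t \<le> b"
  shows "\<bar>u t - u s\<bar> \<le> integral {s..t} (\<lambda>x. \<bar>g x\<bar>)"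
  unfolding has_density_increment[OF assms]
  using integral_norm_bound_integral[of g "{s..t}" "\<lambda>x. \<bar>g x\<bar>"]
    has_density_integrable[OF assms(1,2,4)] by auto

lemma has_density_subinterval:
  assumes "has_density a b u g" "a \<le> s" "t \<le> b"
  shows "has_density s t u g"
  unfolding has_density_def
  using has_density_integrable(1)[OF assms] has_density_increment[OF assms(1,2)] assms(3) by auto

lemma has_densityI:
  assumes "g absolutely_integrable_on {a..b}" "\<And>x. x \<in> {a..b} \<Longrightarrow> u x = u a + integral {a..x} g"
  shows "has_density a b u g"
  unfolding has_density_def
proof (intro conjI ballI assms(1))
  show "u x - u a = integral {a..x} g" if "x \<in> {a..b}" for x
    using assms(2)[OF that] by linarith
qed

lemma has_density_affine: "has_density a b (\<lambda>x. y + m * (x - c)) (\<lambda>_. m)"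
proof (rule has_densityI)
  show "(\<lambda>_. m) absolutely_integrable_on {a..b}" by (rule absolutely_integrable_on_const) simp
  show "y + m * (x - c) = y + m * (a - c) + integral {a..x} (\<lambda>_. m)" if "x \<in> {a..b}" for x
  proof -
    have "integral {a..x} (\<lambda>_. m) = (x - a) * m" using that by simp
    then show ?thesis by (simp add: algebra_simps)
  qed
qed

lemma has_density_glue:
  assumes u: "has_density a c u g" and v: "has_density c b v h" and "u c = v c" "a \<le> c" "c \<le> b"
  shows "has_density a b (\<lambda>x. if x \<le> c then u x else v x) (\<lambda>x. if x \<le> c then g x else h x)"
    (is "has_density a b ?w ?k")
proof -
  have eqg: "integral {s..t} ?k = integral {s..t} g" if "t \<le> c" for s t
    using that by (intro integral_cong) auto
  have eqh: "integral {s..t} ?k = integral {s..t} h" if "c \<le> s" for s t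
    using that by (intro integral_spike[of "{c}"]) auto
  have k1: "?k absolutely_integrable_on {a..c}"
    by (rule absolutely_integrable_spike[OF has_density_integrable(1)[OF u order_refl order_refl], where S="{}"]) auto
  have k2: "?k absolutely_integrable_on {c..b}"
    by (rule absolutely_integrable_spike[OF has_density_integrable(1)[OF v order_refl order_refl], where S="{c}"]) auto
  have k: "?k absolutely_integrable_on {a..b}"
    using k1 k2 assms(4,5) unfolding absolutely_integrable_on_def
    by (metis (no_types, lifting) Henstock_Kurzweil_Integration.integrable_combine)
  show ?thesis
  proof (rule has_densityI[OF k])
    fix x assume x: "x \<in> {a..b}"
    show "?w x = ?w a + integral {a..x} ?k"
    proof (cases "x \<le> c")
      case True
      then show ?thesis using has_density_increment[OF u, of a x] eqg[of x a] x assms(4) by auto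
    next
      case False
      have "integral {a..x} ?k = integral {a..c} ?k + integral {c..x} ?k"
        using False assms(4) absolutely_integrable_on_subinterval[OF k, of a x] x
        by (intro Henstock_Kurzweil_Integration.integral_combine[symmetric]) (auto simp: absolutely_integrable_on_def)
      then show ?thesis
        using has_density_increment[OF u, of a c] has_density_increment[OF v, of c x] eqg[of c a] eqh[of c x] x
          assms(3,4) False by auto
    qed
  qed
qed

lemma has_density_continuous_on:
  assumes "has_density a b u g" shows "continuous_on {a..b} u"
proof -
  have "continuous_on {a..b} (\<lambda>x. u a + integral {a..x} g)"
    by (rule continuous_on_add[OF continuous_on_const indefinite_integral_continuous_1
          [OF has_density_integrable(2)[OF assms order_refl order_refl]]])
  moreover have "u x = u a + integral {a..x} g" if "x \<in> {a..b}" for x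
    using bspec[OF conjunct2[OF assms[unfolded has_density_def]] that] by linarith
  ultimately show ?thesis by (metis (no_types, lifting) continuous_on_cong)
qed

lemma sum_integral_nonoverlapping_le:
  fixes r :: "real \<Rightarrow> real"
  assumes "finite I" and r: "r integrable_on {a..b}" "\<And>x. x \<in> {a..b} \<Longrightarrow> 0 \<le> r x"
    and I: "\<And>s t. (s, t) \<in> I \<Longrightarrow> a \<le> s \<and> s \<le> t \<and> t \<le> b"
    and disj: "pairwise (\<lambda>(s, t) (s', t'). {s<..<t} \<inter> {s'<..<t'} = {}) I"
  shows "(\<Sum>(s, t)\<in>I. integral {s..t} r) \<le> integral {a..b} r"
proof -
  let ?f = "\<lambda>z x. if x \<in> {fst z<..<snd z} then r x else 0"
  have int: "?f z integrable_on UNIV" if "z \<in> I" for z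
  proof -
    have "r integrable_on {fst z..snd z}"
      using r(1) I[of "fst z" "snd z"] that by (auto intro: integrable_on_subinterval)
    then show ?thesis
      by (simp only: integrable_restrict_UNIV integrable_on_open_interval_real)
  qed
  have "(\<Sum>(s, t)\<in>I. integral {s..t} r) = (\<Sum>z\<in>I. integral UNIV (?f z))"
    by (intro sum.cong refl) (simp only: split_beta integral_restrict_UNIV integral_open_interval_real)
  also have "\<dots> = integral UNIV (\<lambda>x. \<Sum>z\<in>I. ?f z x)"
    using assms(1) int by (intro integral_sum[symmetric]) auto
  also have "\<dots> \<le> integral UNIV (\<lambda>x. if x \<in> {a..b} then r x else 0)"
  proof (rule integral_le)
    show "(\<lambda>x. \<Sum>z\<in>I. ?f z x) integrable_on UNIV" using assms(1) int by (intro integrable_sum) auto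
    show "(\<lambda>x. if x \<in> {a..b} then r x else 0) integrable_on UNIV" using r(1) by (simp only: integrable_restrict_UNIV)
    fix x
    show "(\<Sum>z\<in>I. ?f z x) \<le> (if x \<in> {a..b} then r x else 0)"
    proof (cases "\<exists>z\<in>I. x \<in> {fst z<..<snd z}")
      case True
      then obtain z where z: "z \<in> I" "x \<in> {fst z<..<snd z}" by blast
      have "?f y x = 0" if "y \<in> I - {z}" for y
      proof -
        have "{fst z<..<snd z} \<inter> {fst y<..<snd y} = {}"
          using disj z(1) that unfolding pairwise_def by (auto simp: split_beta)
        with z(2) show ?thesis by auto
      qed
      then have "(\<Sum>y\<in>I. ?f y x) = ?f z x"
        using assms(1) z(1) by (subst sum.remove[of _ z]) (auto intro!: sum.neutral)
      moreover have "x \<in> {a..b}" using I[of "fst z" "snd z"] z by auto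
      ultimately show ?thesis using z by simp
    next
      case False
      then have "(\<Sum>z\<in>I. ?f z x) = 0" by (intro sum.neutral) auto
      then show ?thesis using r(2) by auto
    qed
  qed
  also have "\<dots> = integral {a..b} r" by (simp only: integral_restrict_UNIV)
  finally show ?thesis .
qed

text \<open>
  Truncate the density at a height \<open>n\<close>: the bounded part contributes at most \<open>n\<close> times the total length, and
  the remainder has a small integral by dominated convergence.
\<close>

lemma has_density_imp_abs_cont:
  assumes u: "has_density a b u g" shows "abs_cont a b u"
  unfolding abs_cont_def
proof (intro allI impI)
  fix \<epsilon> :: real assume "\<epsilon> > 0"
  note g = has_density_integrable[OF u order_refl order_refl]
  have min_int: "(\<lambda>x. min \<bar>g x\<bar> (real n)) absolutely_integrable_on {a..b}" for n
  proof -
    have "(\<lambda>x. \<bar>g x\<bar>) absolutely_integrable_on {a..b}"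
      using g by (intro nonnegative_absolutely_integrable_1) auto
    then show ?thesis by (intro absolutely_integrable_min_1) (auto simp: absolutely_integrable_on_const)
  qed
  define r where "r n x = \<bar>g x\<bar> - min \<bar>g x\<bar> (real n)" for n x
  have r_int: "r n integrable_on {a..b}" for n
    unfolding r_def using g(3) min_int[of n] by (intro integrable_diff) (auto simp: absolutely_integrable_on_def)
  have "(\<lambda>n. integral {a..b} (r n)) \<longlonglongrightarrow> integral {a..b} (\<lambda>_. 0)"
  proof (rule dominated_convergence(2)[OF r_int g(3)])
    show "norm (r n x) \<le> \<bar>g x\<bar>" for n x by (auto simp: r_def)
    show "(\<lambda>n. r n x) \<longlonglongrightarrow> 0" for x
    proof (rule tendsto_eventually)
      obtain n :: nat where "\<bar>g x\<bar> \<le> n" using real_arch_simple by blast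
      then show "\<forall>\<^sub>F n in sequentially. r n x = 0"
        by (intro eventually_sequentiallyI[of n]) (auto simp: r_def min_def)
    qed
  qed
  then have "\<forall>\<^sub>F n in sequentially. integral {a..b} (r n) < \<epsilon>/2"
    using \<open>\<epsilon> > 0\<close> by (intro order_tendstoD) auto
  then obtain n where n: "integral {a..b} (r n) < \<epsilon>/2" by (auto simp: eventually_sequentially)
  define \<delta> where "\<delta> = \<epsilon> / (2 * (real n + 1))"
  show "\<exists>\<delta>>0. \<forall>I. finite I \<and> (\<forall>(s, t)\<in>I. a \<le> s \<and> s \<le> t \<and> t \<le> b) \<and>
        pairwise (\<lambda>(s, t) (s', t'). {s<..<t} \<inter> {s'<..<t'} = {}) I \<and>
        (\<Sum>(s, t)\<in>I. t - s) < \<delta> \<longrightarrow> (\<Sum>(s, t)\<in>I. \<bar>u t - u s\<bar>) < \<epsilon>"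
  proof (rule exI[of _ \<delta>], intro conjI allI impI)
    show "\<delta> > 0" using \<open>\<epsilon> > 0\<close> by (simp add: \<delta>_def)
    fix I assume I: "finite I \<and> (\<forall>(s, t)\<in>I. a \<le> s \<and> s \<le> t \<and> t \<le> b) \<and>
        pairwise (\<lambda>(s, t) (s', t'). {s<..<t} \<inter> {s'<..<t'} = {}) I \<and> (\<Sum>(s, t)\<in>I. t - s) < \<delta>"
    have "(\<Sum>(s, t)\<in>I. \<bar>u t - u s\<bar>) \<le> (\<Sum>(s, t)\<in>I. integral {s..t} (r n) + n * (t - s))"
    proof (rule sum_mono, clarify)
      fix s t assume "(s, t) \<in> I"
      then have st: "a \<le> s" "s \<le> t" "t \<le> b" using I by auto
      have ri: "r n integrable_on {s..t}" using r_int[of n] st by (auto intro: integrable_on_subinterval)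
      have "\<bar>u t - u s\<bar> \<le> integral {s..t} (\<lambda>x. \<bar>g x\<bar>)" by (rule has_density_increment_le[OF u st])
      also have "\<dots> \<le> integral {s..t} (\<lambda>x. r n x + n)"
      proof (rule integral_le[OF has_density_integrable(3)[OF u st(1,3)]])
        show "(\<lambda>x. r n x + n) integrable_on {s..t}" by (rule integrable_add[OF ri integrable_const_ivl])
      qed (simp add: r_def)
      also have "\<dots> = integral {s..t} (r n) + integral {s..t} (\<lambda>_. real n)"
        by (rule integral_add[OF ri integrable_const_ivl])
      also have "\<dots> = integral {s..t} (r n) + n * (t - s)" using st by simp
      finally show "\<bar>u t - u s\<bar> \<le> integral {s..t} (r n) + n * (t - s)" .
    qed
    also have "\<dots> = (\<Sum>(s, t)\<in>I. integral {s..t} (r n)) + n * (\<Sum>(s, t)\<in>I. t - s)"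
      by (simp add: sum.distrib split_beta sum_distrib_left)
    also have "\<dots> < \<epsilon>/2 + \<epsilon>/2"
    proof (rule add_less_le_mono)
      have "(\<Sum>(s, t)\<in>I. integral {s..t} (r n)) \<le> integral {a..b} (r n)"
        using I r_int[of n] by (intro sum_integral_nonoverlapping_le) (auto simp: r_def)
      with n show "(\<Sum>(s, t)\<in>I. integral {s..t} (r n)) < \<epsilon>/2" by simp
      have "n * (\<Sum>(s, t)\<in>I. t - s) \<le> n * \<delta>" using I by (intro mult_left_mono) auto
      also have "\<dots> \<le> \<epsilon>/2" using \<open>\<epsilon> > 0\<close> by (simp add: \<delta>_def field_simps)
      finally show "n * (\<Sum>(s, t)\<in>I. t - s) \<le> \<epsilon>/2" .
    qed
    finally show "(\<Sum>(s, t)\<in>I. \<bar>u t - u s\<bar>) < \<epsilon>" by simp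
  qed
qed

text \<open>
  Lebesgue differentiation gives the right derivative of the indefinite integral almost everywhere; applied
  to the reflected density it gives the left derivative.
\<close>

lemma has_density_AE_deriv:
  assumes u: "has_density a b u g"
  shows "AE x in lebesgue_on {a..b}. deriv u x = g x"
proof -
  define k where "k x = (if x \<in> {a..b} then g x else 0)" for x
  have "k integrable_on UNIV"
    using has_density_integrable(2)[OF u order_refl order_refl] unfolding k_def by (simp only: integrable_restrict_UNIV)
  then have k: "k integrable_on cbox c d" for c d by (rule integrable_on_subcbox) simp
  have kr: "(\<lambda>x. k (- x)) integrable_on cbox c d" for c d
  proof -
    have "(\<lambda>x. k (- x)) integrable_on cbox (- (- c)) (- (- d))" unfolding integrable_reflect by (rule k)
    then show ?thesis by simp
  qed
  obtain N1 where N1: "negligible N1" "\<And>x e. \<lbrakk>x \<notin> N1; 0 < e\<rbrakk> \<Longrightarrow> \<exists>d>0. \<forall>h. 0 < h \<and> h < d \<longrightarrow>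
     norm (integral (cbox x (x + h *\<^sub>R One)) k /\<^sub>R h ^ DIM(real) - k x) < e"
    using integrable_ccontinuous_explicit[of k] k by blast
  obtain N2 where N2: "negligible N2" "\<And>x e. \<lbrakk>x \<notin> N2; 0 < e\<rbrakk> \<Longrightarrow> \<exists>d>0. \<forall>h. 0 < h \<and> h < d \<longrightarrow>
     norm (integral (cbox x (x + h *\<^sub>R One)) (\<lambda>x. k (- x)) /\<^sub>R h ^ DIM(real) - k (- x)) < e"
    using integrable_ccontinuous_explicit[of "\<lambda>x. k (- x)"] kr by blast
  let ?N = "N1 \<union> uminus ` N2 \<union> {a, b}"
  have "negligible (uminus ` N2)"
    using N2(1) by (intro negligible_differentiable_image_negligible) (auto intro!: differentiable_on_minus)
  then have N: "negligible ?N" using N1(1) by (auto intro: negligible_Un)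
  have deriv: "deriv u x = g x" if x: "x \<in> {a..b}" "x \<notin> ?N" for x
  proof -
    have xab: "a < x" "x < b" using x by auto
    have inc: "integral {c..d} k = u d - u c" if "a \<le> c" "c \<le> d" "d \<le> b" for c d
      unfolding has_density_increment[OF u that]
      using that by (intro integral_cong) (auto simp: k_def)
    have "(u has_field_derivative g x) (at x)"
      unfolding DERIV_def LIM_eq
    proof (intro allI impI)
      fix e :: real assume "e > 0"
      have "- x \<notin> N2" using x(2) by (auto simp: image_iff)
      obtain d1 where d1: "d1 > 0" "\<And>h. 0 < h \<and> h < d1 \<Longrightarrow> \<bar>integral {x..x + h} k / h - k x\<bar> < e"
        using N1(2)[of x e] x(2) \<open>e > 0\<close> by (auto simp: divide_inverse_commute)
      obtain d2 where d2: "d2 > 0" "\<And>h. 0 < h \<and> h < d2 \<Longrightarrow> \<bar>integral {-x..-x + h} (\<lambda>x. k (- x)) / h - k x\<bar> < e"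
        using N2(2)[of "-x" e] \<open>- x \<notin> N2\<close> \<open>e > 0\<close> by (auto simp: divide_inverse_commute)
      define d where "d = Min {d1, d2, x - a, b - x}"
      have d: "d > 0" "d \<le> d1" "d \<le> d2" "d \<le> x - a" "d \<le> b - x" using d1 d2 xab by (auto simp: d_def)
      have kx: "k x = g x" using x by (simp add: k_def)
      have "\<bar>(u (x + h) - u x) / h - g x\<bar> < e" if h: "h \<noteq> 0" "\<bar>h\<bar> < d" for h
      proof (cases "h > 0")
        case True
        then show ?thesis using d1(2)[of h] h d inc[of x "x + h"] xab kx by auto
      next
        case False
        have "integral {-x..-(x + h)} (\<lambda>x. k (- x)) = integral {x + h..x} k" by (rule Henstock_Kurzweil_Integration.integral_reflect_real)
        also have "\<dots> = u x - u (x + h)" using h d False xab by (intro inc) auto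
        finally have "integral {-x..-x + (- h)} (\<lambda>x. k (- x)) = u x - u (x + h)" by simp
        then have "integral {-x..-x + (- h)} (\<lambda>x. k (- x)) / (- h) = (u x - u (x + h)) / (- h)" by simp
        also have "\<dots> = (u (x + h) - u x) / h" using h(1) by (simp add: field_simps)
        finally have "integral {-x..-x + (- h)} (\<lambda>x. k (- x)) / (- h) = (u (x + h) - u x) / h" .
        then show ?thesis using d2(2)[of "-h"] h d False kx by auto
      qed
      then show "\<exists>s>0. \<forall>h. h \<noteq> 0 \<and> norm (h - 0) < s \<longrightarrow> norm ((u (x + h) - u x) / h - g x) < e"
        using d(1) by (intro exI[of _ d]) auto
    qed
    then show ?thesis by (rule DERIV_imp_deriv)
  qed
  have "AE x in lebesgue. x \<notin> ?N"
    using N by (intro AE_not_in) (simp add: negligible_iff_null_sets)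
  then have "AE x in lebesgue. x \<in> {a..b} \<longrightarrow> deriv u x = g x"
    by eventually_elim (use deriv in auto)
  then show ?thesis by (subst AE_restrict_space_iff) auto
qed

lemma has_density_reflect:
  assumes "has_density a b u g" "a \<le> b"
  shows "has_density (- b) (- a) (\<lambda>x. u (- x)) (\<lambda>x. - g (- x))"
proof (rule has_densityI)
  have "(\<lambda>x. g (- x)) absolutely_integrable_on {- b..- a}"
    using has_density_integrable(1)[OF assms(1) order_refl order_refl] by simp
  then show "(\<lambda>x. - g (- x)) absolutely_integrable_on {- b..- a}"
    using set_integrable_mult_right[of "-1" lebesgue "{- b..- a}" "\<lambda>x. g (- x)"] by simp
  fix x assume "x \<in> {- b..- a}"
  then have "u b - u (- x) = integral {- x..b} g"
    by (intro has_density_increment[OF assms(1)]) auto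
  also have "\<dots> = integral {- b..x} (\<lambda>x. g (- x))"
    using Henstock_Kurzweil_Integration.integral_reflect_real[of b "- x" g] by simp
  finally show "u (- x) = u (- (- b)) + integral {- b..x} (\<lambda>x. - g (- x))" by simp
qed

lemma has_density_uminus:
  assumes "has_density a b u g" shows "has_density a b (\<lambda>x. - u x) (\<lambda>x. - g x)"
proof (rule has_densityI)
  show "(\<lambda>x. - g x) absolutely_integrable_on {a..b}"
    using set_integrable_mult_right[of "-1" lebesgue "{a..b}" g]
      has_density_integrable(1)[OF assms order_refl order_refl] by simp
  show "- u x = - u a + integral {a..x} (\<lambda>x. - g x)" if "x \<in> {a..b}" for x
    using has_density_increment[OF assms order_refl, of x] that by auto
qed

section \<open>Energy and near minimizers\<close>

text \<open>
  The density is a separate argument, so that curves can be modified by changing their densities.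
\<close>

definition energy ::
    "(real \<times> real \<times> real \<Rightarrow> real) \<Rightarrow> real \<Rightarrow> real \<Rightarrow> (real \<Rightarrow> real) \<Rightarrow> (real \<Rightarrow> real) \<Rightarrow> ennreal" where
  "energy \<Lambda> a b u g = (\<integral>\<^sup>+x. ennreal (\<Lambda> (x, u x, g x)) * indicator {a..b} x \<partial>lebesgue)"

definition near_min ::
    "(real \<times> real \<times> real \<Rightarrow> real) \<Rightarrow> real \<Rightarrow> real \<Rightarrow> real \<Rightarrow> (real \<Rightarrow> real) \<Rightarrow> (real \<Rightarrow> real) \<Rightarrow> bool" where
  "near_min \<Lambda> \<epsilon> a b u g \<longleftrightarrow> has_density a b u g \<and> energy \<Lambda> a b u g < \<infinity> \<and>
     (\<forall>v h. has_density a b v h \<and> v a = u a \<and> v b = u b \<longrightarrow>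
        energy \<Lambda> a b u g \<le> energy \<Lambda> a b v h + ennreal \<epsilon>)"

lemma borel_measurable_along_density:
  assumes \<Lambda>: "\<Lambda> \<in> borel_measurable (borel :: (real \<times> real \<times> real) measure)" and u: "has_density a b u g"
  shows "(\<lambda>x. \<Lambda> (x, u x, g x)) \<in> borel_measurable (lebesgue_on {a..b})"
proof -
  have [measurable]: "u \<in> borel_measurable (lebesgue_on {a..b})"
    using has_density_continuous_on[OF u] by (intro continuous_imp_measurable_on_sets_lebesgue) auto
  have [measurable]: "g \<in> borel_measurable (lebesgue_on {a..b})"
    using has_density_integrable(1)[OF u order_refl order_refl] by (intro absolutely_integrable_imp_borel_measurable) auto
  have [measurable]: "(\<lambda>x. x) \<in> borel_measurable (lebesgue_on {a..b})"
    by (intro continuous_imp_measurable_on_sets_lebesgue continuous_on_id) auto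
  have "(\<lambda>x. (x, u x, g x)) \<in> borel_measurable (lebesgue_on {a..b})" by measurable
  from measurable_compose[OF this \<Lambda>] show ?thesis .
qed

lemma energy_measurable:
  assumes "\<Lambda> \<in> borel_measurable (borel :: (real \<times> real \<times> real) measure)" "has_density a b u g"
  shows "(\<lambda>x. ennreal (\<Lambda> (x, u x, g x)) * indicator {a..b} x) \<in> borel_measurable lebesgue"
  using borel_measurable_along_density[OF assms]
  by (subst borel_measurable_restrict_space_iff_ennreal[symmetric]) auto

lemma energy_cong:
  assumes "\<And>x. x \<in> {a..b} \<Longrightarrow> v x = u x" "\<And>x. x \<in> {a..b} \<Longrightarrow> h x = g x"
  shows "energy \<Lambda> a b v h = energy \<Lambda> a b u g"
  unfolding energy_def using assms by (intro nn_integral_cong) (auto simp: indicator_def)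

lemma energy_split:
  assumes \<Lambda>: "\<Lambda> \<in> borel_measurable borel" and u: "has_density a b u g" and "a \<le> c" "c \<le> b"
  shows "energy \<Lambda> a b u g = energy \<Lambda> a c u g + energy \<Lambda> c b u g"
proof -
  have "energy \<Lambda> a c u g + energy \<Lambda> c b u g =
     (\<integral>\<^sup>+x. ennreal (\<Lambda> (x, u x, g x)) * indicator {a..c} x
          + ennreal (\<Lambda> (x, u x, g x)) * indicator {c..b} x \<partial>lebesgue)"
    unfolding energy_def
    using energy_measurable[OF \<Lambda> has_density_subinterval[OF u order_refl \<open>c \<le> b\<close>]]
      energy_measurable[OF \<Lambda> has_density_subinterval[OF u \<open>a \<le> c\<close> order_refl]]
    by (intro nn_integral_add[symmetric])
  also have "\<dots> = energy \<Lambda> a b u g"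
    unfolding energy_def
  proof (rule nn_integral_cong_AE)
    have "AE x in lebesgue. x \<noteq> c"
      by (rule AE_I[where N="{c}"]) auto
    then show "AE x in lebesgue. ennreal (\<Lambda> (x, u x, g x)) * indicator {a..c} x
          + ennreal (\<Lambda> (x, u x, g x)) * indicator {c..b} x = ennreal (\<Lambda> (x, u x, g x)) * indicator {a..b} x"
      by eventually_elim (use assms(3,4) in \<open>auto simp: indicator_def\<close>)
  qed
  finally show ?thesis by simp
qed

text \<open>
  At the common point the slopes may disagree, which is a null set.
\<close>

lemma energy_glue:
  assumes \<Lambda>: "\<Lambda> \<in> borel_measurable borel"
    and u: "has_density a c u g" and v: "has_density c b v h" and "u c = v c" "a \<le> c" "c \<le> b"
  shows "energy \<Lambda> a b (\<lambda>x. if x \<le> c then u x else v x) (\<lambda>x. if x \<le> c then g x else h x)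
     = energy \<Lambda> a c u g + energy \<Lambda> c b v h"
proof -
  let ?w = "\<lambda>x. if x \<le> c then u x else v x" and ?k = "\<lambda>x. if x \<le> c then g x else h x"
  have "energy \<Lambda> c b ?w ?k = energy \<Lambda> c b v h"
    unfolding energy_def
  proof (rule nn_integral_cong_AE)
    have "AE x in lebesgue. x \<noteq> c" by (rule AE_I[where N="{c}"]) auto
    then show "AE x in lebesgue. ennreal (\<Lambda> (x, ?w x, ?k x)) * indicator {c..b} x
       = ennreal (\<Lambda> (x, v x, h x)) * indicator {c..b} x"
      by eventually_elim (auto simp: indicator_def)
  qed
  moreover have "energy \<Lambda> a c ?w ?k = energy \<Lambda> a c u g" by (rule energy_cong) auto
  ultimately show ?thesis
    using energy_split[OF \<Lambda> has_density_glue[OF assms(2-6)] assms(5,6)] by simp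
qed

lemma nn_integral_Icc_eq_integral:
  fixes \<phi> :: "real \<Rightarrow> real"
  assumes "\<phi> integrable_on {a..b}" "\<And>x. x \<in> {a..b} \<Longrightarrow> 0 \<le> \<phi> x"
  shows "(\<integral>\<^sup>+x. ennreal (\<phi> x) * indicator {a..b} x \<partial>lebesgue) = ennreal (integral {a..b} \<phi>)"
    and "(\<lambda>x. ennreal (\<phi> x) * indicator {a..b} x) \<in> borel_measurable lebesgue"
proof -
  have hi: "(\<phi> has_integral integral {a..b} \<phi>) {a..b}" using assms(1) by (rule integrable_integral)
  have "(\<lambda>x. indicator {a..b} x *\<^sub>R \<phi> x) \<in> borel_measurable lebesgue"
    by (rule has_integral_implies_lebesgue_measurable[OF hi])
  then have "(\<lambda>x. ennreal (indicator {a..b} x *\<^sub>R \<phi> x)) \<in> borel_measurable lebesgue" by simp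
  moreover have "(\<lambda>x. ennreal (indicator {a..b} x *\<^sub>R \<phi> x)) = (\<lambda>x. ennreal (\<phi> x) * indicator {a..b} x)"
    by (auto simp: indicator_def)
  ultimately show m: "(\<lambda>x. ennreal (\<phi> x) * indicator {a..b} x) \<in> borel_measurable lebesgue" by simp
  show "(\<integral>\<^sup>+x. ennreal (\<phi> x) * indicator {a..b} x \<partial>lebesgue) = ennreal (integral {a..b} \<phi>)"
    using nn_integral_has_integral_lebesgue'[OF assms(2) hi] m by (simp add: nn_integral_completion)
qed

text \<open>
  For a competitor \<open>v\<close> of \<open>u\<close>, the function \<open>\<phi>\<close> is what \<open>v\<close> saves and \<open>\<psi>\<close> is what it costs.
\<close>

lemma energy_compare:
  assumes \<Lambda>: "\<Lambda> \<in> borel_measurable borel" "\<And>z. 0 \<le> \<Lambda> z"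
    and u: "has_density a b u g" and v: "has_density a b v h"
    and \<phi>: "\<phi> integrable_on {a..b}" "\<And>x. x \<in> {a..b} \<Longrightarrow> 0 \<le> \<phi> x"
    and \<psi>: "\<psi> integrable_on {a..b}" "\<And>x. x \<in> {a..b} \<Longrightarrow> 0 \<le> \<psi> x"
    and le: "\<And>x. x \<in> {a..b} \<Longrightarrow> \<Lambda> (x, v x, h x) + \<phi> x \<le> \<Lambda> (x, u x, g x) + \<psi> x"
  shows "energy \<Lambda> a b v h + ennreal (integral {a..b} \<phi>) \<le> energy \<Lambda> a b u g + ennreal (integral {a..b} \<psi>)"
proof -
  have e1: "ennreal (integral {a..b} \<phi>) = (\<integral>\<^sup>+x. ennreal (\<phi> x) * indicator {a..b} x \<partial>lebesgue)"
    using \<phi> by (intro nn_integral_Icc_eq_integral(1)[symmetric])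
  have e2: "ennreal (integral {a..b} \<psi>) = (\<integral>\<^sup>+x. ennreal (\<psi> x) * indicator {a..b} x \<partial>lebesgue)"
    using \<psi> by (intro nn_integral_Icc_eq_integral(1)[symmetric])
  have "energy \<Lambda> a b v h + ennreal (integral {a..b} \<phi>)
     = (\<integral>\<^sup>+x. ennreal (\<Lambda> (x, v x, h x)) * indicator {a..b} x + ennreal (\<phi> x) * indicator {a..b} x \<partial>lebesgue)"
    by (subst e1, unfold energy_def)
      (intro nn_integral_add[symmetric] energy_measurable nn_integral_Icc_eq_integral(2) \<Lambda> v \<phi>)
  also have "\<dots> \<le> (\<integral>\<^sup>+x. ennreal (\<Lambda> (x, u x, g x)) * indicator {a..b} x + ennreal (\<psi> x) * indicator {a..b} x \<partial>lebesgue)"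
  proof (rule nn_integral_mono)
    fix x
    show "ennreal (\<Lambda> (x, v x, h x)) * indicator {a..b} x + ennreal (\<phi> x) * indicator {a..b} x
        \<le> ennreal (\<Lambda> (x, u x, g x)) * indicator {a..b} x + ennreal (\<psi> x) * indicator {a..b} x"
    proof (cases "x \<in> {a..b}")
      case True
      have "ennreal (\<Lambda> (x, v x, h x)) + ennreal (\<phi> x) = ennreal (\<Lambda> (x, v x, h x) + \<phi> x)"
        using \<Lambda>(2) \<phi>(2)[OF True] by simp
      also have "\<dots> \<le> ennreal (\<Lambda> (x, u x, g x) + \<psi> x)" by (intro ennreal_leI le True)
      also have "\<dots> = ennreal (\<Lambda> (x, u x, g x)) + ennreal (\<psi> x)"
        using \<Lambda>(2) \<psi>(2)[OF True] by simp
      finally show ?thesis using True by simp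
    qed simp
  qed
  also have "\<dots> = energy \<Lambda> a b u g + ennreal (integral {a..b} \<psi>)"
    by (subst e2, unfold energy_def)
      (intro nn_integral_add energy_measurable nn_integral_Icc_eq_integral(2) \<Lambda> u \<psi>)
  finally show ?thesis .
qed

text \<open>
  What remains of a Lagrangian after a lower bound has been subtracted from it. Superlinear growth takes
  the form of a linear lower bound for every slope \<open>N\<close>, uniformly in \<open>(x, y)\<close>.
\<close>

locale coercive_lagrangian =
  fixes \<Lambda> :: "real \<times> real \<times> real \<Rightarrow> real"
  assumes borel: "\<Lambda> \<in> borel_measurable borel"
    and nonneg: "0 \<le> \<Lambda> z"
    and bounded: "\<exists>C\<ge>0. \<forall>x y p. \<bar>x\<bar> \<le> R \<and> \<bar>y\<bar> \<le> R \<and> \<bar>p\<bar> \<le> R \<longrightarrow> \<Lambda> (x, y, p) \<le> C"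
    and coercive: "\<exists>c\<ge>0. \<forall>x y p. N * \<bar>p\<bar> \<le> \<Lambda> (x, y, p) + c"
    and lipschitz: "\<exists>C\<ge>0. \<forall>x y1 y2 p. \<bar>x\<bar> \<le> R \<and> \<bar>y1\<bar> \<le> R \<and> \<bar>y2\<bar> \<le> R \<and> \<bar>p\<bar> \<le> R \<longrightarrow>
           \<bar>\<Lambda> (x, y1, p) - \<Lambda> (x, y2, p)\<bar> \<le> C * \<bar>y1 - y2\<bar>"
begin

lemma energy_le_const:
  assumes u: "has_density a b u g" and "a \<le> b" "0 \<le> C" "\<And>x. x \<in> {a..b} \<Longrightarrow> \<Lambda> (x, u x, g x) \<le> C"
  shows "energy \<Lambda> a b u g \<le> ennreal (C * (b - a))"
proof -
  have "energy \<Lambda> a b u g \<le> (\<integral>\<^sup>+x. ennreal C * indicator {a..b} x \<partial>lebesgue)"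
    unfolding energy_def using assms by (intro nn_integral_mono) (auto simp: indicator_def intro: ennreal_leI)
  also have "\<dots> = ennreal (C * (b - a))"
    using nn_integral_Icc_eq_integral(1)[OF integrable_const_ivl, of a b C] assms(2,3) by (simp add: mult.commute)
  finally show ?thesis .
qed

lemma energy_coercive:
  assumes u: "has_density a b u g" and "a \<le> b" "0 \<le> c" "0 \<le> N"
    and c: "\<And>x y p. N * \<bar>p\<bar> \<le> \<Lambda> (x, y, p) + c"
  shows "ennreal (N * integral {a..b} (\<lambda>x. \<bar>g x\<bar>)) \<le> energy \<Lambda> a b u g + ennreal (c * (b - a))"
proof -
  note g = has_density_integrable[OF u order_refl order_refl]
  have 1: "(\<lambda>x. N * \<bar>g x\<bar>) integrable_on {a..b}" using integrable_cmul[OF g(3), of N] by simp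
  have 2: "(\<lambda>x. c) integrable_on {a..b}" by (rule integrable_const_ivl)
  have "ennreal (N * integral {a..b} (\<lambda>x. \<bar>g x\<bar>)) = (\<integral>\<^sup>+x. ennreal (N * \<bar>g x\<bar>) * indicator {a..b} x \<partial>lebesgue)"
    using nn_integral_Icc_eq_integral(1)[OF 1] assms(4) by simp
  also have "\<dots> \<le> (\<integral>\<^sup>+x. ennreal (\<Lambda> (x, u x, g x)) * indicator {a..b} x + ennreal c * indicator {a..b} x \<partial>lebesgue)"
    using c nonneg assms(3) by (intro nn_integral_mono)
      (auto simp: indicator_def ennreal_plus[symmetric] simp del: ennreal_plus intro!: ennreal_leI)
  also have "\<dots> = energy \<Lambda> a b u g + (\<integral>\<^sup>+x. ennreal c * indicator {a..b} x \<partial>lebesgue)"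
    unfolding energy_def by (intro nn_integral_add energy_measurable nn_integral_Icc_eq_integral(2)[OF 2] borel u assms(3))
  also have "(\<integral>\<^sup>+x. ennreal c * indicator {a..b} x \<partial>lebesgue) = ennreal (c * (b - a))"
    using nn_integral_Icc_eq_integral(1)[OF 2] assms(2,3) by (simp add: mult.commute)
  finally show ?thesis .
qed

text \<open>
  A better curve over the subinterval can be spliced into \<open>u\<close>.
\<close>

lemma near_min_subinterval:
  assumes nm: "near_min \<Lambda> \<epsilon> a b u g" and st: "a \<le> s" "s \<le> t" "t \<le> b"
  shows "near_min \<Lambda> \<epsilon> s t u g"
proof -
  have u: "has_density a b u g" and fin: "energy \<Lambda> a b u g < \<infinity>"
    and min: "\<And>v h. has_density a b v h \<Longrightarrow> v a = u a \<Longrightarrow> v b = u b \<Longrightarrow>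
        energy \<Lambda> a b u g \<le> energy \<Lambda> a b v h + ennreal \<epsilon>"
    using nm unfolding near_min_def by auto
  have ust: "has_density s t u g" and uas: "has_density a s u g" and utb: "has_density t b u g"
    and usb: "has_density s b u g"
    using st by (auto intro: has_density_subinterval[OF u])
  have E: "energy \<Lambda> a b u g = energy \<Lambda> a s u g + (energy \<Lambda> s t u g + energy \<Lambda> t b u g)"
    using energy_split[OF borel u st(1)] energy_split[OF borel usb st(2,3)] st by simp
  then have fins: "energy \<Lambda> a s u g < \<infinity>" "energy \<Lambda> s t u g < \<infinity>" "energy \<Lambda> t b u g < \<infinity>"
    using fin by auto
  have "energy \<Lambda> s t u g \<le> energy \<Lambda> s t v h + ennreal \<epsilon>"
    if v: "has_density s t v h" and vs: "v s = u s" and vt: "v t = u t" for v h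
  proof -
    let ?w1 = "\<lambda>x. if x \<le> t then v x else u x" and ?k1 = "\<lambda>x. if x \<le> t then h x else g x"
    have w1: "has_density s b ?w1 ?k1" by (rule has_density_glue[OF v utb vt st(2,3)])
    have e1: "energy \<Lambda> s b ?w1 ?k1 = energy \<Lambda> s t v h + energy \<Lambda> t b u g"
      by (rule energy_glue[OF borel v utb vt st(2,3)])
    let ?w = "\<lambda>x. if x \<le> s then u x else ?w1 x" and ?k = "\<lambda>x. if x \<le> s then g x else ?k1 x"
    have eq: "u s = ?w1 s" and sb: "s \<le> b" using vs st by auto
    have w: "has_density a b ?w ?k" by (rule has_density_glue[OF uas w1 eq st(1) sb])
    have e: "energy \<Lambda> a b ?w ?k = energy \<Lambda> a s u g + (energy \<Lambda> s t v h + energy \<Lambda> t b u g)"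
      unfolding e1[symmetric] by (rule energy_glue[OF borel uas w1 eq st(1) sb])
    have "?w b = u b" using vt vs st by (cases "b = s"; cases "b = t") auto
    with min[OF w] st have "energy \<Lambda> a s u g + (energy \<Lambda> s t u g + energy \<Lambda> t b u g)
        \<le> energy \<Lambda> a s u g + (energy \<Lambda> s t v h + energy \<Lambda> t b u g) + ennreal \<epsilon>"
      unfolding E e by simp
    also have "\<dots> = energy \<Lambda> a s u g + ((energy \<Lambda> s t v h + ennreal \<epsilon>) + energy \<Lambda> t b u g)"
      by (simp add: ac_simps)
    finally have "energy \<Lambda> s t u g + energy \<Lambda> t b u g \<le> (energy \<Lambda> s t v h + ennreal \<epsilon>) + energy \<Lambda> t b u g"
      using fins by (auto simp: ennreal_add_left_cancel_le)
    then have "energy \<Lambda> t b u g + energy \<Lambda> s t u g \<le> energy \<Lambda> t b u g + (energy \<Lambda> s t v h + ennreal \<epsilon>)"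
      by (simp only: add.commute)
    then show ?thesis using fins(3) by (auto simp: ennreal_add_left_cancel_le)
  qed
  with ust fins(2) show ?thesis unfolding near_min_def by blast
qed

lemma energy_affine_le:
  assumes "a < b" "\<bar>A\<bar> \<le> R" "\<bar>B\<bar> \<le> R" "\<bar>B - A\<bar> \<le> M * (b - a)" "0 \<le> C"
    and C: "\<And>x y p. x \<in> {a..b} \<Longrightarrow> \<bar>y\<bar> \<le> R \<Longrightarrow> \<bar>p\<bar> \<le> M \<Longrightarrow> \<Lambda> (x, y, p) \<le> C"
  shows "energy \<Lambda> a b (\<lambda>x. A + (B - A) / (b - a) * (x - a)) (\<lambda>_. (B - A) / (b - a)) \<le> ennreal (C * (b - a))"
proof (intro energy_le_const has_density_affine C assms(5) less_imp_le[OF assms(1)])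
  show "\<bar>(B - A) / (b - a)\<bar> \<le> M" using assms(1,4) by (simp add: abs_divide field_simps)
  fix x assume x: "x \<in> {a..b}"
  define l where "l = (x - a) / (b - a)"
  have l: "0 \<le> l" "l \<le> 1" using x \<open>a < b\<close> by (auto simp: l_def)
  have "(B - A) / (b - a) * (x - a) = l * (B - A)" by (simp add: l_def)
  then have "A + (B - A) / (b - a) * (x - a) = (1 - l) * A + l * B" by (simp add: algebra_simps)
  moreover have "\<bar>(1 - l) * A + l * B\<bar> \<le> (1 - l) * \<bar>A\<bar> + l * \<bar>B\<bar>"
    using l abs_triangle_ineq[of "(1 - l) * A" "l * B"] by (simp add: abs_mult)
  moreover have "(1 - l) * \<bar>A\<bar> + l * \<bar>B\<bar> \<le> R"
    using l assms by (intro convex_bound_le) auto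
  ultimately show "\<bar>A + (B - A) / (b - a) * (x - a)\<bar> \<le> R" by linarith
qed

text \<open>
  The chord is a competitor.
\<close>

lemma near_min_energy_le:
  assumes nm: "near_min \<Lambda> \<epsilon> a b u g" and "a < b" "0 \<le> \<epsilon>" "\<bar>u b - u a\<bar> \<le> M * (b - a)"
    and R: "\<bar>a\<bar> \<le> R" "\<bar>b\<bar> \<le> R" "\<bar>u a\<bar> \<le> R" "\<bar>u b\<bar> \<le> R"
    and C: "0 \<le> C" "\<And>x y p. \<bar>x\<bar> \<le> R \<Longrightarrow> \<bar>y\<bar> \<le> R \<Longrightarrow> \<bar>p\<bar> \<le> M \<Longrightarrow> \<Lambda> (x, y, p) \<le> C"
  shows "energy \<Lambda> a b u g \<le> ennreal (C * (b - a) + \<epsilon>)"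
proof -
  define m where "m = (u b - u a) / (b - a)"
  let ?w = "\<lambda>x. u a + m * (x - a)"
  have "energy \<Lambda> a b ?w (\<lambda>_. m) \<le> ennreal (C * (b - a))"
    unfolding m_def using R by (intro energy_affine_le[OF assms(2) R(3,4) assms(4) C(1)] C(2)) auto
  moreover have "?w b = u b" using \<open>a < b\<close> by (simp add: m_def)
  then have "energy \<Lambda> a b u g \<le> energy \<Lambda> a b ?w (\<lambda>_. m) + ennreal \<epsilon>"
    using nm has_density_affine[of a b "u a" m a] unfolding near_min_def by auto
  ultimately have "energy \<Lambda> a b u g \<le> ennreal (C * (b - a)) + ennreal \<epsilon>"
    by (meson add_right_mono order_trans)
  then show ?thesis using C \<open>a < b\<close> \<open>0 \<le> \<epsilon>\<close> by (simp add: ennreal_plus)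
qed

end

section \<open>Near minimizers with a shallow chord\<close>

context coercive_lagrangian
begin

lemma bounded_choice:
  obtains C where "C \<ge> 0" "\<And>x y p. \<bar>x\<bar> \<le> R \<Longrightarrow> \<bar>y\<bar> \<le> R' \<Longrightarrow> \<bar>p\<bar> \<le> R'' \<Longrightarrow> \<Lambda> (x, y, p) \<le> C"
proof -
  obtain C where "C \<ge> 0" and C: "\<forall>x y p. \<bar>x\<bar> \<le> max R (max R' R'') \<and> \<bar>y\<bar> \<le> max R (max R' R'')
      \<and> \<bar>p\<bar> \<le> max R (max R' R'') \<longrightarrow> \<Lambda> (x, y, p) \<le> C" using bounded by blast
  show thesis
  proof (rule that[OF \<open>C \<ge> 0\<close>])
    fix x y p :: real assume "\<bar>x\<bar> \<le> R" "\<bar>y\<bar> \<le> R'" "\<bar>p\<bar> \<le> R''"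
    then show "\<Lambda> (x, y, p) \<le> C" using C[rule_format, of x y p] by linarith
  qed
qed

lemma lipschitz_choice:
  obtains C where "C \<ge> 0" "\<And>x y1 y2 p. \<bar>x\<bar> \<le> R \<Longrightarrow> \<bar>y1\<bar> \<le> R \<Longrightarrow> \<bar>y2\<bar> \<le> R \<Longrightarrow> \<bar>p\<bar> \<le> R \<Longrightarrow>
     \<Lambda> (x, y1, p) \<le> \<Lambda> (x, y2, p) + C * \<bar>y1 - y2\<bar>"
proof -
  obtain C where "C \<ge> 0" and C: "\<forall>x y1 y2 p. \<bar>x\<bar> \<le> R \<and> \<bar>y1\<bar> \<le> R \<and> \<bar>y2\<bar> \<le> R \<and> \<bar>p\<bar> \<le> R \<longrightarrow>
     \<bar>\<Lambda> (x, y1, p) - \<Lambda> (x, y2, p)\<bar> \<le> C * \<bar>y1 - y2\<bar>" using lipschitz by blast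
  show thesis
  proof (rule that[OF \<open>C \<ge> 0\<close>])
    fix x y1 y2 p :: real assume "\<bar>x\<bar> \<le> R" "\<bar>y1\<bar> \<le> R" "\<bar>y2\<bar> \<le> R" "\<bar>p\<bar> \<le> R"
    then show "\<Lambda> (x, y1, p) \<le> \<Lambda> (x, y2, p) + C * \<bar>y1 - y2\<bar>"
      using C[rule_format, of x y1 y2 p] by linarith
  qed
qed

text \<open>
  The exchange argument described at the beginning: the part of the displacement of \<open>u\<close> that is made with
  slopes above \<open>K\<close> is at most the tolerance.
\<close>

lemma near_min_steep_part:
  assumes "0 \<le> M"
  obtains \<delta> K where "\<delta> > 0" "K \<ge> 0"
    "\<And>\<epsilon> a b u g. \<lbrakk>near_min \<Lambda> \<epsilon> a b u g; a < b; b - a \<le> \<delta>; \<bar>a\<bar> \<le> R; \<bar>b\<bar> \<le> R;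
       \<And>x. x \<in> {a..b} \<Longrightarrow> \<bar>u x\<bar> \<le> R; \<bar>u b - u a\<bar> \<le> M * (b - a); 0 \<le> \<epsilon>; \<epsilon> \<le> b - a\<rbrakk>
      \<Longrightarrow> (\<lambda>x. if \<bar>g x\<bar> > K then \<bar>g x\<bar> else 0) integrable_on {a..b}
         \<and> integral {a..b} (\<lambda>x. if \<bar>g x\<bar> > K then \<bar>g x\<bar> else 0) \<le> \<epsilon>"
proof -
  obtain C0 where C0: "C0 \<ge> 0" "\<And>x y p. \<bar>x\<bar> \<le> R \<Longrightarrow> \<bar>y\<bar> \<le> R \<Longrightarrow> \<bar>p\<bar> \<le> M \<Longrightarrow> \<Lambda> (x, y, p) \<le> C0"
    by (fact bounded_choice)
  obtain c1 where c1: "c1 \<ge> 0" "\<And>x y p. 1 * \<bar>p\<bar> \<le> \<Lambda> (x, y, p) + c1" using coercive[of 1] by blast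
  (* the integral of |g| is at most P/2 times the length, so |g| <= P on half of the interval *)
  define P where "P = 2 * (C0 + 1 + c1)"
  obtain C1 where C1: "C1 \<ge> 0" "\<And>x y p. \<bar>x\<bar> \<le> R \<Longrightarrow> \<bar>y\<bar> \<le> R + 1 \<Longrightarrow> \<bar>p\<bar> \<le> P + 1 \<Longrightarrow> \<Lambda> (x, y, p) \<le> C1"
    by (fact bounded_choice)
  (* the first summand gives D <= (b - a)/4, the others absorb the costs of the exchange *)
  define N where "N = 4 * (C0 + 1) + 2 * C1 + 2"
  (* a lower bound with slope 2 N turns into one with slope N and no constant once |p| >= c2 / N *)
  obtain c2 where c2: "c2 \<ge> 0" "\<And>x y p. (2 * N) * \<bar>p\<bar> \<le> \<Lambda> (x, y, p) + c2" using coercive[of "2 * N"] by blast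
  define K where "K = max (P + 1) (c2 / N)"
  obtain CL where CL: "CL \<ge> 0" "\<And>x y1 y2 p. \<bar>x\<bar> \<le> max (R + 1) K \<Longrightarrow> \<bar>y1\<bar> \<le> max (R + 1) K \<Longrightarrow>
     \<bar>y2\<bar> \<le> max (R + 1) K \<Longrightarrow> \<bar>p\<bar> \<le> max (R + 1) K \<Longrightarrow>
     \<Lambda> (x, y1, p) \<le> \<Lambda> (x, y2, p) + CL * \<bar>y1 - y2\<bar>"
    by (fact lipschitz_choice)
  define \<delta> where "\<delta> = 1 / (2 * CL + 1)"
  have pos: "P \<ge> 2" "N \<ge> 6" "K \<ge> 1" "\<delta> > 0" "\<delta> \<le> 1" "2 * CL * \<delta> \<le> 1" "N \<ge> 4 * (C0 + 1)" "N \<ge> 2 * C1 + 2" "K \<ge> P + 1"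
    using C0(1) c1(1) C1(1) CL(1) by (auto simp: P_def N_def K_def \<delta>_def field_simps)
  have steep: "N * \<bar>p\<bar> \<le> \<Lambda> (x, y, p)" if "\<bar>p\<bar> > K" for x y p
  proof -
    have "c2 / N \<le> \<bar>p\<bar>" using that by (simp add: K_def)
    then have "c2 \<le> N * \<bar>p\<bar>" using pos by (simp add: field_simps)
    then show ?thesis using c2(2)[of p x y] by simp
  qed
  show thesis
  proof (rule that[of \<delta> K])
    fix \<epsilon> a b u g
    assume nm: "near_min \<Lambda> \<epsilon> a b u g" and ab: "a < b" "b - a \<le> \<delta>" "\<bar>a\<bar> \<le> R" "\<bar>b\<bar> \<le> R"
      and uR: "\<And>x. x \<in> {a..b} \<Longrightarrow> \<bar>u x\<bar> \<le> R" and slope: "\<bar>u b - u a\<bar> \<le> M * (b - a)"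
      and \<epsilon>: "0 \<le> \<epsilon>" "\<epsilon> \<le> b - a"
    let ?h = "b - a"
    have u: "has_density a b u g" using nm by (simp add: near_min_def)
    note g = has_density_integrable[OF u order_refl order_refl]
    have [measurable]: "g \<in> borel_measurable (lebesgue_on {a..b})"
      using g(1) by (intro absolutely_integrable_imp_borel_measurable) auto
    have int_abs: "k absolutely_integrable_on {a..b}"
      if "k \<in> borel_measurable (lebesgue_on {a..b})" "\<And>x. x \<in> {a..b} \<Longrightarrow> \<bar>k x\<bar> \<le> \<bar>g x\<bar> + 1" for k :: "real \<Rightarrow> real"
    proof (rule measurable_bounded_by_integrable_imp_absolutely_integrable)
      show "(\<lambda>x. \<bar>g x\<bar> + 1) integrable_on {a..b}" by (rule integrable_add[OF g(3) integrable_const_ivl])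
    qed (use that in auto)
    have int: "k integrable_on {a..b}"
      if "k \<in> borel_measurable (lebesgue_on {a..b})" "\<And>x. x \<in> {a..b} \<Longrightarrow> \<bar>k x\<bar> \<le> \<bar>g x\<bar> + 1" for k :: "real \<Rightarrow> real"
      using int_abs[OF that] by (simp add: absolutely_integrable_on_def)
    have energy_u: "energy \<Lambda> a b u g \<le> ennreal ((C0 + 1) * ?h)"
    proof -
      have "energy \<Lambda> a b u g \<le> ennreal (C0 * ?h + \<epsilon>)"
        by (rule near_min_energy_le[OF nm ab(1) \<epsilon>(1) slope ab(3,4) _ _ C0]) (use uR ab in auto)
      also have "\<dots> \<le> ennreal ((C0 + 1) * ?h)" using \<epsilon> by (intro ennreal_leI) (auto simp: algebra_simps)
      finally show ?thesis .
    qed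
    \<comment> \<open>At least half of the interval carries slopes bounded by P\<close>
    define f where "f x = (if \<bar>g x\<bar> \<le> P then 1 else 0::real)" for x
    have f: "f integrable_on {a..b}" unfolding f_def by (intro int) auto
    have F: "?h / 2 \<le> integral {a..b} f"
    proof -
      have "ennreal (1 * integral {a..b} (\<lambda>x. \<bar>g x\<bar>)) \<le> energy \<Lambda> a b u g + ennreal (c1 * ?h)"
        by (rule energy_coercive[OF u _ c1(1) _ c1(2)]) (use ab in auto)
      also have "\<dots> \<le> ennreal ((C0 + 1) * ?h) + ennreal (c1 * ?h)" using energy_u by (intro add_right_mono)
      also have "\<dots> = ennreal ((C0 + 1) * ?h + c1 * ?h)" using C0(1) c1(1) ab by (intro ennreal_plus[symmetric]) auto
      finally have "integral {a..b} (\<lambda>x. \<bar>g x\<bar>) \<le> (C0 + 1) * ?h + c1 * ?h"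
        using C0(1) c1(1) ab by (subst (asm) ennreal_le_iff) auto
      also have "\<dots> = (C0 + 1 + c1) * ?h" by (rule distrib_right[symmetric])
      also have "\<dots> = P * (?h / 2)" by (simp add: P_def)
      finally have G: "integral {a..b} (\<lambda>x. \<bar>g x\<bar>) \<le> P * (?h / 2)" .
      have "integral {a..b} (\<lambda>x. P * (1 - f x)) \<le> integral {a..b} (\<lambda>x. \<bar>g x\<bar>)"
      proof (rule integral_le[OF _ g(3)])
        have "(\<lambda>x. P *\<^sub>R (1 - f x)) integrable_on {a..b}"
          by (intro integrable_cmul integrable_diff integrable_const_ivl f)
        then show "(\<lambda>x. P * (1 - f x)) integrable_on {a..b}" by simp
      qed (use pos in \<open>auto simp: f_def\<close>)
      also have "integral {a..b} (\<lambda>x. P * (1 - f x)) = P * (?h - integral {a..b} f)"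
        using ab f by (simp add: integral_diff[OF integrable_const_ivl f])
      finally have "P * (?h - integral {a..b} f) \<le> P * (?h / 2)" using G by simp
      then show ?thesis using pos by simp
    qed
    (* k carries the steep part of the slope, e marks where it lives *)
    define e where "e x = (if \<bar>g x\<bar> > K then 1 else 0::real)" for x
    define k where "k x = (if \<bar>g x\<bar> > K then g x else 0)" for x
    have kabs: "(\<lambda>x. if \<bar>g x\<bar> > K then \<bar>g x\<bar> else 0) = (\<lambda>x. \<bar>k x\<bar>)" by (auto simp: k_def)
    have e: "e integrable_on {a..b}" unfolding e_def by (intro int) auto
    have k: "k integrable_on {a..b}" "(\<lambda>x. \<bar>k x\<bar>) integrable_on {a..b}"
      unfolding k_def by (intro int; auto)+
    define D where "D = integral {a..b} (\<lambda>x. \<bar>k x\<bar>)"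
    define \<Delta> where "\<Delta> = integral {a..b} k"
    have D0: "0 \<le> D" unfolding D_def using k(2) by (intro integral_nonneg) auto
    have sub: "\<bar>integral {a..x} k\<bar> \<le> D" if "x \<in> {a..b}" for x
    proof -
      have kx: "k integrable_on {a..x}" "(\<lambda>x. \<bar>k x\<bar>) integrable_on {a..x}"
        using k that by (auto intro: integrable_on_subinterval)
      have "\<bar>integral {a..x} k\<bar> \<le> integral {a..x} (\<lambda>x. \<bar>k x\<bar>)"
        using integral_norm_bound_integral[OF kx] by simp
      also have "\<dots> \<le> D" unfolding D_def using kx k that by (intro integral_subset_le) auto
      finally show ?thesis .
    qed
    have \<Delta>D: "\<bar>\<Delta>\<bar> \<le> D" using sub[of b] ab by (simp add: \<Delta>_def)
    have eD: "integral {a..b} e \<le> D"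
      unfolding D_def using e k(2) pos by (intro integral_le) (auto simp: e_def k_def)
    have NDh: "N * D \<le> (C0 + 1) * ?h"
    proof -
      have Nk: "(\<lambda>x. N * \<bar>k x\<bar>) integrable_on {a..b}" using integrable_cmul[OF k(2), of N] by simp
      have "ennreal (integral {a..b} (\<lambda>x. N * \<bar>k x\<bar>)) = (\<integral>\<^sup>+x. ennreal (N * \<bar>k x\<bar>) * indicator {a..b} x \<partial>lebesgue)"
        by (rule nn_integral_Icc_eq_integral(1)[OF Nk, symmetric]) (use pos in auto)
      also have "\<dots> \<le> energy \<Lambda> a b u g"
        unfolding energy_def
        by (intro nn_integral_mono) (auto simp: indicator_def k_def nonneg intro!: ennreal_leI steep)
      also note energy_u
      finally have "integral {a..b} (\<lambda>x. N * \<bar>k x\<bar>) \<le> (C0 + 1) * ?h"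
        using C0(1) ab by (subst (asm) ennreal_le_iff) auto
      then show ?thesis by (simp add: D_def)
    qed
    have Dh: "D \<le> ?h / 4"
    proof -
      have "4 * (C0 + 1) * D \<le> N * D" using D0 pos by (intro mult_right_mono) auto
      moreover have "4 * (C0 + 1) * D = (C0 + 1) * (4 * D)" by simp
      ultimately have "(C0 + 1) * (4 * D) \<le> (C0 + 1) * ?h" using NDh by linarith
      then show ?thesis using C0(1) by simp
    qed
    (* the set of moderate slopes to the left of \<tau> has measure exactly |\<Delta>| *)
    obtain \<tau> where \<tau>: "a \<le> \<tau>" "\<tau> \<le> b" "integral {a..\<tau>} f = \<bar>\<Delta>\<bar>"
    proof -
      have "\<bar>\<Delta>\<bar> \<le> integral {a..b} f" using F Dh \<Delta>D ab by linarith
      then show thesis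
        using IVT'[of "\<lambda>\<tau>. integral {a..\<tau>} f" a "\<bar>\<Delta>\<bar>" b] ab indefinite_integral_continuous_1[OF f] that by auto
    qed
    define f\<tau> where "f\<tau> x = (if x \<le> \<tau> then f x else 0)" for x
    have f\<tau>: "f\<tau> integrable_on {a..b}"
    proof -
      have [measurable]: "(\<lambda>x::real. x) \<in> borel_measurable (lebesgue_on {a..b})"
        by (intro continuous_imp_measurable_on_sets_lebesgue continuous_on_id) auto
      show ?thesis unfolding f\<tau>_def f_def by (intro int) auto
    qed
    have f\<tau>int: "integral {a..b} f\<tau> = \<bar>\<Delta>\<bar>"
    proof -
      have "integral {a..b} f\<tau> = integral {a..\<tau>} f\<tau> + integral {\<tau>..b} f\<tau>"
        using \<tau> f\<tau> by (intro Henstock_Kurzweil_Integration.integral_combine[symmetric])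
      also have "integral {a..\<tau>} f\<tau> = integral {a..\<tau>} f" by (intro integral_cong) (auto simp: f\<tau>_def)
      also have "integral {\<tau>..b} f\<tau> = integral {\<tau>..b} (\<lambda>_. 0)"
        by (intro integral_spike[of "{\<tau>}"]) (auto simp: f\<tau>_def)
      finally show ?thesis using \<tau> by simp
    qed
    have f\<tau>x: "0 \<le> integral {a..x} f\<tau> \<and> integral {a..x} f\<tau> \<le> \<bar>\<Delta>\<bar>" if "x \<in> {a..b}" for x
    proof -
      have i: "f\<tau> integrable_on {a..x}" using f\<tau> that by (auto intro: integrable_on_subinterval)
      have "0 \<le> integral {a..x} f\<tau>" using i by (intro integral_nonneg) (auto simp: f\<tau>_def f_def)
      moreover have "integral {a..x} f\<tau> \<le> integral {a..b} f\<tau>"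
        using i f\<tau> that by (intro integral_subset_le) (auto simp: f\<tau>_def f_def)
      ultimately show ?thesis using f\<tau>int by simp
    qed
    (* the competitor: no steep slopes, and the displacement \<Delta> restored on that set *)
    define h where "h x = g x - k x + sgn \<Delta> * f\<tau> x" for x
    define v where "v x = u a + integral {a..x} h" for x
    have habs: "h absolutely_integrable_on {a..b}"
    proof (rule int_abs)
      have [measurable]: "(\<lambda>x::real. x) \<in> borel_measurable (lebesgue_on {a..b})"
        by (intro continuous_imp_measurable_on_sets_lebesgue continuous_on_id) auto
      show "h \<in> borel_measurable (lebesgue_on {a..b})"
        unfolding h_def k_def f\<tau>_def f_def by measurable
      show "\<bar>h x\<bar> \<le> \<bar>g x\<bar> + 1" for x
        by (auto simp: h_def k_def f\<tau>_def f_def sgn_if)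
    qed
    have v: "has_density a b v h"
      by (rule has_densityI[OF habs]) (simp add: v_def)
    have vu: "v x = u x - integral {a..x} k + sgn \<Delta> * integral {a..x} f\<tau>" if "x \<in> {a..b}" for x
    proof -
      have "g integrable_on {a..x}" "k integrable_on {a..x}" "f\<tau> integrable_on {a..x}"
        using g k f\<tau> that by (auto intro: integrable_on_subinterval)
      then have "integral {a..x} h = integral {a..x} g - integral {a..x} k + sgn \<Delta> * integral {a..x} f\<tau>"
        unfolding h_def using integrable_cmul[of f\<tau> "{a..x}" "sgn \<Delta>"]
        by (simp add: integral_add integral_diff integrable_diff)
      then show ?thesis using has_density_increment[OF u order_refl, of x] that by (simp add: v_def)
    qed
    have va: "v a = u a" by (simp add: v_def)
    have vb: "v b = u b" using vu[of b] ab f\<tau>int by (simp add: \<Delta>_def[symmetric] sgn_mult_abs)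
    have vdiff: "\<bar>v x - u x\<bar> \<le> 2 * D" if "x \<in> {a..b}" for x
    proof -
      have "\<bar>sgn \<Delta> * integral {a..x} f\<tau>\<bar> \<le> D" using f\<tau>x[OF that] \<Delta>D by (auto simp: abs_mult sgn_if)
      then show ?thesis using vu[OF that] sub[OF that] by linarith
    qed
    have "4 * D \<le> ?h" using Dh by simp
    then have D1: "2 * D \<le> 1" using D0 ab(2) pos(5) by linarith
    define \<psi> where "\<psi> x = C1 * (e x + f\<tau> x) + CL * (2 * D)" for x
    have \<psi>: "\<psi> integrable_on {a..b}"
    proof -
      have "(\<lambda>x. C1 *\<^sub>R (e x + f\<tau> x)) integrable_on {a..b}" by (intro integrable_cmul integrable_add e f\<tau>)
      then have "(\<lambda>x. C1 *\<^sub>R (e x + f\<tau> x) + CL * (2 * D)) integrable_on {a..b}"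
        by (rule integrable_add[OF _ integrable_const_ivl])
      then show ?thesis unfolding \<psi>_def by simp
    qed
    have Nk: "(\<lambda>x. N * \<bar>k x\<bar>) integrable_on {a..b}" using integrable_cmul[OF k(2), of N] by simp
    have "energy \<Lambda> a b v h + ennreal (integral {a..b} (\<lambda>x. N * \<bar>k x\<bar>))
        \<le> energy \<Lambda> a b u g + ennreal (integral {a..b} \<psi>)"
    proof (rule energy_compare[OF borel nonneg u v Nk _ \<psi>])
      show "0 \<le> N * \<bar>k x\<bar>" for x using pos by auto
      show "0 \<le> \<psi> x" for x using C1(1) CL(1) D0 by (auto simp: \<psi>_def e_def f\<tau>_def f_def)
      fix x assume x: "x \<in> {a..b}"
      have xR: "\<bar>x\<bar> \<le> R" using x ab by auto
      have vR: "\<bar>v x\<bar> \<le> R + 1" using vdiff[OF x] uR[OF x] D1 by linarith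
      have CLD: "0 \<le> CL * (2 * D)" using CL(1) D0 by simp
      consider "\<bar>g x\<bar> > K" | "\<bar>g x\<bar> \<le> P" "x \<le> \<tau>" | "\<bar>g x\<bar> \<le> K" "\<not> (\<bar>g x\<bar> \<le> P \<and> x \<le> \<tau>)" by linarith
      then show "\<Lambda> (x, v x, h x) + N * \<bar>k x\<bar> \<le> \<Lambda> (x, u x, g x) + \<psi> x"
      proof cases
        case 1
        then have "h x = 0" "k x = g x" "e x = 1" "f\<tau> x = 0" using pos by (auto simp: h_def k_def f\<tau>_def f_def e_def)
        then show ?thesis
          using C1(2)[OF xR vR, of 0] steep[OF 1, of x "u x"] pos CLD by (simp add: \<psi>_def)
      next
        case 2
        then have hx: "k x = 0" "e x = 0" "f\<tau> x = 1" "\<bar>h x\<bar> \<le> P + 1"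
          using pos by (auto simp: h_def k_def f\<tau>_def f_def e_def sgn_if)
        then show ?thesis
          using C1(2)[OF xR vR hx(4)] nonneg[of "(x, u x, g x)"] CLD by (simp add: \<psi>_def)
      next
        case 3
        then have hx: "h x = g x" "k x = 0" "e x = 0" "f\<tau> x = 0"
          by (auto simp: h_def k_def f\<tau>_def f_def e_def)
        have "\<Lambda> (x, v x, g x) \<le> \<Lambda> (x, u x, g x) + CL * \<bar>v x - u x\<bar>"
          using xR vR uR[OF x] 3 by (intro CL(2)) auto
        also have "\<dots> \<le> \<Lambda> (x, u x, g x) + CL * (2 * D)"
          using vdiff[OF x] CL(1) by (intro add_left_mono mult_left_mono)
        finally show ?thesis using hx by (simp add: \<psi>_def)
      qed
    qed
    moreover have "integral {a..b} (\<lambda>x. N * \<bar>k x\<bar>) = N * D" by (simp add: D_def)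
    moreover have "integral {a..b} \<psi> \<le> (2 * C1 + 1) * D"
    proof -
      have "integral {a..b} \<psi> = C1 * (integral {a..b} e + integral {a..b} f\<tau>) + CL * (2 * D) * ?h"
      proof -
        have i: "(\<lambda>x. e x + f\<tau> x) integrable_on {a..b}" by (rule integrable_add[OF e f\<tau>])
        have ii: "(\<lambda>x. C1 * (e x + f\<tau> x)) integrable_on {a..b}" using integrable_cmul[OF i, of C1] by simp
        have "integral {a..b} \<psi> = integral {a..b} (\<lambda>x. C1 * (e x + f\<tau> x)) + integral {a..b} (\<lambda>_. CL * (2 * D))"
          unfolding \<psi>_def by (rule integral_add[OF ii integrable_const_ivl])
        also have "integral {a..b} (\<lambda>x. C1 * (e x + f\<tau> x)) = C1 * (integral {a..b} e + integral {a..b} f\<tau>)"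
          by (simp add: integral_add[OF e f\<tau>])
        finally show ?thesis using ab by simp
      qed
      also have "\<dots> \<le> C1 * (D + D) + 1 * D"
      proof (rule add_mono)
        show "C1 * (integral {a..b} e + integral {a..b} f\<tau>) \<le> C1 * (D + D)"
          using eD \<Delta>D f\<tau>int C1(1) by (intro mult_left_mono) auto
        have "2 * CL * ?h \<le> 2 * CL * \<delta>" using ab CL(1) by (intro mult_left_mono) auto
        then have "(2 * CL * ?h) * D \<le> 1 * D" using pos D0 by (intro mult_right_mono) auto
        then show "CL * (2 * D) * ?h \<le> 1 * D" by (simp add: ac_simps)
      qed
      finally show ?thesis by (simp add: algebra_simps)
    qed
    ultimately have 1: "energy \<Lambda> a b v h + ennreal (N * D) \<le> energy \<Lambda> a b u g + ennreal ((2 * C1 + 1) * D)"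
      by (metis add_left_mono ennreal_leI order_trans)
    have 2: "energy \<Lambda> a b u g \<le> energy \<Lambda> a b v h + ennreal \<epsilon>"
      using nm v va vb unfolding near_min_def by blast
    have fin: "energy \<Lambda> a b v h \<noteq> top"
    proof -
      have "energy \<Lambda> a b u g < \<infinity>" using nm by (simp add: near_min_def)
      then have "energy \<Lambda> a b u g + ennreal ((2 * C1 + 1) * D) < \<infinity>" by simp
      then show ?thesis using 1 by (auto simp: top_unique)
    qed
    have "energy \<Lambda> a b v h + ennreal (N * D) \<le> energy \<Lambda> a b v h + (ennreal \<epsilon> + ennreal ((2 * C1 + 1) * D))"
      using order_trans[OF 1 add_right_mono[OF 2]] by (simp add: add.assoc)
    then have "ennreal (N * D) \<le> ennreal \<epsilon> + ennreal ((2 * C1 + 1) * D)"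
      using fin by (simp add: ennreal_add_left_cancel_le)
    also have "\<dots> = ennreal (\<epsilon> + (2 * C1 + 1) * D)" using \<epsilon>(1) C1(1) D0 by simp
    finally have "N * D \<le> \<epsilon> + (2 * C1 + 1) * D"
      using \<epsilon>(1) C1(1) D0 by (subst (asm) ennreal_le_iff) auto
    moreover have "(2 * C1 + 2) * D \<le> N * D" using pos D0 by (intro mult_right_mono) auto
    ultimately have "D \<le> \<epsilon>" by (simp add: algebra_simps)
    then show "(\<lambda>x. if \<bar>g x\<bar> > K then \<bar>g x\<bar> else 0) integrable_on {a..b}
         \<and> integral {a..b} (\<lambda>x. if \<bar>g x\<bar> > K then \<bar>g x\<bar> else 0) \<le> \<epsilon>"
      unfolding kabs using k(2) by (simp add: D_def)
  qed (use pos in auto)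
qed

text \<open>
  Slopes up to \<open>K\<close> contribute at most \<open>K (t - s)\<close> to an increment, and the steeper ones at most \<open>\<epsilon>\<close>.
\<close>

lemma near_min_lipschitz:
  assumes "0 \<le> M"
  obtains \<delta> K where "\<delta> > 0" "K \<ge> 0"
    "\<And>\<epsilon> a b u g s t. \<lbrakk>near_min \<Lambda> \<epsilon> a b u g; a < b; b - a \<le> \<delta>; \<bar>a\<bar> \<le> R; \<bar>b\<bar> \<le> R;
       \<And>x. x \<in> {a..b} \<Longrightarrow> \<bar>u x\<bar> \<le> R; \<bar>u b - u a\<bar> \<le> M * (b - a); 0 \<le> \<epsilon>; \<epsilon> \<le> b - a;
       a \<le> s; s \<le> t; t \<le> b\<rbrakk> \<Longrightarrow> \<bar>u t - u s\<bar> \<le> K * (t - s) + \<epsilon>"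
proof -
  obtain \<delta> K where \<delta>K: "\<delta> > 0" "K \<ge> 0"
    and *: "\<And>\<epsilon> a b u g. \<lbrakk>near_min \<Lambda> \<epsilon> a b u g; a < b; b - a \<le> \<delta>; \<bar>a\<bar> \<le> R; \<bar>b\<bar> \<le> R;
       \<And>x. x \<in> {a..b} \<Longrightarrow> \<bar>u x\<bar> \<le> R; \<bar>u b - u a\<bar> \<le> M * (b - a); 0 \<le> \<epsilon>; \<epsilon> \<le> b - a\<rbrakk>
      \<Longrightarrow> (\<lambda>x. if \<bar>g x\<bar> > K then \<bar>g x\<bar> else 0) integrable_on {a..b}
         \<and> integral {a..b} (\<lambda>x. if \<bar>g x\<bar> > K then \<bar>g x\<bar> else 0) \<le> \<epsilon>"
    by (fact near_min_steep_part[OF assms])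
  show thesis
  proof (rule that[OF \<delta>K])
    fix \<epsilon> a b u g s t
    assume A: "near_min \<Lambda> \<epsilon> a b u g" "a < b" "b - a \<le> \<delta>" "\<bar>a\<bar> \<le> R" "\<bar>b\<bar> \<le> R"
      "\<And>x. x \<in> {a..b} \<Longrightarrow> \<bar>u x\<bar> \<le> R" "\<bar>u b - u a\<bar> \<le> M * (b - a)" "0 \<le> \<epsilon>" "\<epsilon> \<le> b - a"
      and st: "a \<le> s" "s \<le> t" "t \<le> b"
    let ?k = "\<lambda>x. if \<bar>g x\<bar> > K then \<bar>g x\<bar> else 0"
    have k: "?k integrable_on {a..b}" "integral {a..b} ?k \<le> \<epsilon>" using *[OF A] by auto
    have u: "has_density a b u g" using A(1) by (simp add: near_min_def)
    have kst: "?k integrable_on {s..t}" using k(1) st by (auto intro: integrable_on_subinterval)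
    have "\<bar>u t - u s\<bar> \<le> integral {s..t} (\<lambda>x. \<bar>g x\<bar>)" by (rule has_density_increment_le[OF u st])
    also have "\<dots> \<le> integral {s..t} (\<lambda>x. K + ?k x)"
      using \<delta>K(2) by (intro integral_le has_density_integrable(3)[OF u st(1,3)] integrable_add integrable_const_ivl kst) auto
    also have "\<dots> = K * (t - s) + integral {s..t} ?k"
      using st by (simp add: integral_add[OF integrable_const_ivl kst])
    also have "integral {s..t} ?k \<le> integral {a..b} ?k"
      using k(1) kst st by (intro integral_subset_le) auto
    finally show "\<bar>u t - u s\<bar> \<le> K * (t - s) + \<epsilon>" using k(2) by linarith
  qed
qed

end

section \<open>Locally uniform limits of near minimizers\<close>

text \<open>
  Approximating curves are only controlled inside an open interval. Points of the closed interval are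
  approached by these interior points, with monotone dependence on the point and without
  increasing distances.
\<close>

definition inward :: "real \<Rightarrow> real \<Rightarrow> nat \<Rightarrow> real \<Rightarrow> real" where
  "inward a b n x = max (a + (b - a) / (real n + 3)) (min (b - (b - a) / (real n + 3)) x)"

lemma inward_bounds:
  assumes "a < b"
  shows "a < inward a b n x" "inward a b n x < b"
    and "x \<le> y \<Longrightarrow> inward a b n x \<le> inward a b n y"
    and "x \<le> y \<Longrightarrow> inward a b n y - inward a b n x \<le> y - x"
proof -
  define h where "h = (b - a) / (real n + 3)"
  have "h * (real n + 3) = b - a" "0 < h" using assms by (auto simp: h_def)
  moreover have "3 * h \<le> h * (real n + 3)" using \<open>0 < h\<close> by (simp add: algebra_simps)
  ultimately have h: "0 < h" "3 * h \<le> b - a" by auto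
  then show "a < inward a b n x" "inward a b n x < b"
    and "x \<le> y \<Longrightarrow> inward a b n x \<le> inward a b n y"
    and "x \<le> y \<Longrightarrow> inward a b n y - inward a b n x \<le> y - x"
    unfolding inward_def h_def[symmetric] by (auto simp: max_def min_def)
qed

lemma inward_tendsto:
  assumes "x \<in> {a..b}"
  shows "(\<lambda>n. inward a b n x) \<longlonglongrightarrow> x"
proof -
  have "(\<lambda>n. (b - a) / (real n + 3)) \<longlonglongrightarrow> 0"
    by (intro tendsto_divide_0[OF tendsto_const] filterlim_at_top_imp_at_infinity
        filterlim_tendsto_add_at_top[OF tendsto_const, of _ _ 3, simplified add.commute] filterlim_real_sequentially)
  then have "(\<lambda>n. inward a b n x) \<longlonglongrightarrow> max (a + 0) (min (b - 0) x)"
    unfolding inward_def by (intro tendsto_intros)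
  then show ?thesis using assms by simp
qed

lemma inward_tendsto_cont:
  fixes u :: "real \<Rightarrow> real"
  assumes "continuous_on {a..b} u" "x \<in> {a'..b'}" "a' < b'" "a \<le> a'" "b' \<le> b"
  shows "(\<lambda>n. u (inward a' b' n x)) \<longlonglongrightarrow> u x"
proof (rule continuous_on_tendsto_compose[OF assms(1) inward_tendsto[OF assms(2)]])
  show "x \<in> {a..b}" using assms by auto
  have "inward a' b' n x \<in> {a..b}" for n
    using inward_bounds(1,2)[OF assms(3), of n x] assms(4,5) by auto
  then show "\<forall>\<^sub>F n in sequentially. inward a' b' n x \<in> {a..b}" by simp
qed

text \<open>
  The consequence of being a generalized minimizer that refers to the energy alone.
\<close>

definition locally_near_min ::
    "(real \<times> real \<times> real \<Rightarrow> real) \<Rightarrow> real \<Rightarrow> real \<Rightarrow> (real \<Rightarrow> real) \<Rightarrow> bool" where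
  "locally_near_min \<Lambda> a b u \<longleftrightarrow> continuous_on {a..b} u \<and>
     (\<forall>s t \<eta>. a < s \<and> s \<le> t \<and> t < b \<and> 0 < \<eta> \<longrightarrow>
        (\<exists>v g. near_min \<Lambda> \<eta> s t v g \<and> (\<forall>x\<in>{s..t}. \<bar>v x - u x\<bar> \<le> \<eta>)))"

context coercive_lagrangian
begin

text \<open>
  Inside the interval the tolerance of the approximating near minimizers tends to \<open>0\<close> in
  \<open>near_min_lipschitz\<close>. The strict inequality for the chord makes it survive the approximation, also of the
  end points.
\<close>

lemma locally_near_min_lipschitz:
  assumes "0 \<le> M"
  obtains \<delta> K where "\<delta> > 0" "K \<ge> 0"
    "\<And>a b u s t x y. \<lbrakk>locally_near_min \<Lambda> a b u; \<bar>a\<bar> \<le> R; \<bar>b\<bar> \<le> R; \<And>x. x \<in> {a..b} \<Longrightarrow> \<bar>u x\<bar> \<le> R;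
       a \<le> s; s < t; t \<le> b; t - s \<le> \<delta>; \<bar>u t - u s\<bar> < M * (t - s); s \<le> x; x \<le> y; y \<le> t\<rbrakk>
      \<Longrightarrow> \<bar>u y - u x\<bar> \<le> K * (y - x)"
proof -
  obtain \<delta> K where \<delta>K: "\<delta> > 0" "K \<ge> 0"
    and *: "\<And>\<epsilon> a b u g s t. \<lbrakk>near_min \<Lambda> \<epsilon> a b u g; a < b; b - a \<le> \<delta>; \<bar>a\<bar> \<le> R + 1; \<bar>b\<bar> \<le> R + 1;
       \<And>x. x \<in> {a..b} \<Longrightarrow> \<bar>u x\<bar> \<le> R + 1; \<bar>u b - u a\<bar> \<le> M * (b - a); 0 \<le> \<epsilon>; \<epsilon> \<le> b - a;
       a \<le> s; s \<le> t; t \<le> b\<rbrakk> \<Longrightarrow> \<bar>u t - u s\<bar> \<le> K * (t - s) + \<epsilon>"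
    by (fact near_min_lipschitz[OF assms])
  have interior: "\<bar>u y - u x\<bar> \<le> K * (y - x)"
    if lnm: "locally_near_min \<Lambda> a b u" and R: "\<bar>a\<bar> \<le> R" "\<bar>b\<bar> \<le> R" "\<And>x. x \<in> {a..b} \<Longrightarrow> \<bar>u x\<bar> \<le> R"
      and st: "a < s" "s < t" "t < b" "t - s \<le> \<delta>" and slope: "\<bar>u t - u s\<bar> < M * (t - s)"
      and xy: "s \<le> x" "x \<le> y" "y \<le> t"
    for a b u s t x y
  proof (rule field_le_epsilon)
    fix e :: real assume "e > 0"
    define \<eta> where "\<eta> = Min {e / 3, 1, t - s, (M * (t - s) - \<bar>u t - u s\<bar>) / 2}"
    have "\<eta> > 0" using \<open>e > 0\<close> st slope by (simp add: \<eta>_def)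
    have "\<eta> \<le> e / 3" "\<eta> \<le> 1" "\<eta> \<le> t - s" "\<eta> \<le> (M * (t - s) - \<bar>u t - u s\<bar>) / 2"
      unfolding \<eta>_def by (intro Min_le; simp)+
    then have \<eta>: "3 * \<eta> \<le> e" "\<eta> \<le> 1" "\<eta> \<le> t - s" "2 * \<eta> \<le> M * (t - s) - \<bar>u t - u s\<bar>" by auto
    obtain v g where v: "near_min \<Lambda> \<eta> s t v g" "\<And>x. x \<in> {s..t} \<Longrightarrow> \<bar>v x - u x\<bar> \<le> \<eta>"
      using lnm st \<open>\<eta> > 0\<close> unfolding locally_near_min_def by (meson less_imp_le)
    have "\<bar>v y - v x\<bar> \<le> K * (y - x) + \<eta>"
    proof (rule *[OF v(1) st(2,4) _ _ _ _ less_imp_le[OF \<open>\<eta> > 0\<close>] \<eta>(3) xy])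
      show "\<bar>s\<bar> \<le> R + 1" "\<bar>t\<bar> \<le> R + 1" using R st by auto
      show "\<bar>v x\<bar> \<le> R + 1" if "x \<in> {s..t}" for x
      proof -
        have "\<bar>u x\<bar> \<le> R" using that st by (intro R(3)) auto
        then show ?thesis using v(2)[OF that] \<eta>(2) by linarith
      qed
      show "\<bar>v t - v s\<bar> \<le> M * (t - s)" using v(2)[of t] v(2)[of s] \<eta>(4) st by auto
    qed
    moreover have "\<bar>v x - u x\<bar> \<le> \<eta>" "\<bar>v y - u y\<bar> \<le> \<eta>" using v(2) xy by auto
    ultimately show "\<bar>u y - u x\<bar> \<le> K * (y - x) + e" using \<eta>(1) by linarith
  qed
  show thesis
  proof (rule that[OF \<delta>K])
    fix a b u s t x y
    assume lnm: "locally_near_min \<Lambda> a b u" and R: "\<bar>a\<bar> \<le> R" "\<bar>b\<bar> \<le> R" "\<And>x. x \<in> {a..b} \<Longrightarrow> \<bar>u x\<bar> \<le> R"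
      and st: "a \<le> s" "s < t" "t \<le> b" "t - s \<le> \<delta>" and slope: "\<bar>u t - u s\<bar> < M * (t - s)"
      and xy: "s \<le> x" "x \<le> y" "y \<le> t"
    have cont: "continuous_on {a..b} u" using lnm by (simp add: locally_near_min_def)
    let ?i = "inward s t"
    note ib = inward_bounds[OF st(2)]
    have lim: "(\<lambda>n. u (?i n z)) \<longlonglongrightarrow> u z" "(\<lambda>n. ?i n z) \<longlonglongrightarrow> z" if "z \<in> {s..t}" for z
      using inward_tendsto_cont[OF cont that st(2,1,3)] inward_tendsto[OF that] by auto
    have "(\<lambda>n. M * (?i n t - ?i n s) - \<bar>u (?i n t) - u (?i n s)\<bar>) \<longlonglongrightarrow> M * (t - s) - \<bar>u t - u s\<bar>"
      using st by (intro tendsto_intros lim) auto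
    then have "\<forall>\<^sub>F n in sequentially. 0 < M * (?i n t - ?i n s) - \<bar>u (?i n t) - u (?i n s)\<bar>"
      using slope by (intro order_tendstoD(1)) auto
    moreover have "(\<lambda>n. ?i n t - ?i n s) \<longlonglongrightarrow> t - s" using st by (intro tendsto_intros lim) auto
    then have "\<forall>\<^sub>F n in sequentially. 0 < ?i n t - ?i n s" using st by (intro order_tendstoD(1)) auto
    ultimately have "\<forall>\<^sub>F n in sequentially. \<bar>u (?i n y) - u (?i n x)\<bar> \<le> K * (?i n y - ?i n x)"
    proof eventually_elim
      case (elim n)
      have "?i n t - ?i n s \<le> t - s" using ib(4)[of s t n] st by simp
      then show ?case
        using elim st xy ib(1)[of n s] ib(2)[of n t] ib(3)[of s x n] ib(3)[of x y n] ib(3)[of y t n]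
        by (intro interior[OF lnm R, of "?i n s" "?i n t"]) auto
    qed
    moreover have l1: "(\<lambda>n. \<bar>u (?i n y) - u (?i n x)\<bar>) \<longlonglongrightarrow> \<bar>u y - u x\<bar>"
      using xy by (intro tendsto_intros lim) auto
    moreover have l2: "(\<lambda>n. K * (?i n y - ?i n x)) \<longlonglongrightarrow> K * (y - x)"
      using xy by (intro tendsto_intros lim) auto
    ultimately show "\<bar>u y - u x\<bar> \<le> K * (y - x)"
      using tendsto_le[OF trivial_limit_sequentially l2 l1] by blast
  qed
qed

lemma infinite_derivative_not_lipschitz:
  fixes u :: "real \<Rightarrow> real"
  assumes "filterlim (\<lambda>x. (u x - u a) / (x - a)) at_top (at a within {a..b})" "a < c" "c \<le> b"
  obtains z where "a < z" "z < c" "u z - u a > K * (z - a)"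
proof -
  have "\<forall>\<^sub>F x in at a within {a..b}. K < (u x - u a) / (x - a)"
    using assms(1) by (simp add: filterlim_at_top_dense)
  then obtain d where d: "d > 0" "\<And>x. x \<in> {a..b} \<Longrightarrow> x \<noteq> a \<Longrightarrow> dist x a < d \<Longrightarrow> K < (u x - u a) / (x - a)"
    unfolding eventually_at by blast
  have "a < min (a + d) c" using d(1) assms by simp
  then obtain z where "a < z" "z < min (a + d) c" using dense by blast
  then have z: "a < z" "z < c" "z \<le> b" "dist z a < d" using assms by (auto simp: dist_real_def)
  have "K < (u z - u a) / (z - a)" using z by (intro d(2)) auto
  then have "u z - u a > K * (z - a)" using z by (simp add: field_simps)
  with z that show thesis by blast
qed

text \<open>
  A shallow chord starting at a point of infinite derivative would make the function Lipschitz
  near that point.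
\<close>

lemma uniformly_steep:
  assumes "0 < M"
  obtains \<delta> where "\<delta> > 0"
    "\<And>a b u x. \<lbrakk>locally_near_min \<Lambda> a b u; \<bar>a\<bar> \<le> R; \<bar>b\<bar> \<le> R; \<And>x. x \<in> {a..b} \<Longrightarrow> \<bar>u x\<bar> \<le> R;
       filterlim (\<lambda>x. (u x - u a) / (x - a)) at_top (at a within {a..b});
       a \<le> x; x \<le> b; x - a \<le> \<delta>\<rbrakk> \<Longrightarrow> M * (x - a) \<le> u x - u a"
proof -
  have "0 \<le> M" using assms by simp
  obtain \<delta> K where \<delta>K: "\<delta> > 0" "K \<ge> 0"
    and *: "\<And>a b u s t x y. \<lbrakk>locally_near_min \<Lambda> a b u; \<bar>a\<bar> \<le> R; \<bar>b\<bar> \<le> R; \<And>x. x \<in> {a..b} \<Longrightarrow> \<bar>u x\<bar> \<le> R;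
       a \<le> s; s < t; t \<le> b; t - s \<le> \<delta>; \<bar>u t - u s\<bar> < M * (t - s); s \<le> x; x \<le> y; y \<le> t\<rbrakk>
      \<Longrightarrow> \<bar>u y - u x\<bar> \<le> K * (y - x)"
    by (fact locally_near_min_lipschitz[OF \<open>0 \<le> M\<close>])
  show thesis
  proof (rule that[OF \<delta>K(1)], rule ccontr)
    fix a b u x
    assume lnm: "locally_near_min \<Lambda> a b u" and R: "\<bar>a\<bar> \<le> R" "\<bar>b\<bar> \<le> R" "\<And>x. x \<in> {a..b} \<Longrightarrow> \<bar>u x\<bar> \<le> R"
      and inf: "filterlim (\<lambda>x. (u x - u a) / (x - a)) at_top (at a within {a..b})"
      and x: "a \<le> x" "x \<le> b" "x - a \<le> \<delta>" and "\<not> M * (x - a) \<le> u x - u a"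
    then have less: "u x - u a < M * (x - a)" and "a < x" by (auto simp: le_less)
    have no_shallow: False if t: "a < t" "t \<le> x" "\<bar>u t - u a\<bar> < M * (t - a)" for t
    proof -
      have "t \<le> b" using t x by simp
      obtain z where z: "a < z" "z < t" "u z - u a > K * (z - a)"
        using infinite_derivative_not_lipschitz[OF inf t(1) \<open>t \<le> b\<close>] .
      have "\<bar>u z - u a\<bar> \<le> K * (z - a)"
        using t x z by (intro *[OF lnm R, of a t]) auto
      with z(3) show False by simp
    qed
    show False
    proof (cases "- (M * (x - a)) < u x - u a")
      case True
      then show False using no_shallow[of x] less \<open>a < x\<close> by (simp add: abs_less_iff)
    next
      case False
      then have "u x \<le> u a" using assms \<open>a < x\<close> mult_pos_pos[of M "x - a"] by linarith
      obtain z where z: "a < z" "z < x" "u z - u a > 0 * (z - a)"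
        using infinite_derivative_not_lipschitz[OF inf \<open>a < x\<close> x(2)] .
      have "continuous_on {z..x} u"
        using lnm z x by (auto simp: locally_near_min_def intro: continuous_on_subset)
      then obtain t where "z \<le> t" "t \<le> x" "u t = u a"
        using IVT2'[of u x "u a" z] z \<open>u x \<le> u a\<close> by auto
      then show False using no_shallow[of t] z assms by auto
    qed
  qed
qed

text \<open>
  Bounded values over an interval of length \<open>d\<close> bound the slope of long chords, hence the energy of the
  approximating near minimizers, and superlinearity turns a bound for the energy into a modulus of
  continuity. The interval \<open>[x, y]\<close> is enlarged so as to contain the middle half of \<open>[a, a + d]\<close>, and then its
  chord is long.
\<close>

lemma locally_near_min_equicontinuous:
  assumes "0 < d" "0 < e"
  obtains \<delta> where "\<delta> > 0"
    "\<And>a u x y. \<lbrakk>locally_near_min \<Lambda> a (a + d) u; \<bar>a\<bar> \<le> R; \<bar>a + d\<bar> \<le> R; \<And>x. x \<in> {a..a + d} \<Longrightarrow> \<bar>u x\<bar> \<le> R;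
       a \<le> x; x \<le> y; y \<le> a + d; y - x \<le> \<delta>\<rbrakk> \<Longrightarrow> \<bar>u y - u x\<bar> \<le> e"
proof -
  define M where "M = 4 * (\<bar>R\<bar> + 1) / d"
  have "0 \<le> M" using assms by (simp add: M_def)
  obtain C where C: "C \<ge> 0" "\<And>x y p. \<bar>x\<bar> \<le> R + 1 \<Longrightarrow> \<bar>y\<bar> \<le> R + 1 \<Longrightarrow> \<bar>p\<bar> \<le> M \<Longrightarrow> \<Lambda> (x, y, p) \<le> C"
    by (fact bounded_choice)
  define A where "A = C * d + 1"
  have "A > 0" using C assms by (simp add: A_def add_nonneg_pos)
  define N where "N = 4 * (A + 1) / e"
  have "N > 0" using \<open>A > 0\<close> assms by (simp add: N_def)
  obtain c where c: "c \<ge> 0" "\<And>x y p. N * \<bar>p\<bar> \<le> \<Lambda> (x, y, p) + c" using coercive[of N] by blast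
  define \<delta> where "\<delta> = 1 / (c + 1)"
  have \<delta>: "\<delta> > 0" "c * \<delta> \<le> 1" using c(1) by (auto simp: \<delta>_def)
  have interior: "\<bar>u y - u x\<bar> \<le> e"
    if lnm: "locally_near_min \<Lambda> a (a + d) u" and R: "\<bar>a\<bar> \<le> R" "\<bar>a + d\<bar> \<le> R" "\<And>x. x \<in> {a..a + d} \<Longrightarrow> \<bar>u x\<bar> \<le> R"
      and xy: "a < x" "x \<le> y" "y < a + d" "y - x \<le> \<delta>" for a u x y
  proof -
    define s where "s = min x (a + d / 4)"
    define t where "t = max y (a + 3 * d / 4)"
    have st: "a < s" "s \<le> x" "y \<le> t" "t < a + d" "d / 2 \<le> t - s" "t - s \<le> d"
      using xy assms(1) by (auto simp: s_def t_def min_def max_def)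
    define \<eta> where "\<eta> = min 1 (e / 4)"
    have \<eta>: "\<eta> > 0" "\<eta> \<le> 1" "\<eta> \<le> e / 4" using assms(2) by (auto simp: \<eta>_def)
    have "s < t" using st assms by linarith
    obtain v g where v: "near_min \<Lambda> \<eta> s t v g" "\<And>x. x \<in> {s..t} \<Longrightarrow> \<bar>v x - u x\<bar> \<le> \<eta>"
      using lnm st(1,4) \<open>s < t\<close> \<eta>(1) unfolding locally_near_min_def by (meson less_imp_le)
    have vR: "\<bar>v x\<bar> \<le> R + 1" if "x \<in> {s..t}" for x
    proof -
      have "\<bar>u x\<bar> \<le> R" using that st by (intro R(3)) auto
      then show ?thesis using v(2)[OF that] \<eta>(2) by linarith
    qed
    have "energy \<Lambda> s t v g \<le> ennreal (C * (t - s) + \<eta>)"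
    proof (rule near_min_energy_le[OF v(1) \<open>s < t\<close> _ _ _ _ _ _ C(1)])
      have "\<bar>v t - v s\<bar> \<le> 2 * (\<bar>R\<bar> + 1)" using vR[of s] vR[of t] \<open>s < t\<close> by auto
      also have "\<dots> = M * (d / 2)" using assms(1) by (simp add: M_def)
      also have "\<dots> \<le> M * (t - s)" using st \<open>0 \<le> M\<close> by (intro mult_left_mono) auto
      finally show "\<bar>v t - v s\<bar> \<le> M * (t - s)" .
      show "\<bar>s\<bar> \<le> R + 1" "\<bar>t\<bar> \<le> R + 1" using st R \<open>s < t\<close> by auto
      show "\<bar>v s\<bar> \<le> R + 1" "\<bar>v t\<bar> \<le> R + 1" using vR \<open>s < t\<close> by auto
    qed (use \<eta> C in auto)
    also have "\<dots> \<le> ennreal A"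
    proof (rule ennreal_leI)
      have "C * (t - s) \<le> C * d" using C(1) st by (intro mult_left_mono) auto
      then show "C * (t - s) + \<eta> \<le> A" using \<eta> by (simp add: A_def)
    qed
    finally have E: "energy \<Lambda> s t v g \<le> ennreal A" .
    have vd: "has_density s t v g" using v(1) by (simp add: near_min_def)
    have vxy: "has_density x y v g" using st by (intro has_density_subinterval[OF vd]) auto
    have "energy \<Lambda> x y v g \<le> energy \<Lambda> s t v g"
      unfolding energy_def using st by (intro nn_integral_mono) (auto simp: indicator_def)
    with E have E': "energy \<Lambda> x y v g \<le> ennreal A" by (rule order_trans[rotated])
    have "ennreal (N * integral {x..y} (\<lambda>x. \<bar>g x\<bar>)) \<le> energy \<Lambda> x y v g + ennreal (c * (y - x))"
      by (rule energy_coercive[OF vxy xy(2) c(1) _ c(2)]) (use \<open>N > 0\<close> in auto)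
    also have "\<dots> \<le> ennreal A + ennreal 1"
    proof (rule add_mono[OF E' ennreal_leI])
      have "c * (y - x) \<le> c * \<delta>" using c(1) xy by (intro mult_left_mono) auto
      with \<delta>(2) show "c * (y - x) \<le> 1" by linarith
    qed
    also have "\<dots> = ennreal (A + 1)" using \<open>A > 0\<close> by (intro ennreal_plus[symmetric]) auto
    finally have "N * integral {x..y} (\<lambda>x. \<bar>g x\<bar>) \<le> A + 1"
      using \<open>A > 0\<close> by (subst (asm) ennreal_le_iff) auto
    moreover have "N * (e / 4) = A + 1" using assms(2) by (simp add: N_def)
    ultimately have "N * integral {x..y} (\<lambda>x. \<bar>g x\<bar>) \<le> N * (e / 4)" by simp
    then have "integral {x..y} (\<lambda>x. \<bar>g x\<bar>) \<le> e / 4" using \<open>N > 0\<close> by simp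
    moreover have "\<bar>v y - v x\<bar> \<le> integral {x..y} (\<lambda>x. \<bar>g x\<bar>)"
      by (rule has_density_increment_le[OF vxy order_refl xy(2) order_refl])
    moreover have "\<bar>v x - u x\<bar> \<le> \<eta>" "\<bar>v y - u y\<bar> \<le> \<eta>" using v(2) st xy by auto
    ultimately show ?thesis using \<eta>(3) by linarith
  qed
  show thesis
  proof (rule that[OF \<delta>(1)])
    fix a u x y
    assume lnm: "locally_near_min \<Lambda> a (a + d) u" and R: "\<bar>a\<bar> \<le> R" "\<bar>a + d\<bar> \<le> R" "\<And>x. x \<in> {a..a + d} \<Longrightarrow> \<bar>u x\<bar> \<le> R"
      and xy: "a \<le> x" "x \<le> y" "y \<le> a + d" "y - x \<le> \<delta>"
    have cont: "continuous_on {a..a + d} u" using lnm by (simp add: locally_near_min_def)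
    have ad: "a < a + d" using assms by simp
    let ?i = "inward a (a + d)"
    have "(\<lambda>n. \<bar>u (?i n y) - u (?i n x)\<bar>) \<longlonglongrightarrow> \<bar>u y - u x\<bar>"
      using xy ad by (intro tendsto_intros inward_tendsto_cont[OF cont]) auto
    moreover have "\<bar>u (?i n y) - u (?i n x)\<bar> \<le> e" for n
    proof -
      have "?i n y - ?i n x \<le> \<delta>" using inward_bounds(4)[OF ad xy(2), of n] xy(4) by linarith
      then show ?thesis
        using inward_bounds[OF ad] xy by (intro interior[OF lnm R]) auto
    qed
    ultimately show "\<bar>u y - u x\<bar> \<le> e" by (intro LIMSEQ_le_const2) auto
  qed
qed

end

section \<open>From the action to the energy\<close>

definition locally_lipschitz_in_y :: "(real \<times> real \<times> real \<Rightarrow> real) \<Rightarrow> bool" where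
  "locally_lipschitz_in_y L \<longleftrightarrow> (\<forall>R>0. \<exists>C\<ge>0. \<forall>x y1 y2 p.
     \<bar>x\<bar> \<le> R \<and> \<bar>y1\<bar> \<le> R \<and> \<bar>y2\<bar> \<le> R \<and> \<bar>p\<bar> \<le> R \<longrightarrow>
     \<bar>L (x, y1, p) - L (x, y2, p)\<bar> \<le> C * \<bar>y1 - y2\<bar>)"

lemma lagrangian_bounded_on_boxes:
  assumes "lagrangian L"
  shows "\<exists>C. \<forall>x y p. \<bar>x\<bar> \<le> R \<and> \<bar>y\<bar> \<le> R \<and> \<bar>p\<bar> \<le> R \<longrightarrow> L (x, y, p) \<le> C"
proof -
  let ?K = "{-R..R} \<times> {-R..R} \<times> {-R..R}"
  have "compact ?K" by (intro compact_Times) auto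
  have "\<forall>z. \<exists>U. open U \<and> z \<in> U \<and> bdd_above (L ` U)" using assms by (simp add: lagrangian_def)
  then obtain U where U: "\<And>z. open (U z)" "\<And>z. z \<in> U z" "\<And>z. bdd_above (L ` U z)" by metis
  obtain F where F: "F \<subseteq> ?K" "finite F" "?K \<subseteq> (\<Union>z\<in>F. U z)"
  proof (rule compactE_image[OF \<open>compact ?K\<close>, of ?K U])
    show "?K \<subseteq> (\<Union>z\<in>?K. U z)" using U(2) by blast
  qed (use U(1) in auto)
  have "bdd_above (L ` (\<Union>z\<in>F. U z))"
    using F(2) U(3) by (simp add: image_UN bdd_above_UN)
  then obtain C where "\<And>w. w \<in> (\<Union>z\<in>F. U z) \<Longrightarrow> L w \<le> C" by (auto simp: bdd_above_def)
  then have "L (x, y, p) \<le> C" if "\<bar>x\<bar> \<le> R" "\<bar>y\<bar> \<le> R" "\<bar>p\<bar> \<le> R" for x y p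
    using F(3) that by (auto simp: subset_iff abs_le_iff)
  then show ?thesis by blast
qed

text \<open>
  For small slopes the additive constant pays for the left hand side.
\<close>

lemma lagrangian_coercive:
  assumes "lagrangian L" and B: "B \<ge> 0" "\<And>z. - B \<le> L z"
  shows "\<exists>c\<ge>0. \<forall>x y p. N * \<bar>p\<bar> \<le> L (x, y, p) + B + c"
proof -
  obtain \<omega> where \<omega>: "superlinear \<omega>" "\<And>x y p. \<omega> p \<le> L (x, y, p)" using assms(1) by (auto simp: lagrangian_def)
  have "\<forall>\<^sub>F p in at_infinity. N \<le> \<omega> p / \<bar>p\<bar>"
    using \<omega>(1) by (simp add: superlinear_def filterlim_at_top)
  then obtain P where P: "\<And>p. P \<le> \<bar>p\<bar> \<Longrightarrow> N \<le> \<omega> p / \<bar>p\<bar>" by (auto simp: eventually_at_infinity)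
  let ?P = "max P 1"
  have "N * \<bar>p\<bar> \<le> L (x, y, p) + B + \<bar>N\<bar> * ?P" for x y p
  proof (cases "?P \<le> \<bar>p\<bar>")
    case True
    then have "N \<le> \<omega> p / \<bar>p\<bar>" "\<bar>p\<bar> > 0" using P[of p] by auto
    then have "N * \<bar>p\<bar> \<le> \<omega> p" by (simp add: field_simps)
    also have "\<dots> \<le> L (x, y, p)" by (rule \<omega>(2))
    finally show ?thesis using B(1) by (simp add: add_nonneg_nonneg add_increasing2)
  next
    case False
    have "N * \<bar>p\<bar> \<le> \<bar>N\<bar> * \<bar>p\<bar>" by (intro mult_right_mono) auto
    also have "\<dots> \<le> \<bar>N\<bar> * ?P" using False by (intro mult_left_mono) auto
    finally show ?thesis using B(2)[of "(x, y, p)"] by linarith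
  qed
  moreover have "\<bar>N\<bar> * ?P \<ge> 0" by (intro mult_nonneg_nonneg) auto
  ultimately show ?thesis by blast
qed

lemma lagrangian_coercive_lagrangian:
  assumes L: "lagrangian L" "locally_lipschitz_in_y L"
  obtains B where "B \<ge> 0" "\<And>z. - B \<le> L z" "coercive_lagrangian (\<lambda>z. L z + B)"
proof -
  have "bdd_below (range L)" using L(1) by (simp add: lagrangian_def)
  then obtain m where m: "\<And>z. m \<le> L z" by (auto simp: bdd_below_def)
  define B where "B = \<bar>m\<bar>"
  have B: "B \<ge> 0" "- B \<le> L z" for z using m[of z] by (auto simp: B_def)
  have "coercive_lagrangian (\<lambda>z. L z + B)"
  proof
    have "L \<in> borel_measurable borel" using L(1) unfolding lagrangian_def by blast
    then show "(\<lambda>z. L z + B) \<in> borel_measurable borel" by (intro borel_measurable_add borel_measurable_const)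
    show "0 \<le> L z + B" for z using B(2)[of z] by simp
    show "\<exists>C\<ge>0. \<forall>x y p. \<bar>x\<bar> \<le> R \<and> \<bar>y\<bar> \<le> R \<and> \<bar>p\<bar> \<le> R \<longrightarrow> L (x, y, p) + B \<le> C" for R
    proof -
      obtain C where "\<forall>x y p. \<bar>x\<bar> \<le> R \<and> \<bar>y\<bar> \<le> R \<and> \<bar>p\<bar> \<le> R \<longrightarrow> L (x, y, p) \<le> C"
        using lagrangian_bounded_on_boxes[OF L(1)] by blast
      then show ?thesis using B(1) by (intro exI[of _ "\<bar>C\<bar> + B"]) force
    qed
    show "\<exists>c\<ge>0. \<forall>x y p. N * \<bar>p\<bar> \<le> L (x, y, p) + B + c" for N
      by (rule lagrangian_coercive[OF L(1) B])
    show "\<exists>C\<ge>0. \<forall>x y1 y2 p. \<bar>x\<bar> \<le> R \<and> \<bar>y1\<bar> \<le> R \<and> \<bar>y2\<bar> \<le> R \<and> \<bar>p\<bar> \<le> R \<longrightarrow>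
           \<bar>L (x, y1, p) + B - (L (x, y2, p) + B)\<bar> \<le> C * \<bar>y1 - y2\<bar>" for R
    proof -
      have "max R 1 > 0" by simp
      then obtain C where "C \<ge> 0" and C: "\<forall>x y1 y2 p. \<bar>x\<bar> \<le> max R 1 \<and> \<bar>y1\<bar> \<le> max R 1 \<and> \<bar>y2\<bar> \<le> max R 1 \<and>
          \<bar>p\<bar> \<le> max R 1 \<longrightarrow> \<bar>L (x, y1, p) - L (x, y2, p)\<bar> \<le> C * \<bar>y1 - y2\<bar>"
        using L(2) unfolding locally_lipschitz_in_y_def by blast
      show ?thesis
      proof (intro exI[of _ C] conjI allI impI \<open>C \<ge> 0\<close>)
        fix x y1 y2 p assume "\<bar>x\<bar> \<le> R \<and> \<bar>y1\<bar> \<le> R \<and> \<bar>y2\<bar> \<le> R \<and> \<bar>p\<bar> \<le> R"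
        then show "\<bar>L (x, y1, p) + B - (L (x, y2, p) + B)\<bar> \<le> C * \<bar>y1 - y2\<bar>"
          using C[rule_format, of x y1 y2 p] by (simp add: le_max_iff_disj)
      qed
    qed
  qed
  with B that show thesis by blast
qed

text \<open>
  The integral of the negative part is at most \<open>B (b - a)\<close>, so the difference of the two integrals in the
  action is never of the form \<open>\<infinity> - \<infinity>\<close>.
\<close>

lemma action_eq_energy:
  assumes L: "L \<in> borel_measurable borel" and B: "B \<ge> 0" "\<And>z. - B \<le> L z"
    and u: "has_density a b u g" and "a \<le> b"
  shows "action L u a b = enn2ereal (energy (\<lambda>z. L z + B) a b u g) - ereal (B * (b - a))"
proof -
  define \<l> where "\<l> x = L (x, u x, g x)" for x
  have m: "(\<lambda>x. \<l> x) \<in> borel_measurable (lebesgue_on {a..b})"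
    unfolding \<l>_def by (rule borel_measurable_along_density[OF L u])
  let ?P = "\<integral>\<^sup>+x. ennreal (\<l> x) \<partial>lebesgue_on {a..b}" and ?M = "\<integral>\<^sup>+x. ennreal (- \<l> x) \<partial>lebesgue_on {a..b}"
  let ?E = "energy (\<lambda>z. L z + B) a b u g"
  have P: "(\<integral>\<^sup>+x. ennreal (L (x, u x, deriv u x)) \<partial>lebesgue_on {a..b}) = ?P"
    by (rule nn_integral_cong_AE, use has_density_AE_deriv[OF u] in eventually_elim) (simp add: \<l>_def)
  have M: "(\<integral>\<^sup>+x. ennreal (- L (x, u x, deriv u x)) \<partial>lebesgue_on {a..b}) = ?M"
    by (rule nn_integral_cong_AE, use has_density_AE_deriv[OF u] in eventually_elim) (simp add: \<l>_def)
  have const: "(\<integral>\<^sup>+x. ennreal B \<partial>lebesgue_on {a..b}) = ennreal (B * (b - a))"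
    using B(1) \<open>a \<le> b\<close> by (simp add: emeasure_restrict_space ennreal_mult)
  have E: "?E = (\<integral>\<^sup>+x. ennreal (\<l> x + B) \<partial>lebesgue_on {a..b})"
    unfolding energy_def \<l>_def by (subst nn_integral_restrict_space) auto
  have "?E + ?M = (\<integral>\<^sup>+x. ennreal (\<l> x + B) + ennreal (- \<l> x) \<partial>lebesgue_on {a..b})"
    unfolding E using m by (intro nn_integral_add[symmetric]) auto
  also have "\<dots> = (\<integral>\<^sup>+x. ennreal (\<l> x) + ennreal B \<partial>lebesgue_on {a..b})"
  proof (rule nn_integral_cong)
    (* t + B plus the negative part of t is the positive part of t plus B *)
    fix x
    have lB: "0 \<le> \<l> x + B" using B(2)[of "(x, u x, g x)"] by (simp add: \<l>_def)
    show "ennreal (\<l> x + B) + ennreal (- \<l> x) = ennreal (\<l> x) + ennreal B"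
    proof (cases "0 \<le> \<l> x")
      case True
      then show ?thesis using B(1) by (simp add: ennreal_neg)
    next
      case False
      then have "ennreal (\<l> x + B) + ennreal (- \<l> x) = ennreal (\<l> x + B + - \<l> x)"
        using lB by (intro ennreal_plus[symmetric]) auto
      then show ?thesis using False by (simp add: ennreal_neg)
    qed
  qed
  also have "\<dots> = ?P + ennreal (B * (b - a))"
    unfolding const[symmetric] using m by (intro nn_integral_add) auto
  finally have sum: "?E + ?M = ?P + ennreal (B * (b - a))" .
  have "?M \<le> (\<integral>\<^sup>+x. ennreal B \<partial>lebesgue_on {a..b})"
    using B(2) by (intro nn_integral_mono ennreal_leI) (simp add: \<l>_def minus_le_iff)
  then have "?M < \<infinity>" unfolding const by (simp add: le_less_trans)
  then obtain m where m: "m \<ge> 0" "?M = ennreal m" by (cases ?M) auto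
  have h: "B * (b - a) \<ge> 0" using B(1) \<open>a \<le> b\<close> by simp
  have "enn2ereal ?P - enn2ereal ?M = enn2ereal ?E - ereal (B * (b - a))"
  proof (cases ?E)
    case top
    then have "?P + ennreal (B * (b - a)) = top" using sum by simp
    then have "?P = top" by (simp only: ennreal_add_eq_top ennreal_neq_top simp_thms)
    then show ?thesis using top m by (simp add: enn2ereal_top)
  next
    case (real e)
    then have "ennreal (e + m) = ?P + ennreal (B * (b - a))" using sum m by simp
    then obtain p where p: "p \<ge> 0" "?P = ennreal p" by (cases ?P) (auto simp: ennreal_add_eq_top)
    then have "e + m = p + B * (b - a)" using sum m real h
      by (simp add: ennreal_plus[symmetric] del: ennreal_plus)
    then show ?thesis using m real p by (simp add: enn2ereal_ennreal)
  qed
  then show ?thesis unfolding action_def P M .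
qed

text \<open>
  In the extended reals used here \<open>\<infinity> - \<infinity> = \<infinity>\<close>, so a finite excess forces a finite action.
\<close>

lemma excess_less_imp_near_min:
  assumes L: "L \<in> borel_measurable borel" and B: "B \<ge> 0" "\<And>z. - B \<le> L z"
    and u: "abs_cont a b u" "a < b" and ex: "excess L u a b < ereal \<epsilon>" and "\<epsilon> \<ge> 0"
  obtains g where "near_min (\<lambda>z. L z + B) \<epsilon> a b u g"
proof -
  obtain g where g: "has_density a b u g" using abs_cont_imp_has_density[OF u(2,1)] .
  let ?\<Lambda> = "\<lambda>z. L z + B" and ?h = "B * (b - a)"
  have A: "action L v a b = enn2ereal (energy ?\<Lambda> a b v k) - ereal ?h" if "has_density a b v k" for v k
    using action_eq_energy[OF L B that] u(2) by simp
  let ?S = "{v. abs_cont a b v \<and> v a = u a \<and> v b = u b}"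
  have least: "least_action L a (u a) b (u b) \<le> action L v a b" if "v \<in> ?S" for v
    unfolding least_action_def by (rule INF_lower[OF that])
  have low: "ereal (- ?h) \<le> least_action L a (u a) b (u b)"
    unfolding least_action_def
  proof (rule INF_greatest)
    fix v assume "v \<in> ?S"
    then obtain k where k: "has_density a b v k" using abs_cont_imp_has_density[OF u(2)] by blast
    have "0 \<le> enn2ereal (energy ?\<Lambda> a b v k)" by simp
    then show "ereal (- ?h) \<le> action L v a b" unfolding A[OF k]
      by (cases "enn2ereal (energy ?\<Lambda> a b v k)") auto
  qed
  have fin: "energy ?\<Lambda> a b u g < \<infinity>"
  proof (rule ccontr)
    assume "\<not> energy ?\<Lambda> a b u g < \<infinity>"
    then have "action L u a b = \<infinity>" unfolding A[OF g] by (simp add: not_less top_unique enn2ereal_top)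
    then show False using ex by (simp add: excess_def)
  qed
  have "energy ?\<Lambda> a b u g \<le> energy ?\<Lambda> a b v k + ennreal \<epsilon>"
    if k: "has_density a b v k" and ends: "v a = u a" "v b = u b" for v k
  proof (cases "energy ?\<Lambda> a b v k")
    case top then show ?thesis by simp
  next
    case (real e)
    obtain e' where e': "e' \<ge> 0" "energy ?\<Lambda> a b u g = ennreal e'" using fin by (cases "energy ?\<Lambda> a b u g") auto
    have "v \<in> ?S" using has_density_imp_abs_cont[OF k] ends by simp
    then have "least_action L a (u a) b (u b) \<le> ereal (e - ?h)"
      using least[of v] A[OF k] real by (simp add: enn2ereal_ennreal)
    moreover have "action L u a b = ereal (e' - ?h)" using A[OF g] e' by (simp add: enn2ereal_ennreal)
    ultimately have "e' \<le> e + \<epsilon>"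
      using ex low unfolding excess_def
      by (cases "least_action L a (u a) b (u b)") auto
    then have "ennreal e' \<le> ennreal (e + \<epsilon>)" by (rule ennreal_leI)
    then show ?thesis using real e' \<open>\<epsilon> \<ge> 0\<close> by simp
  qed
  then have "near_min ?\<Lambda> \<epsilon> a b u g" unfolding near_min_def using g fin by simp
  then show thesis by (rule that)
qed

lemma generalized_minimizer_approx:
  assumes "generalized_minimizer L u a b" "a < s" "s \<le> t" "t < b" "0 < \<eta>"
  obtains v \<alpha> \<beta> where "\<alpha> < \<beta>" "\<alpha> \<le> s" "t \<le> \<beta>" "abs_cont \<alpha> \<beta> v"
    "\<bar>excess L v \<alpha> \<beta>\<bar> < ereal \<eta>" "\<And>x. x \<in> {s..t} \<Longrightarrow> \<bar>v x - u x\<bar> < \<eta>"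
proof -
  obtain us as bs where H: "(\<forall>n. as n < bs n \<and> abs_cont (as n) (bs n) (us n)) \<and>
        (\<lambda>n. excess L (us n) (as n) (bs n)) \<longlonglongrightarrow> 0 \<and>
        (\<forall>K. compact K \<and> K \<subseteq> {a<..<b} \<longrightarrow>
           (\<forall>\<^sub>F n in sequentially. K \<subseteq> {as n..bs n}) \<and> uniform_limit K us u sequentially)"
    using assms(1) unfolding generalized_minimizer_def by (elim conjE exE) (rule that, intro conjI)
  have ac: "as n < bs n \<and> abs_cont (as n) (bs n) (us n)" for n using H by simp
  have ex: "(\<lambda>n. excess L (us n) (as n) (bs n)) \<longlonglongrightarrow> 0" using H by simp
  have K: "(\<forall>\<^sub>F n in sequentially. K \<subseteq> {as n..bs n}) \<and> uniform_limit K us u sequentially"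
    if "compact K" "K \<subseteq> {a<..<b}" for K using H that by simp
  have sub: "{s..t} \<subseteq> {a<..<b}" using assms by auto
  have st: "\<forall>\<^sub>F n in sequentially. {s..t} \<subseteq> {as n..bs n}" "uniform_limit {s..t} us u sequentially"
    using K[OF compact_Icc sub] by auto
  have "((\<lambda>n. \<bar>excess L (us n) (as n) (bs n)\<bar>) \<longlongrightarrow> \<bar>0\<bar>) sequentially"
    using ex by (intro tendsto_abs_ereal)
  then have "\<forall>\<^sub>F n in sequentially. \<bar>excess L (us n) (as n) (bs n)\<bar> < ereal \<eta>"
    using assms(5) by (intro order_tendstoD(2)) auto
  moreover have "\<forall>\<^sub>F n in sequentially. \<forall>x\<in>{s..t}. dist (us n x) (u x) < \<eta>"
    using st(2) assms(5) by (simp add: uniform_limit_iff)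
  ultimately have "\<forall>\<^sub>F n in sequentially. \<bar>excess L (us n) (as n) (bs n)\<bar> < ereal \<eta> \<and>
      (\<forall>x\<in>{s..t}. dist (us n x) (u x) < \<eta>) \<and> {s..t} \<subseteq> {as n..bs n}"
    using st(1) by eventually_elim simp
  then obtain n where n: "\<bar>excess L (us n) (as n) (bs n)\<bar> < ereal \<eta>"
      "\<forall>x\<in>{s..t}. dist (us n x) (u x) < \<eta>" "{s..t} \<subseteq> {as n..bs n}"
    by (auto simp: eventually_sequentially)
  show thesis
    by (rule that[of "as n" "bs n" "us n"]) (use n ac[of n] assms(3) in \<open>auto simp: dist_real_def\<close>)
qed

lemma generalized_minimizer_locally_near_min:
  assumes L: "L \<in> borel_measurable borel" and B: "B \<ge> 0" "\<And>z. - B \<le> L z"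
    and c: "coercive_lagrangian (\<lambda>z. L z + B)" and u: "generalized_minimizer L u a b"
  shows "locally_near_min (\<lambda>z. L z + B) a b u"
  unfolding locally_near_min_def
proof (intro conjI allI impI)
  show "continuous_on {a..b} u" using u by (simp add: generalized_minimizer_def)
  fix s t \<eta> :: real assume *: "a < s \<and> s \<le> t \<and> t < b \<and> 0 < \<eta>"
  obtain v \<alpha> \<beta> where v: "\<alpha> < \<beta>" "\<alpha> \<le> s" "t \<le> \<beta>" "abs_cont \<alpha> \<beta> v"
    "\<bar>excess L v \<alpha> \<beta>\<bar> < ereal \<eta>" "\<And>x. x \<in> {s..t} \<Longrightarrow> \<bar>v x - u x\<bar> < \<eta>"
    by (rule generalized_minimizer_approx[OF u, of s t \<eta>]) (use * in auto)
  have "excess L v \<alpha> \<beta> < ereal \<eta>" using v(5) by (cases "excess L v \<alpha> \<beta>") auto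
  then obtain g where "near_min (\<lambda>z. L z + B) \<eta> \<alpha> \<beta> v g"
    using excess_less_imp_near_min[OF L B v(4,1)] * by (meson less_imp_le)
  then have "near_min (\<lambda>z. L z + B) \<eta> s t v g"
    using coercive_lagrangian.near_min_subinterval[OF c] v * by blast
  with v(6) show "\<exists>v g. near_min (\<lambda>z. L z + B) \<eta> s t v g \<and> (\<forall>x\<in>{s..t}. \<bar>v x - u x\<bar> \<le> \<eta>)"
    by (meson less_imp_le)
qed

lemma generalized_minimizer_subinterval:
  assumes "generalized_minimizer L u a b" "a \<le> a'" "b' \<le> b"
  shows "generalized_minimizer L u a' b'"
proof -
  have cont: "continuous_on {a'..b'} u"
    using assms unfolding generalized_minimizer_def by (auto intro: continuous_on_subset)
  obtain us as bs where H: "(\<forall>n. as n < bs n \<and> abs_cont (as n) (bs n) (us n)) \<and>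
        (\<lambda>n. excess L (us n) (as n) (bs n)) \<longlonglongrightarrow> 0 \<and>
        (\<forall>K. compact K \<and> K \<subseteq> {a<..<b} \<longrightarrow>
           (\<forall>\<^sub>F n in sequentially. K \<subseteq> {as n..bs n}) \<and> uniform_limit K us u sequentially)"
    using assms(1) unfolding generalized_minimizer_def by (elim conjE exE) (rule that, intro conjI)
  have "{a'<..<b'} \<subseteq> {a<..<b}" using assms(2,3) by auto
  then have "\<forall>K. compact K \<and> K \<subseteq> {a'<..<b'} \<longrightarrow>
           (\<forall>\<^sub>F n in sequentially. K \<subseteq> {as n..bs n}) \<and> uniform_limit K us u sequentially"
    using H by (meson order_trans)
  with cont H show ?thesis
    unfolding generalized_minimizer_def by (intro conjI exI[of _ us] exI[of _ as] exI[of _ bs]) simp_all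
qed

section \<open>The set of right singular points is closed\<close>

text \<open>
  Length and bound of the minimizer are fixed, and the singular point is its left end point, where the
  derivative is \<open>+\<infinity>\<close>.
\<close>

definition right_singular_set ::
    "(real \<times> real \<times> real \<Rightarrow> real) \<Rightarrow> real \<Rightarrow> real \<Rightarrow> (real \<times> real) set" where
  "right_singular_set L R d = {(x0, y0). \<bar>x0\<bar> \<le> R \<and>
     (\<exists>u. generalized_minimizer L u x0 (x0 + d) \<and> (\<forall>x\<in>{x0..x0 + d}. \<bar>u x\<bar> \<le> R) \<and> u x0 = y0 \<and>
        filterlim (\<lambda>x. (u x - u x0) / (x - x0)) at_top (at x0 within {x0..x0 + d}))}"

text \<open>
  For each \<open>n\<close> take a function of small excess that is close to \<open>U n\<close> except near the end points; the
  excluded neighbourhoods shrink as \<open>n\<close> grows.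
\<close>

lemma generalized_minimizer_limit:
  assumes U: "\<And>n. generalized_minimizer L (U n) (X n) (X n + d)" and "0 < d"
    and X: "X \<longlonglongrightarrow> x0" and g: "continuous_on {0..d} g"
    and lim: "\<And>e. 0 < e \<Longrightarrow> \<exists>N. \<forall>n\<ge>N. \<forall>s\<in>{0..d}. \<bar>U n (X n + s) - g s\<bar> < e"
  shows "generalized_minimizer L (\<lambda>x. g (x - x0)) x0 (x0 + d)"
proof -
  define h where "h n = d / (real n + 3)" for n
  define \<eta> where "\<eta> n = 1 / (real n + 1)" for n
  have h: "0 < h n" "2 * h n < d" for n
  proof -
    have "h n * (real n + 3) = d" "0 < h n" using \<open>0 < d\<close> by (auto simp: h_def)
    moreover have "3 * h n \<le> h n * (real n + 3)" using \<open>0 < h n\<close> by (simp add: algebra_simps)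
    ultimately show "0 < h n" "2 * h n < d" by auto
  qed
  have h0: "h \<longlonglongrightarrow> 0"
    unfolding h_def
    by (intro tendsto_divide_0[OF tendsto_const] filterlim_at_top_imp_at_infinity
        filterlim_tendsto_add_at_top[OF tendsto_const, of _ _ 3, simplified add.commute] filterlim_real_sequentially)
  have \<eta>: "0 < \<eta> n" for n by (simp add: \<eta>_def)
  have \<eta>0: "\<eta> \<longlonglongrightarrow> 0"
    unfolding \<eta>_def using LIMSEQ_inverse_real_of_nat by (simp add: inverse_eq_divide add.commute)
  have "\<exists>v \<alpha> \<beta>. \<alpha> < \<beta> \<and> \<alpha> \<le> X n + h n \<and> X n + d - h n \<le> \<beta> \<and> abs_cont \<alpha> \<beta> v \<and>
    \<bar>excess L v \<alpha> \<beta>\<bar> < ereal (\<eta> n) \<and> (\<forall>x\<in>{X n + h n..X n + d - h n}. \<bar>v x - U n x\<bar> < \<eta> n)" for n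
  proof -
    have "X n < X n + h n" "X n + h n \<le> X n + d - h n" "X n + d - h n < X n + d" using h[of n] by auto
    from generalized_minimizer_approx[OF U this \<eta>[of n]] show ?thesis by metis
  qed
  then obtain v \<alpha> \<beta> where v: "\<And>n. \<alpha> n < \<beta> n" "\<And>n. \<alpha> n \<le> X n + h n" "\<And>n. X n + d - h n \<le> \<beta> n"
    "\<And>n. abs_cont (\<alpha> n) (\<beta> n) (v n)" "\<And>n. \<bar>excess L (v n) (\<alpha> n) (\<beta> n)\<bar> < ereal (\<eta> n)"
    "\<And>n x. x \<in> {X n + h n..X n + d - h n} \<Longrightarrow> \<bar>v n x - U n x\<bar> < \<eta> n" by metis
  have ex: "(\<lambda>n. excess L (v n) (\<alpha> n) (\<beta> n)) \<longlonglongrightarrow> 0"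
  proof (rule tendsto_sandwich)
    have lohi: "ereal (- \<eta> n) \<le> excess L (v n) (\<alpha> n) (\<beta> n) \<and> excess L (v n) (\<alpha> n) (\<beta> n) \<le> ereal (\<eta> n)" for n
      using v(5)[of n] by (cases "excess L (v n) (\<alpha> n) (\<beta> n)") auto
    show "\<forall>\<^sub>F n in sequentially. ereal (- \<eta> n) \<le> excess L (v n) (\<alpha> n) (\<beta> n)"
      "\<forall>\<^sub>F n in sequentially. excess L (v n) (\<alpha> n) (\<beta> n) \<le> ereal (\<eta> n)" using lohi by auto
    show "(\<lambda>n. ereal (- \<eta> n)) \<longlonglongrightarrow> 0" "(\<lambda>n. ereal (\<eta> n)) \<longlonglongrightarrow> 0"
      using tendsto_minus[OF \<eta>0] \<eta>0 unfolding zero_ereal_def by (intro tendsto_ereal; simp)+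
  qed
  have cont: "continuous_on {x0..x0 + d} (\<lambda>x. g (x - x0))"
    by (rule continuous_on_compose2[OF g]) (auto intro!: continuous_intros)
  have compact: "(\<forall>\<^sub>F n in sequentially. K \<subseteq> {\<alpha> n..\<beta> n}) \<and> uniform_limit K v (\<lambda>x. g (x - x0)) sequentially"
    if K: "compact K" "K \<subseteq> {x0<..<x0 + d}" for K
  proof (cases "K = {}")
    case False
    obtain p where p: "p \<in> K" "\<And>x. x \<in> K \<Longrightarrow> p \<le> x" using compact_attains_inf[OF K(1) False] by blast
    obtain q where q: "q \<in> K" "\<And>x. x \<in> K \<Longrightarrow> x \<le> q" using compact_attains_sup[OF K(1) False] by blast
    have pq: "x0 < p" "q < x0 + d" using p q K(2) by auto
    have "(\<lambda>n. X n + h n) \<longlonglongrightarrow> x0 + 0" by (intro tendsto_add X h0)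
    then have lo: "\<forall>\<^sub>F n in sequentially. X n + h n < p" using pq by (intro order_tendstoD(2)) auto
    have "(\<lambda>n. X n + d - h n) \<longlonglongrightarrow> x0 + d - 0" by (intro tendsto_diff tendsto_add X h0 tendsto_const)
    then have hi: "\<forall>\<^sub>F n in sequentially. q < X n + d - h n" using pq by (intro order_tendstoD(1)) auto
    have Kin: "\<forall>\<^sub>F n in sequentially. K \<subseteq> {X n + h n..X n + d - h n}"
      using lo hi by eventually_elim (use p(2) q(2) in force)
    have "\<forall>\<^sub>F n in sequentially. K \<subseteq> {\<alpha> n..\<beta> n}"
      using Kin
    proof eventually_elim
      case (elim n)
      then show ?case using v(2)[of n] v(3)[of n] by (meson atLeastatMost_subset_iff order_trans)
    qed
    moreover have "uniform_limit K v (\<lambda>x. g (x - x0)) sequentially"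
      unfolding uniform_limit_iff
    proof (intro allI impI)
      fix e :: real assume "0 < e"
      then have e3: "0 < e / 3" by simp
      have "uniformly_continuous_on {0..d} g" using g by (intro compact_uniformly_continuous) auto
      then obtain \<rho> where \<rho>: "\<rho> > 0" "\<And>s s'. s \<in> {0..d} \<Longrightarrow> s' \<in> {0..d} \<Longrightarrow> dist s' s < \<rho> \<Longrightarrow> dist (g s') (g s) < e / 3"
        using e3 unfolding uniformly_continuous_on_def by metis
      have "\<forall>\<^sub>F n in sequentially. dist (X n) x0 < \<rho>" using tendstoD[OF X \<rho>(1)] .
      moreover have "\<forall>\<^sub>F n in sequentially. \<eta> n < e / 3" using \<eta>0 e3 by (intro order_tendstoD(2))
      moreover have "\<forall>\<^sub>F n in sequentially. \<forall>s\<in>{0..d}. \<bar>U n (X n + s) - g s\<bar> < e / 3"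
        using lim[OF e3] unfolding eventually_sequentially .
      ultimately show "\<forall>\<^sub>F n in sequentially. \<forall>x\<in>K. dist (v n x) (g (x - x0)) < e"
        using Kin
      proof eventually_elim
        case (elim n)
        show ?case
        proof
          fix x assume "x \<in> K"
          then have x: "x \<in> {X n + h n..X n + d - h n}" "x \<in> {x0<..<x0 + d}" using elim(4) K(2) by auto
          have s: "x - X n \<in> {0..d}" "x - x0 \<in> {0..d}" using x h(1)[of n] by auto
          have 1: "\<bar>v n x - U n x\<bar> < e / 3" using v(6)[OF x(1)] elim(2) by linarith
          have 2: "\<bar>U n x - g (x - X n)\<bar> < e / 3" using bspec[OF elim(3) s(1)] by simp
          have "dist (x - X n) (x - x0) < \<rho>" using elim(1) by (simp add: dist_real_def abs_minus_commute)
          then have 3: "\<bar>g (x - X n) - g (x - x0)\<bar> < e / 3"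
            using \<rho>(2)[OF s(2) s(1)] by (simp add: dist_real_def)
          have "\<bar>v n x - g (x - x0)\<bar> \<le> \<bar>v n x - U n x\<bar> + \<bar>U n x - g (x - X n)\<bar> + \<bar>g (x - X n) - g (x - x0)\<bar>"
            by linarith
          also have "\<dots> < e / 3 + e / 3 + e / 3" using 1 2 3 by (intro add_strict_mono)
          finally show "dist (v n x) (g (x - x0)) < e" by (simp add: dist_real_def)
        qed
      qed
    qed
    ultimately show ?thesis by blast
  qed (simp add: uniform_limit_iff)
  show ?thesis
    unfolding generalized_minimizer_def
    by (intro conjI exI[of _ v] exI[of _ \<alpha>] exI[of _ \<beta>] allI impI cont ex v(1,4)) (use compact in auto)
qed

text \<open>
  Translated to the common interval \<open>[0, d]\<close>, the minimizers through a convergent sequence of singular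
  points are equicontinuous, and the Arzela-Ascoli theorem applies. Uniform steepness passes to the limit
  curve and makes its derivative infinite.
\<close>

lemma closed_right_singular_set:
  assumes L: "lagrangian L" "locally_lipschitz_in_y L" and "0 < d"
  shows "closed (right_singular_set L R d)"
  unfolding closed_sequential_limits
proof (intro allI impI, elim conjE)
  fix zs z assume zs: "\<forall>n. zs n \<in> right_singular_set L R d" and lim: "zs \<longlonglongrightarrow> z"
  obtain B where B: "B \<ge> 0" "\<And>z. - B \<le> L z" and coer: "coercive_lagrangian (\<lambda>z. L z + B)"
    by (fact lagrangian_coercive_lagrangian[OF L])
  interpret coercive_lagrangian "\<lambda>z. L z + B" by (rule coer)
  have Lb: "L \<in> borel_measurable borel" using L(1) unfolding lagrangian_def by blast
  define x where "x n = fst (zs n)" for n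
  define y where "y n = snd (zs n)" for n
  define R' where "R' = R + d"
  let ?P = "\<lambda>n u. generalized_minimizer L u (x n) (x n + d) \<and> (\<forall>t\<in>{x n..x n + d}. \<bar>u t\<bar> \<le> R) \<and> u (x n) = y n \<and>
        filterlim (\<lambda>t. (u t - u (x n)) / (t - x n)) at_top (at (x n) within {x n..x n + d})"
  have mem: "(x n, y n) \<in> right_singular_set L R d" for n using zs by (simp add: x_def y_def)
  have xR: "\<bar>x n\<bar> \<le> R" for n
    using mem[of n] unfolding right_singular_set_def mem_Collect_eq prod.case by (rule conjunct1)
  have "\<exists>u. ?P n u" for n
    using mem[of n] unfolding right_singular_set_def mem_Collect_eq prod.case by (rule conjunct2)
  then have "\<forall>n. \<exists>u. ?P n u" ..
  then obtain u where "\<forall>n. ?P n (u n)" by (rule choice[THEN exE])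
  then have u: "\<And>n. generalized_minimizer L (u n) (x n) (x n + d)"
      "\<And>n t. t \<in> {x n..x n + d} \<Longrightarrow> \<bar>u n t\<bar> \<le> R" "\<And>n. u n (x n) = y n"
      "\<And>n. filterlim (\<lambda>t. (u n t - u n (x n)) / (t - x n)) at_top (at (x n) within {x n..x n + d})"
    by blast+
  have lnm: "locally_near_min (\<lambda>z. L z + B) (x n) (x n + d) (u n)" for n
    by (rule generalized_minimizer_locally_near_min[OF Lb B coer u(1)])
  have bounds: "\<bar>x n\<bar> \<le> R'" "\<bar>x n + d\<bar> \<le> R'" "\<And>t. t \<in> {x n..x n + d} \<Longrightarrow> \<bar>u n t\<bar> \<le> R'" for n
    using xR[of n] u(2)[of _ n] \<open>0 < d\<close> by (force simp: R'_def)+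
  define w where "w n s = u n (x n + s)" for n s
  have wR: "norm (w n s) \<le> R" if "s \<in> {0..d}" for n s
    using u(2)[of "x n + s" n] that by (auto simp: w_def)
  have equi: "\<exists>\<rho>>0. \<forall>n t. t \<in> {0..d} \<and> norm (s - t) < \<rho> \<longrightarrow> norm (w n s - w n t) < e"
    if s: "s \<in> {0..d}" and "0 < e" for s e
  proof -
    have "0 < e / 2" using \<open>0 < e\<close> by simp
    obtain \<rho> where \<rho>: "\<rho> > 0"
      and *: "\<And>a u x y. \<lbrakk>locally_near_min (\<lambda>z. L z + B) a (a + d) u; \<bar>a\<bar> \<le> R'; \<bar>a + d\<bar> \<le> R';
         \<And>x. x \<in> {a..a + d} \<Longrightarrow> \<bar>u x\<bar> \<le> R'; a \<le> x; x \<le> y; y \<le> a + d; y - x \<le> \<rho>\<rbrakk> \<Longrightarrow> \<bar>u y - u x\<bar> \<le> e / 2"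
      by (fact locally_near_min_equicontinuous[OF \<open>0 < d\<close> \<open>0 < e / 2\<close>])
    have le: "\<bar>w n t' - w n t\<bar> \<le> e / 2" if "0 \<le> t" "t \<le> t'" "t' \<le> d" "t' - t < \<rho>" for n t t'
      unfolding w_def using that by (intro *[OF lnm bounds]) auto
    have "norm (w n s - w n t) < e" if "t \<in> {0..d}" "norm (s - t) < \<rho>" for n t
    proof -
      have "\<bar>w n s - w n t\<bar> \<le> e / 2"
        using le[of s t n] le[of t s n] s that by (cases "s \<le> t") (auto simp: abs_minus_commute)
      then show ?thesis using \<open>0 < e\<close> by simp
    qed
    then show ?thesis using \<rho> by blast
  qed
  obtain g \<kappa> where g: "continuous_on {0..d} g" and \<kappa>: "strict_mono (\<kappa> :: nat \<Rightarrow> nat)"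
    and conv: "\<And>e. 0 < e \<Longrightarrow> \<exists>N. \<forall>n t. n \<ge> N \<and> t \<in> {0..d} \<longrightarrow> norm (w (\<kappa> n) t - g t) < e"
  proof (rule Arzela_Ascoli[of "{0..d}" w R])
    show "compact {0..d}" by (rule compact_Icc)
    show "norm (w n s) \<le> R" if "s \<in> {0..d}" for n s using wR[OF that] .
    show "\<exists>\<rho>>0. \<forall>n t. t \<in> {0..d} \<and> norm (s - t) < \<rho> \<longrightarrow> norm (w n s - w n t) < e"
      if "s \<in> {0..d}" "0 < e" for s e using equi[OF that] .
  next
    fix g and \<kappa> :: "nat \<Rightarrow> nat"
    assume A: "continuous_on {0..d} g" "strict_mono \<kappa>"
      "\<And>e. 0 < e \<Longrightarrow> \<exists>N. \<forall>n t. n \<ge> N \<and> t \<in> {0..d} \<longrightarrow> norm (w (\<kappa> n) t - g t) < e"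
    show thesis by (rule that[OF A(1,2)]) (fact A(3))
  qed
  define x0 where "x0 = fst z"
  define y0 where "y0 = snd z"
  have X: "(\<lambda>n. x (\<kappa> n)) \<longlonglongrightarrow> x0" and Y: "(\<lambda>n. y (\<kappa> n)) \<longlonglongrightarrow> y0"
    using LIMSEQ_subseq_LIMSEQ[OF tendsto_fst[OF lim] \<kappa>] LIMSEQ_subseq_LIMSEQ[OF tendsto_snd[OF lim] \<kappa>]
    by (auto simp: x_def y_def x0_def y0_def o_def)
  have pw: "(\<lambda>n. w (\<kappa> n) s) \<longlonglongrightarrow> g s" if "s \<in> {0..d}" for s
    unfolding LIMSEQ_iff
  proof (intro allI impI)
    fix e :: real assume "0 < e"
    from conv[OF this] obtain N where "\<forall>n t. n \<ge> N \<and> t \<in> {0..d} \<longrightarrow> norm (w (\<kappa> n) t - g t) < e" ..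
    with that show "\<exists>N. \<forall>n\<ge>N. norm (w (\<kappa> n) s - g s) < e" by blast
  qed
  define U where "U t = g (t - x0)" for t
  have "generalized_minimizer L U x0 (x0 + d)"
    unfolding U_def
  proof (rule generalized_minimizer_limit[OF _ \<open>0 < d\<close> X g])
    show "generalized_minimizer L (u (\<kappa> n)) (x (\<kappa> n)) (x (\<kappa> n) + d)" for n by (rule u(1))
    show "\<exists>N. \<forall>n\<ge>N. \<forall>s\<in>{0..d}. \<bar>u (\<kappa> n) (x (\<kappa> n) + s) - g s\<bar> < e" if e: "0 < e" for e
    proof -
      obtain N where N: "\<forall>n t. n \<ge> N \<and> t \<in> {0..d} \<longrightarrow> norm (w (\<kappa> n) t - g t) < e"
        using conv[OF e] ..
      show ?thesis
      proof (intro exI[of _ N] allI impI ballI)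
        fix n s assume "N \<le> n" "s \<in> {0..d}"
        then show "\<bar>u (\<kappa> n) (x (\<kappa> n) + s) - g s\<bar> < e" using N[rule_format, of n s] by (simp add: w_def)
      qed
    qed
  qed
  moreover have "\<bar>x0\<bar> \<le> R"
    using tendsto_rabs[OF X] xR by (intro LIMSEQ_le_const2) auto
  moreover have "\<bar>U t\<bar> \<le> R" if "t \<in> {x0..x0 + d}" for t
  proof -
    have s: "t - x0 \<in> {0..d}" using that by auto
    show ?thesis unfolding U_def
      using tendsto_rabs[OF pw[OF s]] wR[OF s] by (intro LIMSEQ_le_const2) auto
  qed
  moreover have "U x0 = y0"
  proof -
    have "(\<lambda>n. y (\<kappa> n)) \<longlonglongrightarrow> g 0" using pw[of 0] \<open>0 < d\<close> u(3) by (simp add: w_def)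
    then show ?thesis using Y LIMSEQ_unique by (auto simp: U_def)
  qed
  moreover have "filterlim (\<lambda>t. (U t - U x0) / (t - x0)) at_top (at x0 within {x0..x0 + d})"
    unfolding filterlim_at_top
  proof
    fix Z :: real
    have "0 < max Z 1" by simp
    obtain \<delta> where \<delta>: "\<delta> > 0"
      and *: "\<And>a b u x. \<lbrakk>locally_near_min (\<lambda>z. L z + B) a b u; \<bar>a\<bar> \<le> R'; \<bar>b\<bar> \<le> R'; \<And>x. x \<in> {a..b} \<Longrightarrow> \<bar>u x\<bar> \<le> R';
       filterlim (\<lambda>x. (u x - u a) / (x - a)) at_top (at a within {a..b});
       a \<le> x; x \<le> b; x - a \<le> \<delta>\<rbrakk> \<Longrightarrow> max Z 1 * (x - a) \<le> u x - u a"
      by (fact uniformly_steep[OF \<open>0 < max Z 1\<close>])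
    have "Z \<le> (U t - U x0) / (t - x0)" if t: "t \<in> {x0..x0 + d}" "t \<noteq> x0" "dist t x0 < \<delta>" for t
    proof -
      define s where "s = t - x0"
      have s: "0 < s" "s \<le> d" "s \<le> \<delta>" using t by (auto simp: s_def dist_real_def)
      have "max Z 1 * s \<le> w n s - w n 0" for n
        using *[OF lnm bounds u(4), of n "x n + s"] s by (simp add: w_def)
      moreover have "(\<lambda>n. w (\<kappa> n) s - w (\<kappa> n) 0) \<longlonglongrightarrow> g s - g 0"
        using s by (intro tendsto_diff pw) auto
      ultimately have "max Z 1 * s \<le> g s - g 0" by (intro LIMSEQ_le_const) auto
      moreover have "Z * s \<le> max Z 1 * s" using s by (intro mult_right_mono) auto
      ultimately have "Z * s \<le> U t - U x0" by (simp add: U_def s_def)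
      then show ?thesis using s by (simp add: s_def field_simps)
    qed
    then show "\<forall>\<^sub>F t in at x0 within {x0..x0 + d}. Z \<le> (U t - U x0) / (t - x0)"
      using \<delta> unfolding eventually_at by blast
  qed
  ultimately have "(x0, y0) \<in> right_singular_set L R d" unfolding right_singular_set_def by blast
  then show "z \<in> right_singular_set L R d" by (simp add: x0_def y0_def)
qed

section \<open>Crossing curves and the least cost\<close>

text \<open>
  The value function of the energy.
\<close>

definition least_cost ::
    "(real \<times> real \<times> real \<Rightarrow> real) \<Rightarrow> real \<Rightarrow> real \<Rightarrow> real \<Rightarrow> real \<Rightarrow> ennreal" where
  "least_cost \<Lambda> a A b B =
     (INF (v, h) \<in> {(v, h). has_density a b v h \<and> v a = A \<and> v b = B}. energy \<Lambda> a b v h)"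

lemma least_cost_le:
  assumes "has_density a b v h" "v a = A" "v b = B"
  shows "least_cost \<Lambda> a A b B \<le> energy \<Lambda> a b v h"
  unfolding least_cost_def by (rule INF_lower2[of "(v, h)"]) (use assms in auto)

lemma least_cost_greatest:
  assumes "\<And>v h. has_density a b v h \<Longrightarrow> v a = A \<Longrightarrow> v b = B \<Longrightarrow> c \<le> energy \<Lambda> a b v h"
  shows "c \<le> least_cost \<Lambda> a A b B"
  unfolding least_cost_def by (rule INF_greatest) (use assms in auto)

context coercive_lagrangian
begin

lemma least_cost_affine_le:
  assumes "a < b" "\<bar>A\<bar> \<le> R" "\<bar>B\<bar> \<le> R" "\<bar>B - A\<bar> \<le> M * (b - a)" "0 \<le> C"
    and C: "\<And>x y p. x \<in> {a..b} \<Longrightarrow> \<bar>y\<bar> \<le> R \<Longrightarrow> \<bar>p\<bar> \<le> M \<Longrightarrow> \<Lambda> (x, y, p) \<le> C"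
  shows "least_cost \<Lambda> a A b B \<le> ennreal (C * (b - a))"
proof -
  define m where "m = (B - A) / (b - a)"
  let ?w = "\<lambda>x. A + m * (x - a)"
  have "?w b = B" using \<open>a < b\<close> by (simp add: m_def)
  then have "least_cost \<Lambda> a A b B \<le> energy \<Lambda> a b ?w (\<lambda>_. m)"
    by (intro least_cost_le has_density_affine) simp_all
  also have "\<dots> \<le> ennreal (C * (b - a))" unfolding m_def by (rule energy_affine_le[OF assms])
  finally show ?thesis .
qed

text \<open>
  Let \<open>w\<close> follow \<open>l\<close> up to \<open>x1\<close> and then \<open>v\<close>. A curve \<open>q\<close> from \<open>(s', v s')\<close> to \<open>(b, Y)\<close> starts below \<open>w\<close> and ends
  above it. Exchanging the ends of the two curves at a crossing gives a competitor for \<open>v\<close> and a curve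
  from \<open>(s, l s)\<close> to \<open>(b, Y)\<close>.
\<close>

lemma least_cost_crossing:
  assumes nm: "near_min \<Lambda> \<epsilon> s' b v g" and s: "s \<le> s'" "s' \<le> x1" "x1 \<le> b"
    and l: "has_density s x1 l k" and lv: "l x1 = v x1" and above: "v s' \<le> l s'" and below: "v b \<le> Y"
  shows "least_cost \<Lambda> s (l s) b Y + energy \<Lambda> s' x1 v g
      \<le> least_cost \<Lambda> s' (v s') b Y + (energy \<Lambda> s x1 l k + ennreal \<epsilon>)"
proof -
  have v: "has_density s' b v g" and finv: "energy \<Lambda> s' b v g < \<infinity>"
    and min: "\<And>w h. has_density s' b w h \<Longrightarrow> w s' = v s' \<Longrightarrow> w b = v b \<Longrightarrow>
        energy \<Lambda> s' b v g \<le> energy \<Lambda> s' b w h + ennreal \<epsilon>"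
    using nm unfolding near_min_def by auto
  have vx: "has_density x1 b v g" by (rule has_density_subinterval[OF v s(2) order_refl])
  let ?w = "\<lambda>x. if x \<le> x1 then l x else v x" and ?h = "\<lambda>x. if x \<le> x1 then k x else g x"
  have sx1: "s \<le> x1" using s by simp
  have w: "has_density s b ?w ?h" by (rule has_density_glue[OF l vx lv sx1 s(3)])
  have ew: "energy \<Lambda> s b ?w ?h = energy \<Lambda> s x1 l k + energy \<Lambda> x1 b v g"
    by (rule energy_glue[OF borel l vx lv sx1 s(3)])
  have ev: "energy \<Lambda> s' b v g = energy \<Lambda> s' x1 v g + energy \<Lambda> x1 b v g"
    by (rule energy_split[OF borel v s(2,3)])
  then have finx: "energy \<Lambda> x1 b v g \<noteq> top" using finv by auto
  have ws: "?w s = l s" "v s' \<le> ?w s'" "?w b = v b" using s above lv by (auto simp: le_less)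
  let ?L = "least_cost \<Lambda> s (l s) b Y" and ?K = "energy \<Lambda> s x1 l k + ennreal \<epsilon>"
  have *: "?L + energy \<Lambda> s' x1 v g \<le> energy \<Lambda> s' b q j + ?K"
    if q: "has_density s' b q j" and qs: "q s' = v s'" and qb: "q b = Y" for q j
  proof -
    have w': "has_density s' b ?w ?h" by (rule has_density_subinterval[OF w s(1) order_refl])
    have sb: "s' \<le> b" using s by simp
    (* at s' the curve w is above q, at b it is below *)
    obtain c where c: "s' \<le> c" "c \<le> b" "?w c = q c"
    proof -
      have "continuous_on {s'..b} (\<lambda>x. ?w x - q x)"
        by (rule continuous_on_diff[OF has_density_continuous_on[OF w'] has_density_continuous_on[OF q]])
      moreover have "?w b - q b \<le> 0" "0 \<le> ?w s' - q s'" using ws below qs qb by auto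
      ultimately obtain c where "s' \<le> c" "c \<le> b" "?w c - q c = 0"
        using IVT2'[of "\<lambda>x. ?w x - q x" b 0 s'] sb by auto
      then show thesis by (intro that[of c]) auto
    qed
    have sc: "s \<le> c" using c s by simp
    have wsc: "has_density s c ?w ?h" and wcb: "has_density c b ?w ?h"
      using has_density_subinterval[OF w] c sc by auto
    have qsc: "has_density s' c q j" and qcb: "has_density c b q j"
      using has_density_subinterval[OF q] c by auto
    have 1: "?L \<le> energy \<Lambda> s c ?w ?h + energy \<Lambda> c b q j"
    proof -
      let ?z = "\<lambda>x. if x \<le> c then ?w x else q x" and ?y = "\<lambda>x. if x \<le> c then ?h x else j x"
      have z: "has_density s b ?z ?y" by (rule has_density_glue[OF wsc qcb c(3) sc c(2)])
      have "?z s = l s" "?z b = Y" using sc s ws(1) c qb by (auto simp: le_less)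
      then have "?L \<le> energy \<Lambda> s b ?z ?y" by (rule least_cost_le[OF z])
      then show ?thesis unfolding energy_glue[OF borel wsc qcb c(3) sc c(2)] .
    qed
    have 2: "energy \<Lambda> s' b v g \<le> energy \<Lambda> s' c q j + energy \<Lambda> c b ?w ?h + ennreal \<epsilon>"
    proof -
      let ?z = "\<lambda>x. if x \<le> c then q x else ?w x" and ?y = "\<lambda>x. if x \<le> c then j x else ?h x"
      have z: "has_density s' b ?z ?y" by (rule has_density_glue[OF qsc wcb c(3)[symmetric] c(1,2)])
      have "?z s' = v s'" using c qs by simp
      moreover have "?z b = v b" using c ws(3) by (cases "b = c") auto
      ultimately have "energy \<Lambda> s' b v g \<le> energy \<Lambda> s' b ?z ?y + ennreal \<epsilon>" by (rule min[OF z])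
      then show ?thesis unfolding energy_glue[OF borel qsc wcb c(3)[symmetric] c(1,2)] .
    qed
    have "?L + energy \<Lambda> s' x1 v g + energy \<Lambda> x1 b v g = ?L + energy \<Lambda> s' b v g"
      unfolding ev by (simp add: ac_simps)
    also have "\<dots> \<le> (energy \<Lambda> s c ?w ?h + energy \<Lambda> c b q j) + (energy \<Lambda> s' c q j + energy \<Lambda> c b ?w ?h + ennreal \<epsilon>)"
      by (rule add_mono[OF 1 2])
    also have "\<dots> = (energy \<Lambda> s c ?w ?h + energy \<Lambda> c b ?w ?h) + (energy \<Lambda> s' c q j + energy \<Lambda> c b q j) + ennreal \<epsilon>"
      by (simp add: ac_simps)
    also have "\<dots> = energy \<Lambda> s b ?w ?h + energy \<Lambda> s' b q j + ennreal \<epsilon>"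
      unfolding energy_split[OF borel w sc c(2)] energy_split[OF borel q c(1,2)] ..
    also have "\<dots> = (energy \<Lambda> s' b q j + ?K) + energy \<Lambda> x1 b v g"
      unfolding ew by (simp add: ac_simps)
    finally have "energy \<Lambda> x1 b v g + (?L + energy \<Lambda> s' x1 v g) \<le> energy \<Lambda> x1 b v g + (energy \<Lambda> s' b q j + ?K)"
      by (simp only: add.commute)
    then show ?thesis using finx by (simp add: ennreal_add_left_cancel_le)
  qed
  show ?thesis
  proof (cases "?K = top")
    case False
    have "?L + energy \<Lambda> s' x1 v g - ?K \<le> least_cost \<Lambda> s' (v s') b Y"
      using * False by (intro least_cost_greatest) (simp add: ennreal_minus_le_iff add.commute)
    then show ?thesis using False by (simp add: ennreal_minus_le_iff add.commute)
  qed simp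
qed

text \<open>
  One step of length \<open>16 q\<close> along the horizontal segment lowers the value function by \<open>\<kappa>\<close> times the length of
  the step. The steps do not start exactly at height \<open>y0\<close> but at points on near minimizers, within \<open>2 \<eta>\<close> of
  that height, because generalized minimizers are only approximated inside their intervals. The line of
  the argument leads from \<open>(s, y)\<close> to the point of \<open>v\<close> at height \<open>y0 + 16 q\<close>; steepness of \<open>v\<close> ensures that
  this point lies close to \<open>s'\<close>, that the slope of the line is between \<open>7/12\<close> and \<open>2\<close>, and that the line
  passes above \<open>(s', v s')\<close>.
\<close>

lemma horizontal_step:
  assumes q: "0 < q" "16 * q \<le> 1" and N: "0 \<le> N" and c: "0 \<le> c" "\<And>x y p. N * \<bar>p\<bar> \<le> \<Lambda> (x, y, p) + c"
    and C: "0 \<le> C" "\<And>x y p. \<bar>x\<bar> \<le> R' \<Longrightarrow> \<bar>y\<bar> \<le> \<bar>y0\<bar> + 2 \<Longrightarrow> \<bar>p\<bar> \<le> 2 \<Longrightarrow> \<Lambda> (x, y, p) \<le> C"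
    and M: "4 \<le> M" "2 * c \<le> M" and \<kappa>: "0 \<le> \<kappa>" "N = 2 * (2 * C + 2 + \<kappa>)"
    and \<eta>: "0 < \<eta>" "\<eta> \<le> q" "M * \<eta> \<le> 16 * q"
    and s: "t < s" "s < t + \<eta>" "t + 16 * q < s'" "s' < t + 16 * q + \<eta>" and y: "\<bar>y - y0\<bar> \<le> 2 * \<eta>"
    and nm: "near_min \<Lambda> \<eta> s' b v g" and vs: "\<bar>v s' - y0\<bar> \<le> 2 * \<eta>"
    and rise: "y0 + 32 * q - \<eta> \<le> v (t + 16 * q + 32 * q / M)" and b: "t + 24 * q \<le> b"
    and R': "\<bar>t\<bar> \<le> R'" "\<bar>b\<bar> \<le> R'" and Y: "v b \<le> Y"
  shows "least_cost \<Lambda> s y b Y + ennreal (\<kappa> * (16 * q)) \<le> least_cost \<Lambda> s' (v s') b Y"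
proof -
  define z where "z = t + 16 * q + 32 * q / M"
  have M0: "M > 0" using M by simp
  have "32 * q / M \<le> 8 * q" using M q M0 by (simp add: field_simps)
  have "\<eta> < 32 * q / M" using \<eta> q M0 by (simp add: field_simps)
  then have z: "s' < z" "z \<le> t + 24 * q" "z - s' \<le> 32 * q / M" "z \<le> b"
    using s b \<open>32 * q / M \<le> 8 * q\<close> by (auto simp: z_def)
  have v: "has_density s' b v g" using nm by (simp add: near_min_def)
  have vcont: "continuous_on {s'..z} v"
    using has_density_continuous_on[OF has_density_subinterval[OF v order_refl z(4)]] .
  obtain x1 where x1: "s' \<le> x1" "x1 \<le> z" "v x1 = y0 + 16 * q"
  proof -
    have "v s' \<le> y0 + 16 * q" "y0 + 16 * q \<le> v z" using vs rise \<eta> q by (auto simp: z_def)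
    then show thesis using IVT'[of v s' "y0 + 16 * q" z] vcont z that by auto
  qed
  have x1b: "x1 \<le> b" using x1 z by simp
  have sx: "s < x1" "15 * q \<le> s' - s" "s' - s \<le> x1 - s" "x1 - s \<le> 24 * q" using s x1 z \<eta> q by auto
  define B where "B = y0 + 16 * q"
  define m where "m = (B - y) / (x1 - s)"
  define l where "l x = y + m * (x - s)" for x
  have By: "14 * q \<le> B - y" "B - y \<le> 18 * q" using y \<eta> by (auto simp: B_def)
  have slope: "\<bar>B - y\<bar> \<le> 2 * (x1 - s)" using By sx q by auto
  have y2: "\<bar>y\<bar> \<le> \<bar>y0\<bar> + 2" "\<bar>B\<bar> \<le> \<bar>y0\<bar> + 2" using y \<eta> q by (auto simp: B_def)
  have Cx: "\<Lambda> (x, y, p) \<le> C" if "x \<in> {s..x1}" "\<bar>y\<bar> \<le> \<bar>y0\<bar> + 2" "\<bar>p\<bar> \<le> 2" for x y p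
    using that s R' x1b by (intro C) auto
  have l: "has_density s x1 l (\<lambda>_. m)" unfolding l_def by (rule has_density_affine)
  have el: "energy \<Lambda> s x1 l (\<lambda>_. m) \<le> ennreal (C * (x1 - s))"
    unfolding l_def m_def by (rule energy_affine_le[OF sx(1) y2 slope C(1) Cx])
  have "l x1 = v x1" using sx(1) x1(3) by (simp add: l_def m_def B_def)
  have "v s' \<le> l s'"
  proof -
    have "7 * (x1 - s) \<le> 7 * (24 * q)" using sx(4) by (intro mult_left_mono) auto
    also have "\<dots> = 12 * (14 * q)" by simp
    also have "\<dots> \<le> 12 * (B - y)" using By(1) by (intro mult_left_mono) auto
    finally have "7 * (x1 - s) \<le> 12 * (B - y)" .
    then have "7 \<le> 12 * m" using sx(1) by (simp add: m_def pos_le_divide_eq)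
    then have "7 * (15 * q) \<le> (12 * m) * (s' - s)" using sx q by (intro mult_mono) auto
    then have "105 * q \<le> 12 * (m * (s' - s))" by simp
    moreover have "v s' - y \<le> 4 * q" using vs y \<eta> by linarith
    ultimately show ?thesis using q by (simp add: l_def)
  qed
  have "l s = y" by (simp add: l_def)
  have cross: "least_cost \<Lambda> s y b Y + energy \<Lambda> s' x1 v g
      \<le> least_cost \<Lambda> s' (v s') b Y + (energy \<Lambda> s x1 l (\<lambda>_. m) + ennreal \<eta>)"
    using least_cost_crossing[OF nm _ x1(1) x1b l \<open>l x1 = v x1\<close> \<open>v s' \<le> l s'\<close> Y] sx q
    unfolding \<open>l s = y\<close> by simp
  have E2: "ennreal (N * (8 * q) - 16 * q) \<le> energy \<Lambda> s' x1 v g"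
  proof -
    have vx: "has_density s' x1 v g" by (rule has_density_subinterval[OF v order_refl x1b])
    have "8 * q \<le> v x1 - v s'" using vs x1(3) \<eta> q by auto
    also have "\<dots> \<le> integral {s'..x1} (\<lambda>x. \<bar>g x\<bar>)"
      using has_density_increment_le[OF vx order_refl x1(1) order_refl] by linarith
    finally have "N * (8 * q) \<le> N * integral {s'..x1} (\<lambda>x. \<bar>g x\<bar>)" using N by (intro mult_left_mono)
    then have "ennreal (N * (8 * q)) \<le> ennreal (N * integral {s'..x1} (\<lambda>x. \<bar>g x\<bar>))" by (rule ennreal_leI)
    also have "\<dots> \<le> energy \<Lambda> s' x1 v g + ennreal (c * (x1 - s'))"
      by (rule energy_coercive[OF vx x1(1) c(1) N c(2)])
    also have "\<dots> \<le> energy \<Lambda> s' x1 v g + ennreal (16 * q)"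
    proof (intro add_left_mono ennreal_leI)
      have "c * (x1 - s') \<le> (M / 2) * (32 * q / M)" using x1 z M c(1) by (intro mult_mono) auto
      also have "\<dots> = 16 * q" using M0 by simp
      finally show "c * (x1 - s') \<le> 16 * q" .
    qed
    finally have "ennreal (N * (8 * q)) - ennreal (16 * q) \<le> energy \<Lambda> s' x1 v g"
      by (simp add: ennreal_minus_le_iff add.commute)
    then show ?thesis using q by (simp add: ennreal_minus)
  qed
  have E1: "energy \<Lambda> s x1 l (\<lambda>_. m) + ennreal \<eta> \<le> ennreal (C * (24 * q) + q)"
  proof -
    have "C * (x1 - s) \<le> C * (24 * q)" using C(1) sx by (intro mult_left_mono) auto
    then have "energy \<Lambda> s x1 l (\<lambda>_. m) \<le> ennreal (C * (24 * q))" using el by (meson ennreal_leI order_trans)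
    then have "energy \<Lambda> s x1 l (\<lambda>_. m) + ennreal \<eta> \<le> ennreal (C * (24 * q)) + ennreal q"
      using \<eta> by (intro add_mono ennreal_leI)
    also have "\<dots> = ennreal (C * (24 * q) + q)" using C(1) q by (intro ennreal_plus[symmetric]) auto
    finally show ?thesis .
  qed
  have "N * (8 * q) - 16 * q = (C * (24 * q) + q) + \<kappa> * (16 * q) + (C * (8 * q) + 15 * q)"
    unfolding \<kappa>(2) by (simp add: algebra_simps)
  moreover have "0 \<le> C * (8 * q) + 15 * q" using C(1) q by simp
  ultimately have "(C * (24 * q) + q) + \<kappa> * (16 * q) \<le> N * (8 * q) - 16 * q" by linarith
  then have "ennreal ((C * (24 * q) + q) + \<kappa> * (16 * q)) \<le> energy \<Lambda> s' x1 v g"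
    using E2 by (meson ennreal_leI order_trans)
  then have "ennreal (C * (24 * q) + q) + ennreal (\<kappa> * (16 * q)) \<le> energy \<Lambda> s' x1 v g"
    using C(1) q \<kappa>(1) by (subst (asm) ennreal_plus) auto
  then have "least_cost \<Lambda> s y b Y + (ennreal (C * (24 * q) + q) + ennreal (\<kappa> * (16 * q)))
      \<le> least_cost \<Lambda> s' (v s') b Y + ennreal (C * (24 * q) + q)"
    using cross E1 by (meson add_left_mono order_trans)
  then have "ennreal (C * (24 * q) + q) + (least_cost \<Lambda> s y b Y + ennreal (\<kappa> * (16 * q)))
      \<le> ennreal (C * (24 * q) + q) + least_cost \<Lambda> s' (v s') b Y"
    by (simp add: ac_simps)
  then show ?thesis by (auto simp: ennreal_add_left_cancel_le)
qed

end

section \<open>The set of right singular points has empty interior\<close>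

context coercive_lagrangian
begin

text \<open>
  The near minimizer starts slightly to the right of \<open>t\<close> and inherits from \<open>u\<close> the height near \<open>t\<close> and
  the rise up to \<open>t + z\<close>.
\<close>

lemma near_min_from_singular_point:
  assumes lnm: "locally_near_min \<Lambda> t (t + 4 * D) u" and uR: "\<And>x. x \<in> {t..t + 4 * D} \<Longrightarrow> \<bar>u x\<bar> \<le> R"
    and ut: "u t = y0" and steep: "\<And>x. \<lbrakk>t \<le> x; x \<le> t + 4 * D; x - t \<le> \<delta>\<rbrakk> \<Longrightarrow> M * (x - t) \<le> u x - u t"
    and \<eta>: "0 < \<eta>" "\<eta> \<le> 1" "\<eta> \<le> D" and z: "\<eta> < z" "z \<le> \<delta>" "z \<le> D" and b: "t + 2 * D \<le> b" "b < t + 4 * D"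
  shows "\<exists>s v g. t < s \<and> s < t + \<eta> \<and> near_min \<Lambda> \<eta> s b v g \<and> \<bar>v s - y0\<bar> \<le> 2 * \<eta> \<and> \<bar>v b\<bar> \<le> R + 1
     \<and> y0 + M * z - \<eta> \<le> v (t + z)"
proof -
  have "continuous_on {t..t + 4 * D} u" using lnm by (simp add: locally_near_min_def)
  moreover have "t \<in> {t..t + 4 * D}" using \<eta> by simp
  ultimately obtain \<rho> where \<rho>: "\<rho> > 0" "\<And>x. x \<in> {t..t + 4 * D} \<Longrightarrow> dist x t < \<rho> \<Longrightarrow> dist (u x) (u t) < \<eta>"
    using \<eta>(1) unfolding continuous_on_iff by blast
  have "t < min (t + \<eta>) (t + \<rho>)" using \<rho>(1) \<eta>(1) by simp
  then obtain s where s: "t < s" "s < min (t + \<eta>) (t + \<rho>)" using dense by blast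
  have sb: "s \<le> b" using s \<eta> b by auto
  obtain v g where v: "near_min \<Lambda> \<eta> s b v g" "\<forall>x\<in>{s..b}. \<bar>v x - u x\<bar> \<le> \<eta>"
    using lnm s(1) sb b(2) \<eta>(1) unfolding locally_near_min_def by blast
  have "\<bar>u s - y0\<bar> < \<eta>" using \<rho>(2)[of s] s \<eta> ut by (simp add: dist_real_def)
  then have "\<bar>v s - y0\<bar> \<le> 2 * \<eta>" using v(2)[rule_format, of s] sb by auto
  moreover have "\<bar>v b\<bar> \<le> R + 1"
    using v(2)[rule_format, of b] uR[of b] sb b \<eta> by auto
  moreover have "y0 + M * z - \<eta> \<le> v (t + z)"
  proof -
    have "M * z \<le> u (t + z) - y0" using steep[of "t + z"] z \<eta> ut by simp
    moreover have "\<bar>v (t + z) - u (t + z)\<bar> \<le> \<eta>" using s z b \<eta> by (intro v(2)[rule_format]) auto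
    ultimately show ?thesis by linarith
  qed
  ultimately show ?thesis using s v(1) by auto
qed

text \<open>
  Chaining steps of length \<open>16 q = \<l> / n\<close> along the segment lowers the value function by \<open>\<kappa> \<l> = A + \<l>\<close>, although
  it is nonnegative and at most \<open>A\<close> at the right end of the segment.
\<close>

lemma no_singular_segment:
  assumes D: "0 < D" and \<l>: "0 < \<l>" "\<l> \<le> D"
    and sing: "\<And>t. t \<in> {t0..t0 + \<l>} \<Longrightarrow> \<exists>u. locally_near_min \<Lambda> t (t + 4 * D) u \<and>
        (\<forall>x\<in>{t..t + 4 * D}. \<bar>u x\<bar> \<le> R) \<and> u t = y0 \<and>
        filterlim (\<lambda>x. (u x - u t) / (x - t)) at_top (at t within {t..t + 4 * D})"
  shows False
proof -
  have y0R: "\<bar>y0\<bar> \<le> R"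
  proof -
    obtain u where "\<forall>x\<in>{t0..t0 + 4 * D}. \<bar>u x\<bar> \<le> R" "u t0 = y0" using sing[of t0] \<l> by auto
    then show ?thesis using D by force
  qed
  then have R0: "0 \<le> R" by linarith
  define b where "b = t0 + 3 * D"
  define R' where "R' = \<bar>t0\<bar> + 5 * D + R"
  define M1 where "M1 = 2 * (R + 1) / D"
  obtain CA where CA: "CA \<ge> 0" "\<And>x y p. \<bar>x\<bar> \<le> R' \<Longrightarrow> \<bar>y\<bar> \<le> R + 1 \<Longrightarrow> \<bar>p\<bar> \<le> M1 \<Longrightarrow> \<Lambda> (x, y, p) \<le> CA"
    by (fact bounded_choice)
  define A where "A = CA * (3 * D)"
  have A0: "0 \<le> A" using CA(1) D by (simp add: A_def)
  (* chosen so that the total gain \<kappa> \<l> exceeds the upper bound A of the value function *)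
  define \<kappa> where "\<kappa> = A / \<l> + 1"
  have \<kappa>0: "0 \<le> \<kappa>" using A0 \<l> by (simp add: \<kappa>_def)
  obtain C where C: "C \<ge> 0" "\<And>x y p. \<bar>x\<bar> \<le> R' \<Longrightarrow> \<bar>y\<bar> \<le> \<bar>y0\<bar> + 2 \<Longrightarrow> \<bar>p\<bar> \<le> 2 \<Longrightarrow> \<Lambda> (x, y, p) \<le> C"
    by (fact bounded_choice)
  (* per unit of step length the steep part costs at least N/2 - 1, the line at most 2 C *)
  define N where "N = 2 * (2 * C + 2 + \<kappa>)"
  have N0: "0 \<le> N" using C(1) \<kappa>0 by (simp add: N_def)
  obtain c where c: "c \<ge> 0" "\<And>x y p. N * \<bar>p\<bar> \<le> \<Lambda> (x, y, p) + c" using coercive[of N] by blast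
  define M where "M = 4 + 2 * c"
  have M: "4 \<le> M" "2 * c \<le> M" "0 < M" using c(1) by (auto simp: M_def)
  obtain \<delta> where \<delta>: "\<delta> > 0"
    and steep: "\<And>a b u x. \<lbrakk>locally_near_min \<Lambda> a b u; \<bar>a\<bar> \<le> R'; \<bar>b\<bar> \<le> R'; \<And>x. x \<in> {a..b} \<Longrightarrow> \<bar>u x\<bar> \<le> R';
       filterlim (\<lambda>x. (u x - u a) / (x - a)) at_top (at a within {a..b});
       a \<le> x; x \<le> b; x - a \<le> \<delta>\<rbrakk> \<Longrightarrow> M * (x - a) \<le> u x - u a"
    by (fact uniformly_steep[OF M(3)])
  obtain n :: nat where n: "\<l> / min 1 \<delta> \<le> n" using real_arch_simple by blast
  have "0 < \<l> / min 1 \<delta>" using \<l> \<delta> by simp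
  then have n0: "0 < real n" using n by linarith
  define q where "q = \<l> / (16 * real n)"
  have nq: "real n * (16 * q) = \<l>" using n0 by (simp add: q_def)
  have q0: "0 < q" using \<l> n0 by (simp add: q_def)
  have q1: "16 * q \<le> min 1 \<delta>"
  proof -
    have "\<l> \<le> real n * min 1 \<delta>" using n \<delta> by (simp add: pos_divide_le_eq)
    then have "real n * (16 * q) \<le> real n * min 1 \<delta>" using nq by simp
    then show ?thesis using n0 by simp
  qed
  have q\<l>: "16 * q \<le> \<l>"
  proof -
    have "1 \<le> real n" using n0 by simp
    then have "1 * (16 * q) \<le> real n * (16 * q)" using q0 by (intro mult_right_mono) auto
    then show ?thesis using nq by simp
  qed
  define z where "z = 32 * q / M"
  have zM: "M * z = 32 * q" using M by (simp add: z_def)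
  have "4 * z \<le> M * z" using M q0 by (intro mult_right_mono) (auto simp: z_def)
  then have z8: "z \<le> 8 * q" using zM by linarith
  (* the minimizers rise by 32 q within the time z, after the near minimizers have started *)
  define \<eta> where "\<eta> = min q (z / 2)"
  have z0: "0 < z" using q0 M by (simp add: z_def)
  have \<eta>: "0 < \<eta>" "\<eta> \<le> q" "\<eta> < z" using q0 z0 by (auto simp: \<eta>_def min_def)
  have M\<eta>: "M * \<eta> \<le> 16 * q"
  proof -
    have "M * \<eta> \<le> M * (z / 2)" using M by (intro mult_left_mono) (auto simp: \<eta>_def)
    then show ?thesis using zM by simp
  qed
  have small: "\<eta> \<le> 1" "\<eta> \<le> D" "z \<le> \<delta>" "z \<le> D" using \<eta> q0 q1 q\<l> \<l> z8 by auto
  define T where "T i = t0 + real i * (16 * q)" for i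
  have T: "T i \<in> {t0..t0 + \<l>}" if "i \<le> n" for i
  proof -
    have "real i * (16 * q) \<le> real n * (16 * q)" using that q0 by (intro mult_right_mono) auto
    then show ?thesis using nq q0 by (simp add: T_def)
  qed
  have "\<exists>s v g. T i < s \<and> s < T i + \<eta> \<and> near_min \<Lambda> \<eta> s b v g \<and> \<bar>v s - y0\<bar> \<le> 2 * \<eta> \<and> \<bar>v b\<bar> \<le> R + 1
     \<and> y0 + M * z - \<eta> \<le> v (T i + z)" if "i \<le> n" for i
  proof -
    note Ti = T[OF that]
    obtain u where u: "locally_near_min \<Lambda> (T i) (T i + 4 * D) u" "\<forall>x\<in>{T i..T i + 4 * D}. \<bar>u x\<bar> \<le> R" "u (T i) = y0"
        "filterlim (\<lambda>x. (u x - u (T i)) / (x - T i)) at_top (at (T i) within {T i..T i + 4 * D})"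
      using sing[OF Ti] by (elim exE conjE) (rule that)
    show ?thesis
    proof (rule near_min_from_singular_point[OF u(1) _ u(3) _ \<eta>(1) small(1,2) \<eta>(3) small(3,4)])
      show "\<bar>u x\<bar> \<le> R" if "x \<in> {T i..T i + 4 * D}" for x using u(2) that by blast
      show "M * (x - T i) \<le> u x - u (T i)" if "T i \<le> x" "x \<le> T i + 4 * D" "x - T i \<le> \<delta>" for x
      proof (rule steep[OF u(1) _ _ _ u(4) that])
        show "\<bar>T i\<bar> \<le> R'" "\<bar>T i + 4 * D\<bar> \<le> R'" using Ti \<l> D R0 by (auto simp: R'_def)
        show "\<bar>u x\<bar> \<le> R'" if "x \<in> {T i..T i + 4 * D}" for x
        proof -
          have "\<bar>u x\<bar> \<le> R" using u(2) that by blast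
          then show ?thesis using D by (simp add: R'_def)
        qed
      qed
    qed (use Ti \<l> D in \<open>auto simp: b_def\<close>)
  qed
  then obtain S V G where SV: "\<And>i. i \<le> n \<Longrightarrow> T i < S i \<and> S i < T i + \<eta> \<and> near_min \<Lambda> \<eta> (S i) b (V i) (G i) \<and>
     \<bar>V i (S i) - y0\<bar> \<le> 2 * \<eta> \<and> \<bar>V i b\<bar> \<le> R + 1 \<and> y0 + M * z - \<eta> \<le> V i (T i + z)"
    by metis
  define W where "W i = least_cost \<Lambda> (S i) (V i (S i)) b (R + 1)" for i
  have step: "W i + ennreal (\<kappa> * (16 * q)) \<le> W (Suc i)" if "i < n" for i
  proof -
    have TS: "T (Suc i) = T i + 16 * q" by (simp add: T_def algebra_simps)
    note A = SV[OF less_imp_le[OF that]] and B = SV[OF Suc_leI[OF that]]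
    have in1: "T i \<in> {t0..t0 + \<l>}" "T i + 16 * q \<in> {t0..t0 + \<l>}"
      using T[of i] T[of "Suc i"] that TS by auto
    show ?thesis
      unfolding W_def
    proof (rule horizontal_step[OF q0 _ N0 c C M(1,2) \<kappa>0 N_def \<eta>(1,2) M\<eta>])
      show "T i < S i" "S i < T i + \<eta>" "\<bar>V i (S i) - y0\<bar> \<le> 2 * \<eta>" using A by auto
      show "T i + 16 * q < S (Suc i)" "S (Suc i) < T i + 16 * q + \<eta>" "near_min \<Lambda> \<eta> (S (Suc i)) b (V (Suc i)) (G (Suc i))"
        "\<bar>V (Suc i) (S (Suc i)) - y0\<bar> \<le> 2 * \<eta>" using B TS by auto
      show "y0 + 32 * q - \<eta> \<le> V (Suc i) (T i + 16 * q + 32 * q / M)" using B TS zM by (simp add: z_def)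
      show "V (Suc i) b \<le> R + 1" using B by auto
      show "T i + 24 * q \<le> b" using in1 \<l> D q\<l> q0 by (auto simp: b_def)
      show "\<bar>T i\<bar> \<le> R'" "\<bar>b\<bar> \<le> R'" using in1 \<l> D R0 by (auto simp: R'_def b_def)
      show "16 * q \<le> 1" using q1 by simp
    qed
  qed
  have chain: "W 0 + ennreal (real i * (\<kappa> * (16 * q))) \<le> W i" if "i \<le> n" for i
    using that
  proof (induction i)
    case (Suc i)
    have "W 0 + ennreal (real (Suc i) * (\<kappa> * (16 * q)))
        = (W 0 + ennreal (real i * (\<kappa> * (16 * q)))) + ennreal (\<kappa> * (16 * q))"
      using \<kappa>0 q0 by (simp add: add.assoc ennreal_plus[symmetric] algebra_simps del: ennreal_plus)
    also have "\<dots> \<le> W i + ennreal (\<kappa> * (16 * q))" using Suc by (intro add_right_mono) auto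
    also have "\<dots> \<le> W (Suc i)" using Suc.prems by (intro step) auto
    finally show ?case .
  qed simp
  have "W n \<le> ennreal (CA * (b - S n))"
    unfolding W_def
  proof (rule least_cost_affine_le[OF _ _ _ _ CA(1), where R = "R + 1" and M = M1])
    note A = SV[OF order_refl] and Tn = T[OF order_refl]
    have bS: "D \<le> b - S n" using A Tn \<l> small(2) by (auto simp: b_def)
    then show "S n < b" using D by simp
    have "V n (S n) \<le> R + 1 \<and> - (R + 1) \<le> V n (S n)" using A y0R \<eta>(2) q1 q0 by (auto simp: abs_le_iff)
    then show VR: "\<bar>V n (S n)\<bar> \<le> R + 1" by (simp add: abs_le_iff)
    show "\<bar>R + 1\<bar> \<le> R + 1" using R0 by simp
    have "\<bar>R + 1 - V n (S n)\<bar> \<le> 2 * (R + 1)" using VR by (auto simp: abs_le_iff)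
    also have "\<dots> = M1 * D" using D by (simp add: M1_def)
    also have "\<dots> \<le> M1 * (b - S n)" using bS R0 D by (intro mult_left_mono) (auto simp: M1_def)
    finally show "\<bar>R + 1 - V n (S n)\<bar> \<le> M1 * (b - S n)" .
    show "\<Lambda> (x, y, p) \<le> CA" if "x \<in> {S n..b}" "\<bar>y\<bar> \<le> R + 1" "\<bar>p\<bar> \<le> M1" for x y p
    proof (rule CA(2)[OF _ that(2,3)])
      have "t0 \<le> x" "x \<le> t0 + 3 * D" using that(1) A Tn by (auto simp: b_def)
      then show "\<bar>x\<bar> \<le> R'" using D R0 by (auto simp: R'_def)
    qed
  qed
  also have "\<dots> \<le> ennreal A"
  proof (rule ennreal_leI)
    have "b - S n \<le> 3 * D" using SV[OF order_refl] T[OF order_refl] by (auto simp: b_def)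
    then show "CA * (b - S n) \<le> A" using CA(1) unfolding A_def by (intro mult_left_mono) auto
  qed
  finally have "W n \<le> ennreal A" .
  have "ennreal (real n * (\<kappa> * (16 * q))) \<le> W 0 + ennreal (real n * (\<kappa> * (16 * q)))"
    by (rule add_increasing) auto
  also have "\<dots> \<le> W n" by (rule chain[OF order_refl])
  also note \<open>W n \<le> ennreal A\<close>
  finally have "ennreal (real n * (\<kappa> * (16 * q))) \<le> ennreal A" .
  then have "real n * (\<kappa> * (16 * q)) \<le> A" using A0 by simp
  moreover have "real n * (\<kappa> * (16 * q)) = A + \<l>"
  proof -
    have "real n * (\<kappa> * (16 * q)) = \<kappa> * (real n * (16 * q))" by simp
    also have "\<dots> = \<kappa> * \<l>" by (simp only: nq)
    also have "\<dots> = A + \<l>" using \<l> by (simp add: \<kappa>_def field_simps)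
    finally show ?thesis .
  qed
  ultimately show False using \<l> by linarith
qed

end

lemma interior_right_singular_set:
  assumes L: "lagrangian L" "locally_lipschitz_in_y L" and "0 < d"
  shows "interior (right_singular_set L R d) = {}"
proof (rule ccontr)
  assume "interior (right_singular_set L R d) \<noteq> {}"
  then obtain t0 y0 where "(t0, y0) \<in> interior (right_singular_set L R d)" by auto
  then obtain e where e: "e > 0" "ball (t0, y0) e \<subseteq> right_singular_set L R d"
    using mem_interior by blast
  obtain B where B: "B \<ge> 0" "\<And>z. - B \<le> L z" and coer: "coercive_lagrangian (\<lambda>z. L z + B)"
    by (fact lagrangian_coercive_lagrangian[OF L])
  interpret coercive_lagrangian "\<lambda>z. L z + B" by (rule coer)
  have Lb: "L \<in> borel_measurable borel" using L(1) unfolding lagrangian_def by blast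
  define D where "D = d / 4"
  have D: "0 < D" "d = 4 * D" using \<open>0 < d\<close> by (auto simp: D_def)
  define \<l> where "\<l> = min D (e / 2)"
  have \<l>: "0 < \<l>" "\<l> \<le> D" "\<l> < e" using D e by (auto simp: \<l>_def min_def)
  show False
  proof (rule no_singular_segment[OF D(1) \<l>(1,2)])
    fix t assume "t \<in> {t0..t0 + \<l>}"
    then have "(t, y0) \<in> ball (t0, y0) e" using \<l>(3) by (simp add: dist_Pair_Pair dist_real_def)
    then have "(t, y0) \<in> right_singular_set L R d" using e(2) by blast
    then obtain u where u: "generalized_minimizer L u t (t + d)" "\<forall>x\<in>{t..t + d}. \<bar>u x\<bar> \<le> R" "u t = y0"
        "filterlim (\<lambda>x. (u x - u t) / (x - t)) at_top (at t within {t..t + d})"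
      unfolding right_singular_set_def mem_Collect_eq prod.case by (elim conjE exE) (rule that)
    have "locally_near_min (\<lambda>z. L z + B) t (t + d) u"
      by (rule generalized_minimizer_locally_near_min[OF Lb B coer u(1)])
    with u show "\<exists>u. locally_near_min (\<lambda>z. L z + B) t (t + 4 * D) u \<and>
        (\<forall>x\<in>{t..t + 4 * D}. \<bar>u x\<bar> \<le> R) \<and> u t = y0 \<and>
        filterlim (\<lambda>x. (u x - u t) / (x - t)) at_top (at t within {t..t + 4 * D})"
      unfolding D(2) by (intro exI[of _ u] conjI)
  qed
qed

section \<open>Reflections and the universal singular set\<close>

text \<open>
  Here \<open>c\<close> and \<open>\<sigma>\<close> are signs, and slopes change by the sign \<open>c \<sigma>\<close>.
\<close>

definition reflect_lagrangian ::
    "real \<Rightarrow> real \<Rightarrow> (real \<times> real \<times> real \<Rightarrow> real) \<Rightarrow> real \<times> real \<times> real \<Rightarrow> real" where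
  "reflect_lagrangian c \<sigma> L = (\<lambda>(x, y, p). L (c * x, \<sigma> * y, c * \<sigma> * p))"

definition reflect_curve :: "real \<Rightarrow> real \<Rightarrow> (real \<Rightarrow> real) \<Rightarrow> real \<Rightarrow> real" where
  "reflect_curve c \<sigma> u = (\<lambda>x. \<sigma> * u (c * x))"

lemma sign_mult:
  assumes "c \<in> {1, -1::real}" shows "c * (c * x) = x" "\<bar>c * x\<bar> = \<bar>x\<bar>" "c \<noteq> 0" "c * c = 1"
  using assms by auto

lemma reflect_lagrangian_involution:
  assumes "c \<in> {1, -1}" "\<sigma> \<in> {1, -1}"
  shows "reflect_lagrangian c \<sigma> (reflect_lagrangian c \<sigma> L) = L"
  using assms by (auto simp: reflect_lagrangian_def)

lemma reflect_curve_involution: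
  assumes "c \<in> {1, -1}" "\<sigma> \<in> {1, -1}"
  shows "reflect_curve c \<sigma> (reflect_curve c \<sigma> u) = u"
  using assms by (auto simp: reflect_curve_def)

lemma reflect_lagrangian_lagrangian:
  assumes L: "lagrangian L" and c: "c \<in> {1, -1}" and \<sigma>: "\<sigma> \<in> {1, -1}"
  shows "lagrangian (reflect_lagrangian c \<sigma> L)"
proof -
  let ?T = "\<lambda>(x, y, p). (c * x, \<sigma> * y, c * \<sigma> * p)" and ?L = "reflect_lagrangian c \<sigma> L"
  have eq: "?L z = L (?T z)" for z by (simp add: reflect_lagrangian_def split: prod.split)
  have T: "continuous_on UNIV ?T" unfolding split_beta by (intro continuous_intros)
  have "L \<in> borel_measurable borel" using L unfolding lagrangian_def by blast
  then have "(\<lambda>z. L (?T z)) \<in> borel_measurable borel"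
    by (rule measurable_compose[OF borel_measurable_continuous_onI[OF T]])
  then have 1: "?L \<in> borel_measurable borel" by (simp only: eq[abs_def])
  have "bdd_below (range L)" using L by (simp add: lagrangian_def)
  moreover have "range ?L \<subseteq> range L" using eq by auto
  ultimately have 2: "bdd_below (range ?L)" by (rule bdd_below_mono)
  have 3: "\<forall>z. \<exists>U. open U \<and> z \<in> U \<and> bdd_above (?L ` U)"
  proof
    fix z
    obtain U where U: "open U" "?T z \<in> U" "bdd_above (L ` U)" using L unfolding lagrangian_def by blast
    have "open (?T -` U)" using T U(1) by (rule open_vimage[rotated])
    moreover have "?L ` (?T -` U) \<subseteq> L ` U" using eq by auto
    then have "bdd_above (?L ` (?T -` U))" by (rule bdd_above_mono[OF U(3)])
    ultimately show "\<exists>U. open U \<and> z \<in> U \<and> bdd_above (?L ` U)" using U(2) by (intro exI[of _ "?T -` U"]) simp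
  qed
  obtain \<omega> where \<omega>: "superlinear \<omega>" "\<And>x y p. \<omega> p \<le> L (x, y, p)" using L unfolding lagrangian_def by blast
  have abs1: "\<bar>c * \<sigma> * p\<bar> = \<bar>p\<bar>" for p using c \<sigma> by auto
  have "superlinear (\<lambda>p. \<omega> (c * \<sigma> * p))"
    unfolding superlinear_def
  proof -
    have "filterlim (\<lambda>p. c * \<sigma> * p) at_infinity at_infinity"
      using c \<sigma> by (intro tendsto_mult_filterlim_at_infinity[OF tendsto_const] filterlim_ident) auto
    from filterlim_compose[OF \<omega>(1)[unfolded superlinear_def] this]
    show "LIM p at_infinity. \<omega> (c * \<sigma> * p) / \<bar>p\<bar> :> at_top" unfolding abs1 .
  qed
  moreover have "\<forall>x y p. \<omega> (c * \<sigma> * p) \<le> ?L (x, y, p)" using \<omega>(2) by (simp add: reflect_lagrangian_def)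
  ultimately show ?thesis using 1 2 3 unfolding lagrangian_def by blast
qed

lemma reflect_lagrangian_lipschitz:
  assumes L: "locally_lipschitz_in_y L" and c: "c \<in> {1, -1}" and \<sigma>: "\<sigma> \<in> {1, -1}"
  shows "locally_lipschitz_in_y (reflect_lagrangian c \<sigma> L)"
  unfolding locally_lipschitz_in_y_def
proof (intro allI impI)
  fix R :: real assume "R > 0"
  then obtain C where C: "C \<ge> 0" "\<forall>x y1 y2 p. \<bar>x\<bar> \<le> R \<and> \<bar>y1\<bar> \<le> R \<and> \<bar>y2\<bar> \<le> R \<and> \<bar>p\<bar> \<le> R \<longrightarrow>
     \<bar>L (x, y1, p) - L (x, y2, p)\<bar> \<le> C * \<bar>y1 - y2\<bar>" using L unfolding locally_lipschitz_in_y_def by blast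
  show "\<exists>C\<ge>0. \<forall>x y1 y2 p. \<bar>x\<bar> \<le> R \<and> \<bar>y1\<bar> \<le> R \<and> \<bar>y2\<bar> \<le> R \<and> \<bar>p\<bar> \<le> R \<longrightarrow>
     \<bar>reflect_lagrangian c \<sigma> L (x, y1, p) - reflect_lagrangian c \<sigma> L (x, y2, p)\<bar> \<le> C * \<bar>y1 - y2\<bar>"
  proof (intro exI[of _ C] conjI allI impI C(1))
    fix x y1 y2 p assume *: "\<bar>x\<bar> \<le> R \<and> \<bar>y1\<bar> \<le> R \<and> \<bar>y2\<bar> \<le> R \<and> \<bar>p\<bar> \<le> R"
    have "\<bar>c * \<sigma> * p\<bar> = \<bar>p\<bar>" "\<bar>\<sigma> * y1 - \<sigma> * y2\<bar> = \<bar>y1 - y2\<bar>" using c \<sigma> by auto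
    then show "\<bar>reflect_lagrangian c \<sigma> L (x, y1, p) - reflect_lagrangian c \<sigma> L (x, y2, p)\<bar> \<le> C * \<bar>y1 - y2\<bar>"
      using C(2)[rule_format, of "c * x" "\<sigma> * y1" "\<sigma> * y2" "c * \<sigma> * p"] *
        sign_mult(2)[OF c] sign_mult(2)[OF \<sigma>] by (simp add: reflect_lagrangian_def)
  qed
qed

text \<open>
  The end points of the interval \<open>c \<cdot> [a, b]\<close>.
\<close>

abbreviation "lo c a b \<equiv> min (c * a) (c * b :: real)"
abbreviation "hi c a b \<equiv> max (c * a) (c * b :: real)"

lemma lo_hi_involution:
  assumes "c \<in> {1, -1}" "a \<le> b"
  shows "lo c (lo c a b) (hi c a b) = a" "hi c (lo c a b) (hi c a b) = b"
  using assms by (auto simp: min_def max_def)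

lemma reflect_mem_Icc:
  assumes "c \<in> {1, -1}" "a \<le> b"
  shows "c * x \<in> {a..b} \<longleftrightarrow> x \<in> {lo c a b..hi c a b}"
  using assms by (auto simp: min_def max_def)

lemma reflect_mem_Ioo:
  assumes "c \<in> {1, -1}" "a \<le> b"
  shows "c * x \<in> {a<..<b} \<longleftrightarrow> x \<in> {lo c a b<..<hi c a b}"
  using assms by (auto simp: min_def max_def)

lemma has_density_reflect_curve:
  assumes u: "has_density a b u g" and "a \<le> b" and c: "c \<in> {1, -1}" and \<sigma>: "\<sigma> \<in> {1, -1}"
  shows "has_density (lo c a b) (hi c a b) (reflect_curve c \<sigma> u) (\<lambda>x. c * \<sigma> * g (c * x))"
proof -
  have s: "has_density p q (\<lambda>x. \<sigma> * v x) (\<lambda>x. \<sigma> * h x)" if "has_density p q v h" for p q v h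
    using \<sigma> that has_density_uminus[OF that] by auto
  consider "c = 1" | "c = -1" using c by auto
  then show ?thesis
  proof cases
    case 1
    then show ?thesis using s[OF u] \<open>a \<le> b\<close> by (simp add: reflect_curve_def min_def max_def)
  next
    case 2
    then show ?thesis using s[OF has_density_reflect[OF u \<open>a \<le> b\<close>]] \<open>a \<le> b\<close>
      by (auto simp: reflect_curve_def min_def max_def)
  qed
qed

lemma energy_reflect:
  assumes \<Lambda>: "\<Lambda> \<in> borel_measurable borel" and u: "has_density a b u g" and "a \<le> b"
    and c: "c \<in> {1, -1}" and \<sigma>: "\<sigma> \<in> {1, -1}"
  shows "energy (reflect_lagrangian c \<sigma> \<Lambda>) (lo c a b) (hi c a b) (reflect_curve c \<sigma> u) (\<lambda>x. c * \<sigma> * g (c * x))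
     = energy \<Lambda> a b u g"
proof -
  let ?f = "\<lambda>x. ennreal (\<Lambda> (x, u x, g x)) * indicator {a..b} x"
  note reflect_mem_Icc[OF c \<open>a \<le> b\<close>]
  moreover have "\<Lambda> (x, \<sigma> * (\<sigma> * y), c * \<sigma> * (c * \<sigma> * p)) = \<Lambda> (x, y, p)" for x y p
    using c \<sigma> by auto
  ultimately have eq: "energy (reflect_lagrangian c \<sigma> \<Lambda>) (lo c a b) (hi c a b) (reflect_curve c \<sigma> u) (\<lambda>x. c * \<sigma> * g (c * x))
      = (\<integral>\<^sup>+x. ?f (0 + c * x) \<partial>lebesgue)"
    unfolding energy_def by (intro nn_integral_cong) (auto simp: reflect_lagrangian_def reflect_curve_def indicator_def)
  have "(\<integral>\<^sup>+x. ?f x \<partial>lebesgue) = ennreal \<bar>c\<bar> * (\<integral>\<^sup>+x. ?f (0 + c * x) \<partial>lebesgue)"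
    by (rule nn_integral_real_affine_lebesgue[OF energy_measurable[OF \<Lambda> u] sign_mult(3)[OF c]])
  moreover have "\<bar>c\<bar> = 1" using c by auto
  ultimately show ?thesis unfolding eq by (simp add: energy_def)
qed

lemma action_reflect:
  assumes L: "lagrangian L" and u: "abs_cont a b u" "a < b" and c: "c \<in> {1, -1}" and \<sigma>: "\<sigma> \<in> {1, -1}"
  shows "abs_cont (lo c a b) (hi c a b) (reflect_curve c \<sigma> u)"
    and "action (reflect_lagrangian c \<sigma> L) (reflect_curve c \<sigma> u) (lo c a b) (hi c a b) = action L u a b"
proof -
  obtain g where g: "has_density a b u g" using abs_cont_imp_has_density[OF u(2,1)] .
  have ab: "a \<le> b" using u(2) by simp
  note rg = has_density_reflect_curve[OF g ab c \<sigma>]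
  show "abs_cont (lo c a b) (hi c a b) (reflect_curve c \<sigma> u)" by (rule has_density_imp_abs_cont[OF rg])
  have "bdd_below (range L)" using L by (simp add: lagrangian_def)
  then obtain m where m: "\<And>z. m \<le> L z" by (auto simp: bdd_below_def)
  define B where "B = \<bar>m\<bar>"
  have B: "B \<ge> 0" "- B \<le> L z" for z using m[of z] by (auto simp: B_def)
  let ?L = "reflect_lagrangian c \<sigma> L"
  have B': "- B \<le> ?L z" for z using B(2) by (simp add: reflect_lagrangian_def split: prod.split)
  have Lb: "L \<in> borel_measurable borel" using L unfolding lagrangian_def by blast
  have Lb': "?L \<in> borel_measurable borel"
    using reflect_lagrangian_lagrangian[OF L c \<sigma>] unfolding lagrangian_def by blast
  have \<Lambda>: "(\<lambda>z. L z + B) \<in> borel_measurable borel" using Lb by (intro borel_measurable_add borel_measurable_const)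
  have eq: "(\<lambda>z. ?L z + B) = reflect_lagrangian c \<sigma> (\<lambda>z. L z + B)"
    by (auto simp: reflect_lagrangian_def)
  have "hi c a b - lo c a b = b - a" using c ab by (auto simp: min_def max_def)
  moreover have "lo c a b \<le> hi c a b" by simp
  ultimately show "action ?L (reflect_curve c \<sigma> u) (lo c a b) (hi c a b) = action L u a b"
    unfolding action_eq_energy[OF Lb B g ab] action_eq_energy[OF Lb' B(1) B' rg \<open>lo c a b \<le> hi c a b\<close>] eq
      energy_reflect[OF \<Lambda> g ab c \<sigma>] by simp
qed

text \<open>
  Equality follows by applying this to the reflected data, because reflections are involutions.
\<close>

lemma least_action_reflect_le:
  assumes L: "lagrangian L" and "a < b" and c: "c \<in> {1, -1}" and \<sigma>: "\<sigma> \<in> {1, -1}"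
  shows "least_action (reflect_lagrangian c \<sigma> L) (lo c a b) (reflect_curve c \<sigma> u (lo c a b))
     (hi c a b) (reflect_curve c \<sigma> u (hi c a b)) \<le> least_action L a (u a) b (u b)"
  unfolding least_action_def
proof (rule INF_greatest)
  fix v assume v: "v \<in> {v. abs_cont a b v \<and> v a = u a \<and> v b = u b}"
  then have ac: "abs_cont a b v" by simp
  have "c * lo c a b \<in> {a, b}" "c * hi c a b \<in> {a, b}" using c by (auto simp: min_def max_def)
  then have "reflect_curve c \<sigma> v (lo c a b) = reflect_curve c \<sigma> u (lo c a b)"
    "reflect_curve c \<sigma> v (hi c a b) = reflect_curve c \<sigma> u (hi c a b)"
    using v by (auto simp: reflect_curve_def)
  then show "(INF v\<in>{v. abs_cont (lo c a b) (hi c a b) v \<and> v (lo c a b) = reflect_curve c \<sigma> u (lo c a b) \<and>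
      v (hi c a b) = reflect_curve c \<sigma> u (hi c a b)}. action (reflect_lagrangian c \<sigma> L) v (lo c a b) (hi c a b))
      \<le> action L v a b"
    using action_reflect[OF L ac assms(2) c \<sigma>] by (intro INF_lower2[of "reflect_curve c \<sigma> v"]) auto
qed

lemma excess_reflect:
  assumes L: "lagrangian L" and u: "abs_cont a b u" "a < b" and c: "c \<in> {1, -1}" and \<sigma>: "\<sigma> \<in> {1, -1}"
  shows "excess (reflect_lagrangian c \<sigma> L) (reflect_curve c \<sigma> u) (lo c a b) (hi c a b) = excess L u a b"
proof -
  have ab: "a \<le> b" using u(2) by simp
  have lh: "lo c a b < hi c a b" using c u(2) by auto
  have "least_action L a (u a) b (u b) \<le> least_action (reflect_lagrangian c \<sigma> L) (lo c a b) (reflect_curve c \<sigma> u (lo c a b))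
     (hi c a b) (reflect_curve c \<sigma> u (hi c a b))"
    using least_action_reflect_le[OF reflect_lagrangian_lagrangian[OF L c \<sigma>] lh c \<sigma>, of "reflect_curve c \<sigma> u"]
    unfolding reflect_lagrangian_involution[OF c \<sigma>] reflect_curve_involution[OF c \<sigma>] lo_hi_involution[OF c ab] .
  then show ?thesis
    using least_action_reflect_le[OF L u(2) c \<sigma>, of u]
    unfolding excess_def action_reflect(2)[OF L u c \<sigma>] by simp
qed

lemma generalized_minimizer_reflect:
  assumes L: "lagrangian L" and u: "generalized_minimizer L u a b" and "a \<le> b"
    and c: "c \<in> {1, -1}" and \<sigma>: "\<sigma> \<in> {1, -1}"
  shows "generalized_minimizer (reflect_lagrangian c \<sigma> L) (reflect_curve c \<sigma> u) (lo c a b) (hi c a b)"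
proof -
  obtain us as bs where H: "(\<forall>n. as n < bs n \<and> abs_cont (as n) (bs n) (us n)) \<and>
        (\<lambda>n. excess L (us n) (as n) (bs n)) \<longlonglongrightarrow> 0 \<and>
        (\<forall>K. compact K \<and> K \<subseteq> {a<..<b} \<longrightarrow>
           (\<forall>\<^sub>F n in sequentially. K \<subseteq> {as n..bs n}) \<and> uniform_limit K us u sequentially)"
    using u unfolding generalized_minimizer_def by (elim conjE exE) (rule that, intro conjI)
  have ac: "abs_cont (as n) (bs n) (us n)" "as n < bs n" for n using H by auto
  let ?vs = "\<lambda>n. reflect_curve c \<sigma> (us n)"
  have cont: "continuous_on {lo c a b..hi c a b} (reflect_curve c \<sigma> u)"
  proof -
    have u': "continuous_on {a..b} u" using u unfolding generalized_minimizer_def by (rule conjunct1)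
    have sub: "(\<lambda>x. c * x) ` {lo c a b..hi c a b} \<subseteq> {a..b}"
      unfolding image_subset_iff using reflect_mem_Icc[OF c \<open>a \<le> b\<close>] by blast
    have "continuous_on {lo c a b..hi c a b} (\<lambda>x. c * x)" by (intro continuous_intros)
    from continuous_on_compose2[OF u' this sub] show ?thesis unfolding reflect_curve_def by (intro continuous_on_mult_left)
  qed
  have lim: "(\<forall>\<^sub>F n in sequentially. K \<subseteq> {lo c (as n) (bs n)..hi c (as n) (bs n)}) \<and>
      uniform_limit K ?vs (reflect_curve c \<sigma> u) sequentially"
    if K: "compact K" "K \<subseteq> {lo c a b<..<hi c a b}" for K
  proof -
    let ?K = "(\<lambda>x. c * x) ` K"
    have "compact ?K" by (intro compact_continuous_image continuous_intros K(1))
    moreover have "?K \<subseteq> {a<..<b}" unfolding image_subset_iff using K(2) reflect_mem_Ioo[OF c \<open>a \<le> b\<close>] by blast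
    ultimately have *: "(\<forall>\<^sub>F n in sequentially. ?K \<subseteq> {as n..bs n})" "uniform_limit ?K us u sequentially"
      using H by blast+
    have "\<forall>\<^sub>F n in sequentially. K \<subseteq> {lo c (as n) (bs n)..hi c (as n) (bs n)}"
      using *(1)
    proof eventually_elim
      case (elim n)
      show ?case
      proof
        fix x assume "x \<in> K"
        then have "c * x \<in> {as n..bs n}" using elim by blast
        then show "x \<in> {lo c (as n) (bs n)..hi c (as n) (bs n)}" by (rule reflect_mem_Icc[OF c less_imp_le[OF ac(2)], THEN iffD1])
      qed
    qed
    moreover have "uniform_limit K ?vs (reflect_curve c \<sigma> u) sequentially"
      unfolding uniform_limit_iff
    proof (intro allI impI)
      fix e :: real assume "e > 0"
      then have "\<forall>\<^sub>F n in sequentially. \<forall>x\<in>?K. dist (us n x) (u x) < e"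
        using *(2) unfolding uniform_limit_iff by blast
      moreover have "dist (\<sigma> * y) (\<sigma> * z) = dist y z" for y z using \<sigma> by (auto simp: dist_real_def)
      ultimately show "\<forall>\<^sub>F n in sequentially. \<forall>x\<in>K. dist (?vs n x) (reflect_curve c \<sigma> u x) < e"
        by (simp add: reflect_curve_def)
    qed
    ultimately show ?thesis ..
  qed
  have ex: "(\<lambda>n. excess (reflect_lagrangian c \<sigma> L) (?vs n) (lo c (as n) (bs n)) (hi c (as n) (bs n))) \<longlonglongrightarrow> 0"
    using H unfolding excess_reflect[OF L ac c \<sigma>] by blast
  have ac': "lo c (as n) (bs n) < hi c (as n) (bs n) \<and> abs_cont (lo c (as n) (bs n)) (hi c (as n) (bs n)) (?vs n)" for n
    using action_reflect(1)[OF L ac c \<sigma>, of n] ac(2)[of n] c by auto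
  have lim': "\<forall>K. compact K \<and> K \<subseteq> {lo c a b<..<hi c a b} \<longrightarrow>
     (\<forall>\<^sub>F n in sequentially. K \<subseteq> {lo c (as n) (bs n)..hi c (as n) (bs n)}) \<and>
     uniform_limit K ?vs (reflect_curve c \<sigma> u) sequentially"
    by (rule allI, rule impI, elim conjE) (rule lim)
  show ?thesis
    unfolding generalized_minimizer_def
    by (rule conjI[OF cont], (rule exI)+) (rule conjI[OF allI[OF ac'] conjI[OF ex lim']])
qed

lemma filterlim_reflect_quotient:
  assumes c: "c \<in> {1, -1}" and lim: "filterlim (\<lambda>x. c * \<sigma> * ((u x - u x0) / (x - x0))) F (at x0 within S)"
    and sub: "\<And>x. x \<in> S' \<Longrightarrow> c * x \<in> S"
  shows "filterlim (\<lambda>x. (reflect_curve c \<sigma> u x - reflect_curve c \<sigma> u (c * x0)) / (x - c * x0)) F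
     (at (c * x0) within S')"
proof -
  have "filterlim (\<lambda>x. c * x) (at x0 within S) (at (c * x0) within S')"
    unfolding filterlim_at
  proof
    have "((\<lambda>x. c * x) \<longlongrightarrow> c * (c * x0)) (at (c * x0) within S')" by (intro tendsto_intros)
    then show "((\<lambda>x. c * x) \<longlongrightarrow> x0) (at (c * x0) within S')" by (simp add: sign_mult(1)[OF c])
    show "\<forall>\<^sub>F x in at (c * x0) within S'. c * x \<in> S \<and> c * x \<noteq> x0"
      unfolding eventually_at using sub sign_mult(1)[OF c] by (intro exI[of _ 1]) auto
  qed
  from filterlim_compose[OF lim this]
  have "filterlim (\<lambda>x. c * \<sigma> * ((u (c * x) - u x0) / (c * x - x0))) F (at (c * x0) within S')" .
  moreover have "c * \<sigma> * ((u (c * x) - u x0) / (c * x - x0))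
      = (reflect_curve c \<sigma> u x - reflect_curve c \<sigma> u (c * x0)) / (x - c * x0)" for x
    using c by (auto simp: reflect_curve_def sign_mult(1)[OF c] divide_simps) (auto simp: algebra_simps)
  ultimately show ?thesis by simp
qed

definition reflected_singular_set ::
    "(real \<times> real \<times> real \<Rightarrow> real) \<Rightarrow> real \<times> real \<times> nat \<Rightarrow> (real \<times> real) set" where
  "reflected_singular_set L = (\<lambda>(c, \<sigma>, m). (\<lambda>(x, y). (c * x, \<sigma> * y)) -`
     right_singular_set (reflect_lagrangian c \<sigma> L) (real (Suc m)) (1 / real (Suc m)))"

text \<open>
  If \<open>x0\<close> is not the right end point of the interval of a minimizer, part of the interval lies to the right of
  \<open>x0\<close>; otherwise a reflection in \<open>x\<close> makes \<open>x0\<close> a left end point. The sign \<open>\<sigma>\<close> is chosen so that the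
  reflected derivative is \<open>+\<infinity>\<close>.
\<close>

lemma universal_singular_set_eq:
  assumes L: "lagrangian L"
  shows "universal_singular_set L = (\<Union>i\<in>{1, -1} \<times> {1, -1} \<times> UNIV. reflected_singular_set L i)"
proof (intro set_eqI iffI)
  fix z assume "z \<in> universal_singular_set L"
  then obtain x0 y0 a b u where z: "z = (x0, y0)" and ab: "a \<le> x0" "x0 \<le> b" "a < b"
    and u: "generalized_minimizer L u a b" "u x0 = y0" "infinite_derivative_within u x0 {a..b}"
    unfolding universal_singular_set_def by auto
  define c :: real where "c = (if x0 < b then 1 else -1)"
  have c: "c \<in> {1, -1}" by (auto simp: c_def)
  define Q where "Q x = (u x - u x0) / (x - x0)" for x
  obtain \<tau> where \<tau>: "\<tau> \<in> {1, -1::real}" "filterlim (\<lambda>x. \<tau> * Q x) at_top (at x0 within {a..b})"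
  proof -
    from u(3) consider "filterlim Q at_top (at x0 within {a..b})" | "filterlim Q at_bot (at x0 within {a..b})"
      unfolding infinite_derivative_within_def Q_def by blast
    then show thesis
    proof cases
      case 1
      then show thesis by (intro that[of 1]) auto
    next
      case 2
      then show thesis by (intro that[of "-1"]) (auto simp: filterlim_uminus_at_bot)
    qed
  qed
  define \<sigma> where "\<sigma> = c * \<tau>"
  have \<sigma>: "\<sigma> \<in> {1, -1}" "c * \<sigma> = \<tau>" using c \<tau>(1) by (auto simp: \<sigma>_def)
  have start: "lo c x0 (if c = 1 then b else a) = c * x0" "c * x0 < hi c a b" "lo c a b \<le> c * x0"
    using ab by (auto simp: c_def min_def max_def)
  let ?L = "reflect_lagrangian c \<sigma> L" and ?v = "reflect_curve c \<sigma> u"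
  have v: "generalized_minimizer ?L ?v (lo c a b) (hi c a b)"
    using ab by (intro generalized_minimizer_reflect[OF L u(1) _ c \<sigma>(1)]) simp
  have cont: "continuous_on {lo c a b..hi c a b} ?v" using v unfolding generalized_minimizer_def by (rule conjunct1)
  have "compact (?v ` {lo c a b..hi c a b})" by (rule compact_continuous_image[OF cont compact_Icc])
  then obtain R where R: "\<And>x. x \<in> {lo c a b..hi c a b} \<Longrightarrow> \<bar>?v x\<bar> \<le> R"
    by (fastforce dest!: compact_imp_bounded simp: bounded_iff)
  obtain m :: nat where m: "max (max R \<bar>x0\<bar>) (1 / (hi c a b - c * x0)) \<le> m" using real_arch_simple by blast
  define d where "d = 1 / real (Suc m)"
  have mR: "R \<le> real (Suc m)" "\<bar>x0\<bar> \<le> real (Suc m)" using m by auto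
  have "1 / (hi c a b - c * x0) \<le> real (Suc m)" using m by auto
  then have "1 \<le> real (Suc m) * (hi c a b - c * x0)" using start(2) by (simp only: pos_divide_le_eq diff_gt_0_iff_gt)
  then have d: "0 < d" "c * x0 + d \<le> hi c a b" by (auto simp: d_def field_simps)
  have sub: "{c * x0..c * x0 + d} \<subseteq> {lo c a b..hi c a b}" using start(3) d by auto
  have "(c * x0, \<sigma> * y0) \<in> right_singular_set ?L (real (Suc m)) d"
    unfolding right_singular_set_def mem_Collect_eq prod.case
  proof (intro conjI exI[of _ ?v])
    show "\<bar>c * x0\<bar> \<le> real (Suc m)" using mR(2) sign_mult(2)[OF c] by simp
    show "generalized_minimizer ?L ?v (c * x0) (c * x0 + d)"
      by (rule generalized_minimizer_subinterval[OF v start(3) d(2)])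
    show "\<forall>x\<in>{c * x0..c * x0 + d}. \<bar>?v x\<bar> \<le> real (Suc m)" using R sub mR(1) by fastforce
    show "?v (c * x0) = \<sigma> * y0" using u(2) by (simp add: reflect_curve_def sign_mult(1)[OF c])
    show "filterlim (\<lambda>x. (?v x - ?v (c * x0)) / (x - c * x0)) at_top (at (c * x0) within {c * x0..c * x0 + d})"
    proof (rule filterlim_reflect_quotient[OF c])
      show "filterlim (\<lambda>x. c * \<sigma> * ((u x - u x0) / (x - x0))) at_top (at x0 within {a..b})"
        using \<tau>(2) unfolding \<sigma>(2) Q_def .
      show "c * x \<in> {a..b}" if "x \<in> {c * x0..c * x0 + d}" for x
      proof -
        have "x \<in> {lo c a b..hi c a b}" using that sub by blast
        then show ?thesis using reflect_mem_Icc[OF c less_imp_le[OF ab(3)]] by blast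
      qed
    qed
  qed
  then have "z \<in> reflected_singular_set L (c, \<sigma>, m)" by (simp add: reflected_singular_set_def z d_def)
  with c \<sigma>(1) show "z \<in> (\<Union>i\<in>{1, -1} \<times> {1, -1} \<times> UNIV. reflected_singular_set L i)" by blast
next
  fix z assume "z \<in> (\<Union>i\<in>{1, -1} \<times> {1, -1} \<times> UNIV. reflected_singular_set L i)"
  then obtain c \<sigma> m where c: "c \<in> {1, -1}" and \<sigma>: "\<sigma> \<in> {1, -1}" and z: "z \<in> reflected_singular_set L (c, \<sigma>, m)"
    by auto
  obtain x0 y0 where z0: "z = (x0, y0)" by (cases z)
  define d where "d = 1 / real (Suc m)"
  have d: "d > 0" by (simp add: d_def)
  let ?L = "reflect_lagrangian c \<sigma> L"
  have "(c * x0, \<sigma> * y0) \<in> right_singular_set ?L (real (Suc m)) d"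
    using z by (simp add: reflected_singular_set_def z0 d_def)
  then obtain v where v: "generalized_minimizer ?L v (c * x0) (c * x0 + d)" "v (c * x0) = \<sigma> * y0"
    "filterlim (\<lambda>x. (v x - v (c * x0)) / (x - c * x0)) at_top (at (c * x0) within {c * x0..c * x0 + d})"
    unfolding right_singular_set_def mem_Collect_eq prod.case by (elim conjE exE) (rule that)
  let ?a = "lo c (c * x0) (c * x0 + d)" and ?b = "hi c (c * x0) (c * x0 + d)" and ?u = "reflect_curve c \<sigma> v"
  have u: "generalized_minimizer L ?u ?a ?b"
    using generalized_minimizer_reflect[OF reflect_lagrangian_lagrangian[OF L c \<sigma>] v(1) _ c \<sigma>] d
    unfolding reflect_lagrangian_involution[OF c \<sigma>] by simp
  have ab: "?a \<le> x0" "x0 \<le> ?b" "?a < ?b" using c d by (auto simp: min_def max_def)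
  have ux0: "?u x0 = y0" using v(2) sign_mult(1)[OF \<sigma>] by (simp add: reflect_curve_def)
  have inside: "c * x \<in> {c * x0..c * x0 + d}" if "x \<in> {?a..?b}" for x
    using that c d by (auto simp: min_def max_def split: if_splits)
  have x0: "c * (c * x0) = x0" by (rule sign_mult(1)[OF c])
  have "infinite_derivative_within ?u x0 {?a..?b}"
  proof (cases "c * \<sigma> = 1")
    case True
    then have "filterlim (\<lambda>x. c * \<sigma> * ((v x - v (c * x0)) / (x - c * x0))) at_top (at (c * x0) within {c * x0..c * x0 + d})"
      using v(3) by simp
    from filterlim_reflect_quotient[OF c this inside]
    show ?thesis unfolding infinite_derivative_within_def x0 by blast
  next
    case False
    then have "c * \<sigma> = -1" using c \<sigma> by auto
    then have "filterlim (\<lambda>x. c * \<sigma> * ((v x - v (c * x0)) / (x - c * x0))) at_bot (at (c * x0) within {c * x0..c * x0 + d})"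
      using v(3)[unfolded filterlim_uminus_at_top] by (simp only: mult_minus1)
    from filterlim_reflect_quotient[OF c this inside]
    show ?thesis unfolding infinite_derivative_within_def x0 by blast
  qed
  note facts = ab u ux0 this
  show "z \<in> universal_singular_set L"
    unfolding universal_singular_set_def z0 mem_Collect_eq prod.case
    by (rule exI[of _ ?a], rule exI[of _ ?b], rule exI[of _ ?u]) (intro conjI facts)
qed

lemma closed_reflected_singular_set:
  assumes "lagrangian L" "locally_lipschitz_in_y L" "i \<in> {1, -1} \<times> {1, -1} \<times> UNIV"
  shows "closed (reflected_singular_set L i)" "interior (reflected_singular_set L i) = {}"
proof -
  obtain c \<sigma> m where i: "i = (c, \<sigma>, m)" and c: "c \<in> {1, -1}" and \<sigma>: "\<sigma> \<in> {1, -1}" using assms(3) by auto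
  let ?T = "\<lambda>(x, y). (c * x, \<sigma> * y)"
  let ?S = "right_singular_set (reflect_lagrangian c \<sigma> L) (real (Suc m)) (1 / real (Suc m))"
  have T: "continuous_on UNIV ?T" unfolding split_beta by (intro continuous_intros)
  have TT: "?T (?T z) = z" for z using sign_mult(1)[OF c] sign_mult(1)[OF \<sigma>] by (auto split: prod.split)
  have eq: "reflected_singular_set L i = ?T -` ?S" by (simp add: reflected_singular_set_def i)
  note L' = reflect_lagrangian_lagrangian[OF assms(1) c \<sigma>] reflect_lagrangian_lipschitz[OF assms(2) c \<sigma>]
  have "closed ?S" by (rule closed_right_singular_set[OF L']) simp
  then show "closed (reflected_singular_set L i)" unfolding eq using T by (rule closed_vimage)
  have S: "interior ?S = {}" by (rule interior_right_singular_set[OF L']) simp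
  show "interior (reflected_singular_set L i) = {}"
  proof (rule ccontr)
    assume "interior (reflected_singular_set L i) \<noteq> {}"
    then obtain U z where U: "open U" "U \<subseteq> ?T -` ?S" "z \<in> U" unfolding eq interior_def by auto
    have "open (?T -` U)" using U(1) T by (rule open_vimage)
    moreover have "?T -` U \<subseteq> ?S"
    proof
      fix w assume "w \<in> ?T -` U"
      then have "?T (?T w) \<in> ?S" using U(2) by blast
      then show "w \<in> ?S" by (simp only: TT)
    qed
    moreover have "?T z \<in> ?T -` U" using U(3) TT by (simp only: vimage_eq)
    ultimately have "?T z \<in> interior ?S" by (meson interiorI)
    then show False using S by simp
  qed
qed

theorem theorem3p4:
  fixes L :: "real \<times> real \<times> real \<Rightarrow> real"
  assumes "lagrangian L"
    and "\<forall>R>0. \<exists>C\<ge>0. \<forall>x y1 y2 p.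
           \<bar>x\<bar> \<le> R \<and> \<bar>y1\<bar> \<le> R \<and> \<bar>y2\<bar> \<le> R \<and> \<bar>p\<bar> \<le> R \<longrightarrow>
           \<bar>L (x, y1, p) - L (x, y2, p)\<bar> \<le> C * \<bar>y1 - y2\<bar>"
  shows "fsigma (universal_singular_set L) \<and> first_category (universal_singular_set L)"
proof -
  have lip: "locally_lipschitz_in_y L" using assms(2) unfolding locally_lipschitz_in_y_def .
  let ?I = "{1, -1} \<times> {1, -1} \<times> (UNIV :: nat set)"
  define f :: "nat \<Rightarrow> real \<times> real \<times> nat" where "f = from_nat_into ?I"
  have f: "range f = ?I" unfolding f_def by (rule range_from_nat_into) auto
  define F where "F n = reflected_singular_set L (f n)" for n
  have fI: "f n \<in> ?I" for n using f by blast
  have F: "closed (F n)" "interior (F n) = {}" for n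
    unfolding F_def by (rule closed_reflected_singular_set[OF assms(1) lip fI])+
  have eq: "universal_singular_set L = (\<Union>n. F n)"
    unfolding universal_singular_set_eq[OF assms(1)] f[symmetric] F_def by simp
  have "fsigma (universal_singular_set L)" unfolding eq by (rule fsigma.intros) (rule F(1))
  moreover have "nowhere_dense (F n)" for n unfolding nowhere_dense_def using F[of n] by simp
  then have "first_category (universal_singular_set L)" unfolding first_category_def eq by blast
  ultimately show ?thesis ..
qed

end
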